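(* Let $f\colon M^n\to\mathbb{R}^{n+p}$, $n\geq 2p+3$, be an isometric immersion of a Riemannian manifold with codimension $1\leq p\leq 4$. Assume that the conformal $s$-nullities of $f$ at any point of $M^n$ satisfy $\nu_s^c\leq n-2s-1$ for all $1\leq s\leq p$. Then $f$ is conformally infinitesimally rigid, that is, every conformal infinitesimal bending of $f$ is trivial.
   Context: Let $\alpha\colon TM\times TM\to N_fM$ be the second fundamental form of an isometric immersion $f\colon M^n\to\mathbb{R}^m$. For $x\in M^n$ and $1\leq s\leq m-n$, the conformal $s$-nullity is $$\nu_s^c(x)=\max\{\dim\mathcal{N}(\alpha_{U^s}-\langle\,,\rangle\zeta)(x)\colon U^s\subset N_fM(x)\ \text{an $s$-dimensional subspace},\ \zeta\in U^s\},$$ where $\alpha_{U^s}=\pi_{U^s}\circ\alpha$ with $\pi_{U^s}\colon N_fM(x)\to U^s$ the orthogonal projection, and $$\mathcal{N}(\alpha_{U^s}-\langle\,,\rangle\zeta)(x)=\{Y\in T_xM\colon\alpha_{U^s}(Y,X)-\langle Y,X\rangle\zeta=0\ \text{for all }X\in T_xM\}.$$ With $\tilde\nabla$ the flat connection of $\mathbb{R}^m$, a conformal infinitesimal bending of $f$ with conformal factor $\rho\in C^\infty(M)$ is a smooth section $\mathcal{T}\in\Gamma(f^*T\mathbb{R}^m)$ with $\langle\tilde\nabla_X\mathcal{T},f_*Y\rangle+\langle f_*X,\tilde\nabla_Y\mathcal{T}\rangle=2\rho\langle X,Y\rangle$ for all $X,Y\in\mathfrak{X}(M)$. It is trivial if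 it is locally the restriction to the submanifold of a conformal Killing vector field of $\mathbb{R}^m$, i.e. locally $\mathcal{T}(x)=(\langle f(x),v\rangle+\lambda)f(x)-\frac12\|f(x)\|^2v+\mathcal{D}f(x)+w$ with $\lambda\in\mathbb{R}$, $v,w\in\mathbb{R}^m$ and $\mathcal{D}\in\mathrm{End}(\mathbb{R}^m)$ skew-symmetric. *)

theory Defs
  imports "HOL-Analysis.Analysis"
begin

subsection \<open>Smooth maps between Euclidean spaces\<close>

text \<open>
  Only meant for open \<open>S\<close>: there the Frechet derivative at a point of \<open>S\<close> depends on the values
  of \<open>h\<close> in \<open>S\<close> alone.
\<close>

primrec k_smooth_on ::
  "nat \<Rightarrow> 'a::euclidean_space set \<Rightarrow> ('a \<Rightarrow> 'b::euclidean_space) \<Rightarrow> bool" where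
  "k_smooth_on 0 S h \<longleftrightarrow> continuous_on S h"
| "k_smooth_on (Suc k) S h \<longleftrightarrow>
     (\<forall>z\<in>S. h differentiable (at z)) \<and>
     (\<forall>v. k_smooth_on k S (\<lambda>z. frechet_derivative h (at z) v))"

definition smooth_on :: "'a::euclidean_space set \<Rightarrow> ('a \<Rightarrow> 'b::euclidean_space) \<Rightarrow> bool" where
  "smooth_on S h \<longleftrightarrow> (\<forall>k. k_smooth_on k S h)"


subsection \<open>Smooth manifolds\<close>

text \<open>
  A chart \<open>(U, \<phi>)\<close> consists of an open subset of the manifold and a coordinate map, of which only
  the values on \<open>U\<close> matter. An atlas need not be maximal.
\<close>

type_synonym ('a, 'n) chart = "'a set \<times> ('a \<Rightarrow> real ^ 'n)"

definition chart_on :: "'a topology \<Rightarrow> ('a, 'n::finite) chart \<Rightarrow> bool" where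
  "chart_on M c \<longleftrightarrow>
     openin M (fst c) \<and> open (snd c ` fst c) \<and>
     homeomorphic_map (subtopology M (fst c)) (top_of_set (snd c ` fst c)) (snd c)"

definition in_chart :: "('a, 'n::finite) chart \<Rightarrow> ('a \<Rightarrow> 'b) \<Rightarrow> real ^ 'n \<Rightarrow> 'b" where
  "in_chart c h = h \<circ> inv_into (fst c) (snd c)"

definition smooth_manifold :: "'a topology \<Rightarrow> ('a, 'n::finite) chart set \<Rightarrow> bool" where
  "smooth_manifold M A \<longleftrightarrow>
     Hausdorff_space M \<and> second_countable M \<and>
     (\<forall>c\<in>A. chart_on M c) \<and> (\<Union>c\<in>A. fst c) = topspace M \<and>
     (\<forall>c\<in>A. \<forall>d\<in>A. smooth_on (snd c ` (fst c \<inter> fst d)) (in_chart c (snd d)))"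

definition smooth_map ::
  "('a, 'n::finite) chart set \<Rightarrow> ('a \<Rightarrow> 'b::euclidean_space) \<Rightarrow> bool" where
  "smooth_map A h \<longleftrightarrow> (\<forall>c\<in>A. smooth_on (snd c ` fst c) (in_chart c h))"

text \<open>
  A tangent vector at \<open>x\<close> is given by its coordinate vector \<open>u\<close> with respect to a chart \<open>c\<close> around
  \<open>x\<close>. For a vector-valued map \<open>h\<close> on the manifold, \<open>differential c h x u\<close> is the derivative of
  \<open>h\<close> in the direction of that tangent vector. Thus it is \<open>f\<^sub>* X\<close> for an immersion \<open>f\<close>, it is the
  flat covariant derivative along \<open>X\<close> for a section of the pull-back of the tangent bundle of the
  ambient Euclidean space, and \<open>differential c (snd d) x u\<close> is the coordinate vector with respect
  to another chart \<open>d\<close>.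
\<close>

definition differential ::
  "('a, 'n::finite) chart \<Rightarrow> ('a \<Rightarrow> 'b::euclidean_space) \<Rightarrow> 'a \<Rightarrow> real ^ 'n \<Rightarrow> 'b" where
  "differential c h x u = frechet_derivative (in_chart c h) (at (snd c x)) u"


subsection \<open>Riemannian manifolds and isometric immersions\<close>

text \<open>
  \<open>g c x u v\<close> is the inner product of the tangent vectors at \<open>x\<close> with coordinate vectors
  \<open>u\<close> and \<open>v\<close> with respect to \<open>c\<close>.
\<close>

type_synonym ('a, 'n) metric =
  "('a, 'n) chart \<Rightarrow> 'a \<Rightarrow> real ^ 'n \<Rightarrow> real ^ 'n \<Rightarrow> real"

definition riemannian_metric ::
  "('a, 'n::finite) chart set \<Rightarrow> ('a, 'n) metric \<Rightarrow> bool" where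
  "riemannian_metric A g \<longleftrightarrow>
     (\<forall>c\<in>A. \<forall>x\<in>fst c. bilinear (g c x) \<and> (\<forall>u v. g c x u v = g c x v u) \<and>
        (\<forall>u. u \<noteq> 0 \<longrightarrow> g c x u u > 0)) \<and>
     (\<forall>c\<in>A. \<forall>u v. smooth_on (snd c ` fst c) (in_chart c (\<lambda>x. g c x u v))) \<and>
     (\<forall>c\<in>A. \<forall>d\<in>A. \<forall>x\<in>fst c \<inter> fst d. \<forall>u v.
        g c x u v = g d x (differential c (snd d) x u) (differential c (snd d) x v))"

definition riemannian_manifold ::
  "'a topology \<Rightarrow> ('a, 'n::finite) chart set \<Rightarrow> ('a, 'n) metric \<Rightarrow> bool" where
  "riemannian_manifold M A g \<longleftrightarrow> smooth_manifold M A \<and> riemannian_metric A g"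

definition isometric_immersion ::
  "('a, 'n::finite) chart set \<Rightarrow> ('a, 'n) metric \<Rightarrow> ('a \<Rightarrow> real ^ 'm::finite) \<Rightarrow> bool" where
  "isometric_immersion A g f \<longleftrightarrow>
     smooth_map A f \<and>
     (\<forall>c\<in>A. \<forall>x\<in>fst c. inj (differential c f x) \<and>
        (\<forall>u v. differential c f x u \<bullet> differential c f x v = g c x u v))"


subsection \<open>Second fundamental form and conformal nullities\<close>

definition orth_proj :: "'b::euclidean_space set \<Rightarrow> 'b \<Rightarrow> 'b" where
  "orth_proj U w = (THE y. y \<in> U \<and> (\<forall>z\<in>U. orthogonal (w - y) z))"

definition normal_space ::
  "('a, 'n::finite) chart \<Rightarrow> ('a \<Rightarrow> real ^ 'm::finite) \<Rightarrow> 'a \<Rightarrow> (real ^ 'm) set" where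
  "normal_space c f x = orthogonal_comp (range (differential c f x))"

text \<open>
  The second fundamental form at \<open>X, Y\<close> is the normal part of the flat derivative of \<open>f\<^sub>* Y\<close>
  along \<open>X\<close>. Being tensorial, it may be computed by extending \<open>Y\<close> to the vector field whose
  coordinates with respect to \<open>c\<close> are constant.
\<close>

definition second_fundamental_form ::
  "('a, 'n::finite) chart \<Rightarrow> ('a \<Rightarrow> real ^ 'm::finite) \<Rightarrow> 'a \<Rightarrow> real ^ 'n \<Rightarrow> real ^ 'n \<Rightarrow> real ^ 'm"
  where
  "second_fundamental_form c f x u v =
     orth_proj (normal_space c f x) (differential c (\<lambda>y. differential c f y v) x u)"

definition nullity_space ::
  "('a, 'n::finite) chart \<Rightarrow> ('a, 'n) metric \<Rightarrow> ('a \<Rightarrow> real ^ 'm::finite) \<Rightarrow> 'a \<Rightarrow>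
   (real ^ 'm) set \<Rightarrow> real ^ 'm \<Rightarrow> (real ^ 'n) set" where
  "nullity_space c g f x U \<zeta> =
     {u. \<forall>v. orth_proj U (second_fundamental_form c f x u v) - g c x u v *\<^sub>R \<zeta> = 0}"

text \<open>
  The maximum also runs over the charts \<open>c\<close> around \<open>x\<close> in the atlas; this has no effect, since
  changing the chart transforms \<open>nullity_space\<close> by a linear isomorphism. It is a maximum over a
  nonempty set only if the normal spaces have dimension at least \<open>s\<close>.
\<close>

definition conformal_nullity ::
  "('a, 'n::finite) chart set \<Rightarrow> ('a, 'n) metric \<Rightarrow> ('a \<Rightarrow> real ^ 'm::finite) \<Rightarrow> nat \<Rightarrow> 'a \<Rightarrow> nat"
  where
  "conformal_nullity A g f s x =
     Max {dim (nullity_space c g f x U \<zeta>) | c U \<zeta>.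
            c \<in> A \<and> x \<in> fst c \<and> subspace U \<and> U \<subseteq> normal_space c f x \<and> dim U = s \<and> \<zeta> \<in> U}"


subsection \<open>Conformal infinitesimal bendings\<close>

definition conformal_infinitesimal_bending ::
  "('a, 'n::finite) chart set \<Rightarrow> ('a, 'n) metric \<Rightarrow> ('a \<Rightarrow> real ^ 'm::finite) \<Rightarrow>
   ('a \<Rightarrow> real) \<Rightarrow> ('a \<Rightarrow> real ^ 'm) \<Rightarrow> bool" where
  "conformal_infinitesimal_bending A g f \<rho> T \<longleftrightarrow>
     smooth_map A \<rho> \<and> smooth_map A T \<and>
     (\<forall>c\<in>A. \<forall>x\<in>fst c. \<forall>u v.
        differential c T x u \<bullet> differential c f x v + differential c f x u \<bullet> differential c T x v
          = 2 * \<rho> x * g c x u v)"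

definition conformal_killing_field :: "(real ^ 'm::finite \<Rightarrow> real ^ 'm) \<Rightarrow> bool" where
  "conformal_killing_field V \<longleftrightarrow>
     (\<exists>l v w D. linear D \<and> (\<forall>y z. D y \<bullet> z = - (y \<bullet> D z)) \<and>
        (\<forall>y. V y = (y \<bullet> v + l) *\<^sub>R y - ((1/2) * (norm y)\<^sup>2) *\<^sub>R v + D y + w))"

definition trivial_bending ::
  "'a topology \<Rightarrow> ('a \<Rightarrow> real ^ 'm::finite) \<Rightarrow> ('a \<Rightarrow> real ^ 'm) \<Rightarrow> bool" where
  "trivial_bending M f T \<longleftrightarrow>
     (\<forall>x\<in>topspace M. \<exists>W V. openin M W \<and> x \<in> W \<and> conformal_killing_field V \<and>
        (\<forall>y\<in>W. T y = V (f y)))"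

definition conformally_infinitesimally_rigid ::
  "'a topology \<Rightarrow> ('a, 'n::finite) chart set \<Rightarrow> ('a, 'n) metric \<Rightarrow>
   ('a \<Rightarrow> real ^ 'm::finite) \<Rightarrow> bool" where
  "conformally_infinitesimally_rigid M A g f \<longleftrightarrow>
     (\<forall>\<rho> T. conformal_infinitesimal_bending A g f \<rho> T \<longrightarrow> trivial_bending M f T)"

end

theory Submission
  imports Defs "HOL-Computational_Algebra.Polynomial"
begin

text \<open>
  Lift \<open>f\<close> to the light cone by \<open>F = (f, 1, \<bar>f\<bar>\<^sup>2)\<close>. A conformal bending of \<open>f\<close> becomes an
  isometric bending of \<open>F\<close> and, after lowering an index, a map \<open>G\<close> with \<open>F \<bullet> G = 0\<close> and
  \<open>F\<^sub>u \<bullet> G\<^sub>v + G\<^sub>u \<bullet> F\<^sub>v = 0\<close>; it is trivial iff \<open>G = \<Omega> F\<close> for a constant skew map \<open>\<Omega>\<close>.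
  The symmetric bilinear form \<open>\<theta> (u, v) = (F\<^sub>u\<^sub>v, G\<^sub>u\<^sub>v)\<close> is flat for the split form of signature
  \<open>(p + 1, p + 1)\<close> on the quotient by the isotropic first-order jets. A flat form that spans a
  nondegenerate space of dimension at most 10 has a nullity of at least the complementary dimension;
  applied modulo the radical of the span of \<open>\<theta>\<close>, this contradicts the nullity hypothesis unless
  \<open>\<theta>\<close> is null. Nullity of \<open>\<theta>\<close> yields a skew \<open>\<Omega>\<close> at each point matching the second-order jets
  of \<open>F\<close> and \<open>G\<close>. A symmetry argument shows that it matches third-order jets as well, so that it
  is locally constant.
\<close>


subsection \<open>Linear algebra\<close>

text \<open>Lifting replaces the pair of a subspace \<open>U\<close> and a vector
  \<open>\<zeta>\<close> by a single subspace \<open>Y\<close> normal to the first-order jets of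
  \<open>F\<close>: the last coordinate on \<open>Y\<close> encodes \<open>\<zeta>\<close>. Such a
  \<open>Y\<close> can have dimension \<open>p + 1\<close>, beyond the range of the nullity
  hypothesis; there the assumption \<open>n >= 2 p + 3\<close> takes over. The constant 10 is a
  dimension count: \<open>(F, G)\<close> lives in dimension \<open>2 (n + p + 2)\<close>, the
  first-order jets span an isotropic space of dimension \<open>n + 1\<close>, and
  \<open>2 (n + p + 2) - 2 (n + 1) = 2 (p + 1) <= 10\<close> for \<open>p <= 4\<close>. If the form
  were not null, the bound for flat forms would produce a \<open>Y\<close> of some dimension
  \<open>s\<close> with nullity at least \<open>n - 2 s\<close>, one more than the hypothesis
  allows. The obstacle in the flat-form bound is that the scalar product is indefinite, so images of
  \<open>\<theta> x\<close> may be highly degenerate; the total symmetry of the associated quartic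
  is the substitute for definiteness. The skew maps are found point by point without any regularity.
  Local constancy is therefore proved for the smooth defect from the map at one fixed point, through
  a linear differential inequality.\<close>

lemma linear_basis_sum:
  fixes L :: "'a::euclidean_space \<Rightarrow> 'b::real_vector"
  assumes "linear L"
  shows "L u = (\<Sum>i\<in>Basis. (u \<bullet> i) *\<^sub>R L i)"
proof -
  have "L u = L (\<Sum>i\<in>Basis. (u \<bullet> i) *\<^sub>R i)" by (simp add: euclidean_representation)
  then show ?thesis using assms by (simp add: linear_sum linear_scale)
qed

lemma dim_image_kernel:
  fixes L :: "'v::euclidean_space \<Rightarrow> 'w::euclidean_space"
  assumes "linear L" "subspace A"
  shows "dim (L ` A) + dim {x \<in> A. L x = 0} = dim A"
proof -
  let ?K = "{x \<in> A. L x = 0}"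
  have K: "subspace ?K"
    using assms by (auto simp: subspace_def linear_add linear_scale linear_0)
  let ?C = "{y \<in> A. \<forall>x\<in>?K. orthogonal x y}"
  have C: "subspace ?C"
    using assms(2) by (auto simp: subspace_def orthogonal_def inner_add_right)
  have 1: "dim ?C + dim ?K = dim A"
    by (rule dim_subspace_orthogonal_to_vectors[OF K assms(2)]) auto
  have inj: "inj_on L ?C"
  proof (rule inj_onI)
    fix x y assume xy: "x \<in> ?C" "y \<in> ?C" "L x = L y"
    have "x - y \<in> ?C" using C xy by (simp add: subspace_diff del: mem_Collect_eq)
    moreover have "x - y \<in> ?K"
      using xy assms by (auto simp: linear_diff subspace_diff)
    ultimately have "orthogonal (x - y) (x - y)" by blast
    then show "x = y" by (simp add: orthogonal_self)
  qed
  have "L ` A = L ` ?C"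
  proof
    show "L ` A \<subseteq> L ` ?C"
    proof
      fix w assume "w \<in> L ` A"
      then obtain x where x: "x \<in> A" "w = L x" by auto
      obtain y z where yz: "y \<in> span ?K" "\<And>w. w \<in> span ?K \<Longrightarrow> orthogonal z w" "x = y + z"
        using orthogonal_subspace_decomp_exists[of ?K x] by blast
      have y: "y \<in> ?K" using yz(1) K by (metis span_eq_iff)
      have "z \<in> A" using yz(3) x y assms(2) by (metis (mono_tags, lifting) add_diff_cancel_left' mem_Collect_eq subspace_diff)
      then have "z \<in> ?C" using yz(2) by (auto intro: span_base simp: orthogonal_commute)
      moreover have "L z = w" using yz(3) x y assms(1) by (auto simp: linear_add)
      ultimately show "w \<in> L ` ?C" by blast
    qed
  qed auto
  then have "dim (L ` A) = dim (L ` ?C)" by simp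
  also have "\<dots> = dim ?C"
    by (rule dim_image_eq[OF assms(1)]) (use inj C in \<open>simp add: span_eq_iff[THEN iffD2] del: mem_Collect_eq\<close>)
  finally show ?thesis using 1 by simp
qed

text \<open>Summing \<open>b x e\<close> times \<open>e\<close> over an orthonormal basis of
  \<open>A\<close> defines a linear map into \<open>A\<close>; the hypothesis is exactly its
  injectivity on \<open>B\<close>.\<close>

lemma dim_le_if_perp_trivial:
  fixes b :: "'w::euclidean_space \<Rightarrow> 'u::euclidean_space \<Rightarrow> real"
  assumes "bilinear b" "subspace A" "subspace B"
    and inj: "\<And>x. x \<in> B \<Longrightarrow> (\<And>y. y \<in> A \<Longrightarrow> b x y = 0) \<Longrightarrow> x = 0"
  shows "dim B \<le> dim A"
proof -
  obtain E where E: "E \<subseteq> A" "pairwise orthogonal E" "\<And>x. x \<in> E \<Longrightarrow> norm x = 1"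
    "independent E" "card E = dim A" "span E = A"
    using orthonormal_basis_subspace[OF assms(2)] by blast
  have finE: "finite E" using E(4) independent_bound by blast
  define L where "L x = (\<Sum>e\<in>E. b x e *\<^sub>R e)" for x
  have b: "linear (\<lambda>x. b x y)" "linear (b x)" for x y
    using assms(1) by (auto simp: bilinear_def)
  have L: "linear L"
    unfolding L_def
    by (intro linear_compose_sum ballI linearI)
       (simp_all add: linear_add[OF b(1)] linear_scale[OF b(1)] scaleR_add_left)
  have inner_e: "e \<bullet> e' = (if e = e' then 1 else 0)" if "e \<in> E" "e' \<in> E" for e e'
    using E(2,3) that by (auto simp: pairwise_def orthogonal_def norm_eq_1)
  have "inj_on L B"
  proof (rule inj_onI)
    fix x y assume xy: "x \<in> B" "y \<in> B" "L x = L y"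
    have 0: "L (x - y) = 0" using xy(3) by (simp add: linear_diff[OF L])
    have be: "b (x - y) e = 0" if "e \<in> E" for e
    proof -
      have "0 = L (x - y) \<bullet> e" using 0 by simp
      also have "\<dots> = (\<Sum>e'\<in>E. b (x - y) e' * (e' \<bullet> e))" by (simp add: L_def inner_sum_left)
      also have "\<dots> = (\<Sum>e'\<in>E. if e' = e then b (x - y) e' else 0)"
        by (rule sum.cong) (auto simp: inner_e that)
      also have "\<dots> = b (x - y) e" using finE that by simp
      finally show ?thesis by simp
    qed
    have "x - y = 0"
    proof (rule inj)
      show "x - y \<in> B" using assms(3) xy by (simp add: subspace_diff)
      fix z assume "z \<in> A"
      then have "z \<in> span E" using E by simp
      then show "b (x - y) z = 0"
        by (induction rule: span_induct_alt)
           (simp_all add: be linear_0[OF b(2)] linear_add[OF b(2)] linear_scale[OF b(2)])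
    qed
    then show "x = y" by simp
  qed
  then have "dim (L ` B) = dim B"
    by (intro dim_image_eq[OF L]) (use assms(3) in \<open>simp add: span_eq_iff[THEN iffD2]\<close>)
  moreover have "L ` B \<subseteq> A"
    using E(1) assms(2) by (auto simp: L_def intro!: subspace_sum subspace_scale)
  ultimately show ?thesis using dim_subset by metis
qed

text \<open>Let \<open>C\<close> be the Euclidean complement of \<open>A\<close> in
  \<open>S\<close>. An element of \<open>B\<close> already annihilates \<open>A\<close>, so if it
  also annihilates \<open>C\<close> it annihilates \<open>S\<close> and vanishes; hence
  \<open>dim B\<close> is at most \<open>dim C\<close>.\<close>

lemma dim_perp_add_le:
  fixes b :: "'w::euclidean_space \<Rightarrow> 'w \<Rightarrow> real"
  assumes "bilinear b" "subspace S" "subspace A" "subspace B" "A \<subseteq> S" "B \<subseteq> S"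
    and nondeg: "\<And>x. x \<in> S \<Longrightarrow> (\<And>y. y \<in> S \<Longrightarrow> b x y = 0) \<Longrightarrow> x = 0"
    and perp: "\<And>x y. x \<in> B \<Longrightarrow> y \<in> A \<Longrightarrow> b x y = 0"
  shows "dim A + dim B \<le> dim S"
proof -
  let ?C = "{y \<in> S. \<forall>x\<in>A. orthogonal x y}"
  have C: "subspace ?C"
    using assms(2) by (auto simp: subspace_def orthogonal_def inner_add_right)
  have 1: "dim ?C + dim A = dim S"
    by (rule dim_subspace_orthogonal_to_vectors) (use assms in auto)
  have "dim B \<le> dim ?C"
  proof (rule dim_le_if_perp_trivial[OF assms(1) C assms(4)])
    fix x assume x: "x \<in> B" and xC: "\<And>y. y \<in> ?C \<Longrightarrow> b x y = 0"
    show "x = 0"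
    proof (rule nondeg)
      show "x \<in> S" using x assms by blast
      fix y assume "y \<in> S"
      obtain u z where yz: "u \<in> span A" "\<And>w. w \<in> span A \<Longrightarrow> orthogonal z w" "y = u + z"
        using orthogonal_subspace_decomp_exists[of A y] by blast
      have u: "u \<in> A" using yz(1) assms(3) by (metis span_eq_iff)
      have "z \<in> S" using yz(3) u \<open>y \<in> S\<close> assms(2,5)
        by (metis add_diff_cancel_left' subsetD subspace_diff)
      then have "z \<in> ?C" using yz(2) by (auto intro: span_base simp: orthogonal_commute)
      then show "b x y = 0"
        using xC perp[OF x u] yz(3) assms(1) by (simp add: bilinear_radd)
    qed
  qed
  then show ?thesis using 1 by simp
qed

text \<open>Orders of vanishing at 0: differentiation lowers the order of a nonzero \<open>p\<close>
  by one, and \<open>q\<close> has order 0, so the two sides could not have the same order.\<close>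

lemma poly_proportional_if_wronskian_0:
  fixes p q :: "real poly"
  assumes "p * pderiv q = pderiv p * q" "poly p 0 = 0" "poly q 0 \<noteq> 0"
  shows "p = 0"
proof (rule ccontr)
  assume p: "p \<noteq> 0"
  have q: "q \<noteq> 0" using assms(3) by auto
  have dp: "pderiv p \<noteq> 0"
  proof
    assume "pderiv p = 0"
    then obtain h where "p = [:h:]" using pderiv_iszero by blast
    then show False using assms(2) p by simp
  qed
  then have nz: "pderiv p * q \<noteq> 0" using q by simp
  have "order 0 p = Suc (order 0 (pderiv p))"
    using order_pderiv[OF p assms(2)] .
  moreover have "order 0 q = 0" using assms(3) order_root by blast
  moreover have "order 0 (pderiv p * q) = order 0 (pderiv p) + order 0 q"
    using order_mult nz by blast
  moreover have "order 0 (p * pderiv q) = order 0 p + order 0 (pderiv q)"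
    using order_mult nz assms(1) by metis
  ultimately show False using assms(1) by simp
qed

text \<open>The hypothesis says that the quotient of \<open>f\<close> and \<open>g\<close> has vanishing derivative.\<close>

lemma dependent_if_proportional_derivatives:
  fixes f g :: "'v::real_vector \<Rightarrow> real" and f' g' :: "'v \<Rightarrow> 'v \<Rightarrow> real"
  assumes f: "\<And>y z. \<exists>P. \<forall>t. f (y + t *\<^sub>R z) = poly P t \<and> f' (y + t *\<^sub>R z) z = poly (pderiv P) t"
    and g: "\<And>y z. \<exists>P. \<forall>t. g (y + t *\<^sub>R z) = poly P t \<and> g' (y + t *\<^sub>R z) z = poly (pderiv P) t"
    and fg: "\<And>y z. f y * g' y z = g y * f' y z"
  shows "\<exists>a b. (a \<noteq> 0 \<or> b \<noteq> 0) \<and> (\<forall>y. a * f y + b * g y = 0)"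
proof (cases "\<forall>y. g y = 0")
  case True
  then show ?thesis by (intro exI[of _ 0] exI[of _ 1]) simp
next
  case False
  then obtain y where y: "g y \<noteq> 0" by blast
  have "g y * f x + (- f y) * g x = 0" for x
  proof -
    define z where "z = x - y"
    obtain P where P: "\<And>t. f (y + t *\<^sub>R z) = poly P t \<and> f' (y + t *\<^sub>R z) z = poly (pderiv P) t"
      using f[of y z] by blast
    obtain Q where Q: "\<And>t. g (y + t *\<^sub>R z) = poly Q t \<and> g' (y + t *\<^sub>R z) z = poly (pderiv Q) t"
      using g[of y z] by blast
    have eq: "P * pderiv Q = Q * pderiv P"
    proof (rule poly_eq_poly_eq_iff[THEN iffD1], rule ext)
      fix t
      show "poly (P * pderiv Q) t = poly (Q * pderiv P) t"
        using fg[of "y + t *\<^sub>R z" z] P[of t] Q[of t] by simp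
    qed
    \<comment> \<open>This combination vanishes at 0 and still has zero Wronskian with
      \<open>Q\<close>, where \<open>Q\<close> is nonzero at 0; evaluation at 1 then reaches the
      point \<open>x\<close>.\<close>
    define h where "h = smult (g y) P - smult (f y) Q"
    have "poly P 0 = f y" "poly Q 0 = g y" using P[of 0] Q[of 0] by auto
    then have "h = 0"
      by (intro poly_proportional_if_wronskian_0[of h Q])
         (use y eq in \<open>auto simp: h_def pderiv_diff pderiv_smult algebra_simps\<close>)
    then have "poly h 1 = 0" by simp
    moreover have "f x = poly P 1" "g x = poly Q 1" using P[of 1] Q[of 1] by (auto simp: z_def)
    ultimately show ?thesis by (simp add: h_def)
  qed
  then show ?thesis using y by blast
qed

text \<open>On \<open>E\<close> the map \<open>L0\<close> is bounded below by some \<open>e\<close>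
  times the norm, and \<open>L1\<close> is bounded above by \<open>C\<close> times the norm; the
  radius \<open>e / C\<close> keeps the first bound dominant.\<close>

lemma inj_on_perturb:
  fixes L0 L1 :: "'v::euclidean_space \<Rightarrow> 'w::euclidean_space"
  assumes L: "linear L0" "linear L1" and E: "subspace E" and inj: "inj_on L0 E"
  obtains \<epsilon> where "\<epsilon> > 0" "\<And>t. \<bar>t\<bar> < \<epsilon> \<Longrightarrow> inj_on (\<lambda>x. L0 x + t *\<^sub>R L1 x) E"
proof -
  have z: "\<forall>x\<in>E. L0 x = 0 \<longrightarrow> x = 0"
    using inj E L(1) by (metis inj_onD linear_0 subspace_0)
  obtain e where e: "e > 0" "\<forall>x\<in>E. norm (L0 x) \<ge> e * norm x"
    using injective_imp_isometric[OF closed_subspace[OF E] E linear_conv_bounded_linear[THEN iffD1, OF L(1)] z]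
    by blast
  obtain C where C: "C > 0" "\<And>x. norm (L1 x) \<le> C * norm x"
    using linear_bounded_pos[OF L(2)] by blast
  show thesis
  proof
    show "e / C > 0" using e C by simp
    fix t assume t: "\<bar>t\<bar> < e / C"
    have lin: "linear (\<lambda>x. L0 x + t *\<^sub>R L1 x)"
      by (intro linear_compose_add linear_compose_scale_right L)
    show "inj_on (\<lambda>x. L0 x + t *\<^sub>R L1 x) E"
    proof (rule inj_onI, rule ccontr)
      fix x y assume xy: "x \<in> E" "y \<in> E" "L0 x + t *\<^sub>R L1 x = L0 y + t *\<^sub>R L1 y" "x \<noteq> y"
      have d: "x - y \<in> E" using xy E by (simp add: subspace_diff)
      have "L0 (x - y) = - (t *\<^sub>R L1 (x - y))"
        using xy(3) by (simp add: linear_diff[OF L(1)] linear_diff[OF L(2)] algebra_simps)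
      then have "norm (L0 (x - y)) = \<bar>t\<bar> * norm (L1 (x - y))" by simp
      also have "\<dots> \<le> \<bar>t\<bar> * (C * norm (x - y))" by (intro mult_left_mono C) auto
      finally have "e * norm (x - y) \<le> (\<bar>t\<bar> * C) * norm (x - y)"
        using e(2) d by fastforce
      then have "e \<le> \<bar>t\<bar> * C" using xy(4) by simp
      then show False using t C by (simp add: field_simps)
    qed
  qed
qed


subsection \<open>Flat symmetric bilinear forms\<close>

text \<open>Small \<open>t\<close> must suffice because regularity is known only near a given
  vector. The coefficients form a function so that \<open>(!)\<close> of an explicit list can be
  inserted; cubics are padded with a zero.\<close>

lemma quartic_coeffs_0:
  fixes a :: "nat \<Rightarrow> real"
  assumes "\<epsilon> > 0" "\<And>t. \<bar>t\<bar> < \<epsilon> \<Longrightarrow> a 0 + t * a 1 + t^2 * a 2 + t^3 * a 3 + t^4 * a 4 = 0"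
  shows "a 0 = 0" "a 1 = 0" "a 2 = 0" "a 3 = 0" "a 4 = 0"
proof -
  define P where "P = [:a 0, a 1, a 2, a 3, a 4:]"
  have "P = 0"
  proof (rule ccontr)
    assume "P \<noteq> 0"
    then have "finite {t. poly P t = 0}" by (rule poly_roots_finite)
    moreover have "{-\<epsilon><..<\<epsilon>} \<subseteq> {t. poly P t = 0}"
    proof
      fix t assume "t \<in> {-\<epsilon><..<\<epsilon>}"
      then have "\<bar>t\<bar> < \<epsilon>" by auto
      then have "a 0 + t * a 1 + t^2 * a 2 + t^3 * a 3 + t^4 * a 4 = 0" by (rule assms(2))
      then show "t \<in> {t. poly P t = 0}"
        by (simp add: P_def algebra_simps power2_eq_square power3_eq_cube power4_eq_xxxx)
    qed
    moreover have "infinite {-\<epsilon><..<\<epsilon>}" using assms(1) by (intro infinite_Ioo) simp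
    ultimately show False using finite_subset by blast
  qed
  then show "a 0 = 0" "a 1 = 0" "a 2 = 0" "a 3 = 0" "a 4 = 0"
    by (auto simp: P_def)
qed

text \<open>The condition \<open>total\<close> packs two facts together: \<open>b\<close> is
  nondegenerate on \<open>S\<close>, and the values of \<open>\<theta>\<close> span
  \<open>S\<close>. No signature is prescribed; only the dimension of \<open>S\<close> will
  enter.\<close>

locale flat_form =
  fixes S :: "'w::euclidean_space set"
    and b :: "'w \<Rightarrow> 'w \<Rightarrow> real"
    and \<theta> :: "'v::euclidean_space \<Rightarrow> 'v \<Rightarrow> 'w"
  assumes S: "subspace S"
    and b: "bilinear b" and b_commute: "b x y = b y x"
    and \<theta>: "bilinear \<theta>" and \<theta>_commute: "\<theta> u v = \<theta> v u" and \<theta>_in: "\<theta> u v \<in> S"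
    and flat: "b (\<theta> u v) (\<theta> w z) = b (\<theta> u z) (\<theta> w v)"
    and total: "x \<in> S \<Longrightarrow> (\<And>u v. b x (\<theta> u v) = 0) \<Longrightarrow> x = 0"
begin

lemmas b_simps = bilinear_ladd[OF b] bilinear_radd[OF b] bilinear_lmul[OF b] bilinear_rmul[OF b]
  bilinear_lneg[OF b] bilinear_rneg[OF b] bilinear_lzero[OF b] bilinear_rzero[OF b]
lemmas \<theta>_simps = bilinear_ladd[OF \<theta>] bilinear_radd[OF \<theta>] bilinear_lmul[OF \<theta>] bilinear_rmul[OF \<theta>]
  bilinear_lneg[OF \<theta>] bilinear_rneg[OF \<theta>] bilinear_lzero[OF \<theta>] bilinear_rzero[OF \<theta>]

lemma linear_\<theta>: "linear (\<theta> x)" "linear (\<lambda>x. \<theta> x y)"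
  using \<theta> by (auto simp: bilinear_def)

text \<open>Flatness of \<open>\<theta>\<close> means that \<open>c\<close> is totally symmetric.\<close>

definition c :: "'v \<Rightarrow> 'v \<Rightarrow> 'v \<Rightarrow> 'v \<Rightarrow> real" where
  "c x y z w = b (\<theta> x y) (\<theta> z w)"

text \<open>All six transpositions are listed, so that permutative rewriting can sort the arguments
  of \<open>c\<close>.\<close>

lemma c_sym: "c x y z w = c y x z w" "c x y z w = c z y x w" "c x y z w = c w y z x"
  "c x y z w = c x z y w" "c x y z w = c x w z y" "c x y z w = c x y w z"
proof -
  show 1: "c x y z w = c y x z w" for x y z w by (simp add: c_def \<theta>_commute)
  show 2: "c x y z w = c x y w z" for x y z w by (simp add: c_def \<theta>_commute)
  show 3: "c x y z w = c x w z y" for x y z w unfolding c_def by (rule flat)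
  show "c x y z w = c x z y w" using 2[of x y z w] 3[of x y w z] 2[of x z w y] by simp
  show "c x y z w = c w y z x" using 1[of x y z w] 3[of y x z w] 1[of y w z x] by simp
  show "c x y z w = c z y x w"
    using 2[of x y z w] 1[of x y w z] 3[of y x w z] 1[of y z w x] 2[of z y w x] by simp
qed

lemma c_simps:
  "c (x + x') y z w = c x y z w + c x' y z w" "c x (y + y') z w = c x y z w + c x y' z w"
  "c x y (z + z') w = c x y z w + c x y z' w" "c x y z (w + w') = c x y z w + c x y z w'"
  "c (k *\<^sub>R x) y z w = k * c x y z w" "c x (k *\<^sub>R y) z w = k * c x y z w"
  "c x y (k *\<^sub>R z) w = k * c x y z w" "c x y z (k *\<^sub>R w) = k * c x y z w"
  by (simp_all add: c_def \<theta>_simps b_simps)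

lemma nondegenerate:
  assumes "x \<in> S" "\<And>y. y \<in> S \<Longrightarrow> b x y = 0"
  shows "x = 0"
  using assms \<theta>_in by (intro total) auto

lemma subspace_range: "subspace (range (\<theta> x))"
  by (intro linear_subspace_image linear_\<theta>) simp

lemma range_subset: "range (\<theta> x) \<subseteq> S"
  using \<theta>_in by auto

section \<open>Regular elements and the radical of their image\<close>

definition regular :: "'v \<Rightarrow> bool" where
  "regular x \<longleftrightarrow> (\<forall>y. dim (range (\<theta> y)) \<le> dim (range (\<theta> x)))"

definition rad :: "'v \<Rightarrow> 'w set" where
  "rad x = {w \<in> range (\<theta> x). \<forall>v. b w (\<theta> x v) = 0}"

definition ker :: "'v \<Rightarrow> 'v set" where
  "ker x = {v. \<theta> x v = 0}"

definition nullspace :: "'v set" where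
  "nullspace = {v. \<forall>u. \<theta> v u = 0}"

lemma subspace_rad: "subspace (rad x)"
  using subspace_range[of x] by (auto simp: rad_def subspace_def b_simps)

lemma subspace_ker: "subspace (ker x)"
  by (auto simp: ker_def subspace_def \<theta>_simps)

lemma subspace_nullspace: "subspace nullspace"
  by (auto simp: nullspace_def subspace_def \<theta>_simps)

lemma rad_subset: "rad x \<subseteq> S"
  using range_subset by (auto simp: rad_def)

lemma dim_range_add_rad: "dim (range (\<theta> x)) + dim (rad x) \<le> dim S"
  by (rule dim_perp_add_le[OF b S subspace_range subspace_rad range_subset rad_subset nondegenerate])
     (auto simp: rad_def)

lemma dim_range_add_ker: "dim (range (\<theta> x)) + dim (ker x) = DIM('v)"
  using dim_image_kernel[OF linear_\<theta>(1) subspace_UNIV, of x] by (simp add: ker_def)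

lemma regular_exists: obtains x where "regular x"
proof -
  let ?d = "\<lambda>x. dim (range (\<theta> x))"
  have "finite (range ?d)"
    by (rule finite_subset[of _ "{..DIM('w)}"]) (auto simp: dim_subset_UNIV)
  then have "Max (range ?d) \<in> range ?d"
    by (intro Max_in) auto
  then obtain x where "Max (range ?d) = ?d x"
    by blast
  moreover have "?d y \<le> Max (range ?d)" for y
    by (rule Max_ge[OF \<open>finite (range ?d)\<close>]) simp
  ultimately have "regular x"
    by (simp add: regular_def)
  then show thesis by (rule that)
qed

lemma dim_le_dim_range:
  fixes E :: "'e::euclidean_space set"
  assumes "linear L" "subspace E" "inj_on L E" "L ` E \<subseteq> range (\<theta> x)"
  shows "dim E \<le> dim (range (\<theta> x))"
proof -
  have "dim (L ` E) = dim E"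
    by (intro dim_image_eq) (use assms(1,2,3) in \<open>simp_all add: span_eq_iff[THEN iffD2]\<close>)
  then show ?thesis using dim_subset[OF assms(4)] by simp
qed

lemma ker_complement:
  obtains E where "subspace E" "inj_on (\<theta> x) E" "dim E = dim (range (\<theta> x))"
proof -
  let ?E = "{y \<in> UNIV. \<forall>n\<in>ker x. orthogonal n y}"
  have E: "subspace ?E"
    by (auto simp: subspace_def orthogonal_def inner_add_right)
  have d: "dim ?E + dim (ker x) = dim (UNIV :: 'v set)"
    by (rule dim_subspace_orthogonal_to_vectors[OF subspace_ker subspace_UNIV]) auto
  have "inj_on (\<theta> x) ?E"
  proof (rule inj_onI)
    fix u v assume uv: "u \<in> ?E" "v \<in> ?E" "\<theta> x u = \<theta> x v"
    have "u - v \<in> ?E" using E uv by (simp add: subspace_diff del: mem_Collect_eq)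
    moreover have "u - v \<in> ker x" using uv(3) by (simp add: ker_def linear_diff[OF linear_\<theta>(1)])
    ultimately have "orthogonal (u - v) (u - v)" by blast
    then show "u = v" by (simp add: orthogonal_self)
  qed
  then show thesis using that[OF E] d dim_range_add_ker[of x] by simp
qed

text \<open>Lower semicontinuity of the rank: a complement of the kernel on which
  \<open>\<theta> x\<close> is injective stays such under small perturbation, and the rank cannot
  exceed the maximal one.\<close>

lemma regular_near:
  assumes "regular x"
  obtains \<epsilon> where "\<epsilon> > 0" "\<And>t. \<bar>t\<bar> < \<epsilon> \<Longrightarrow> regular (x + t *\<^sub>R y)"
proof -
  obtain E where E: "subspace E" "inj_on (\<theta> x) E" "dim E = dim (range (\<theta> x))"
    using ker_complement .
  obtain \<epsilon> where \<epsilon>: "\<epsilon> > 0" "\<And>t. \<bar>t\<bar> < \<epsilon> \<Longrightarrow> inj_on (\<lambda>v. \<theta> x v + t *\<^sub>R \<theta> y v) E"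
    using inj_on_perturb[OF linear_\<theta>(1) linear_\<theta>(1) E(1,2)] by blast
  show thesis
  proof
    fix t assume "\<bar>t\<bar> < \<epsilon>"
    moreover have "\<theta> (x + t *\<^sub>R y) = (\<lambda>v. \<theta> x v + t *\<^sub>R \<theta> y v)" by (rule ext) (simp add: \<theta>_simps)
    ultimately have "inj_on (\<theta> (x + t *\<^sub>R y)) E" using \<epsilon>(2) by metis
    then have "dim E \<le> dim (range (\<theta> (x + t *\<^sub>R y)))"
      by (intro dim_le_dim_range[OF linear_\<theta>(1) E(1)]) auto
    then show "regular (x + t *\<^sub>R y)" using assms E(3) by (auto simp: regular_def intro: le_trans)
  qed fact
qed

text \<open>Otherwise \<open>\<theta> (x + t *\<^sub>R y)\<close> would have larger rank than \<open>\<theta> x\<close> for small \<open>t \<noteq> 0\<close>.\<close>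

lemma regular_ker_in_range:
  assumes "regular x" "n \<in> ker x"
  shows "\<theta> n y \<in> range (\<theta> x)"
proof (rule ccontr)
  assume notin: "\<theta> n y \<notin> range (\<theta> x)"
  obtain E where E: "subspace E" "inj_on (\<theta> x) E" "dim E = dim (range (\<theta> x))"
    using ker_complement .
  \<comment> \<open>For \<open>t\<close> nonzero, \<open>L0 p + t L1 p\<close> is the value of
    \<open>\<theta> (x + t y)\<close> at \<open>fst p + (snd p / t) n\<close>: the summand
    \<open>\<theta> x n\<close> vanishes, and division by \<open>t\<close> lets
    \<open>\<theta> y n\<close> survive the limit. If \<open>\<theta> n y\<close> lies outside the
    image, \<open>L0\<close> is injective on a space one dimension larger than that image.\<close>
  define L0 where "L0 p = \<theta> x (fst p) + snd p *\<^sub>R \<theta> y n" for p :: "'v \<times> real"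
  define L1 where "L1 p = \<theta> y (fst p)" for p :: "'v \<times> real"
  have L: "linear L0" "linear L1"
    by (auto intro!: linearI simp: L0_def L1_def \<theta>_simps scaleR_add_left scaleR_add_right)
  have E': "subspace (E \<times> (UNIV :: real set))" using E(1) by (auto intro: subspace_Times)
  have inj: "inj_on L0 (E \<times> UNIV)"
  proof (rule inj_onI)
    fix p q assume pq: "p \<in> E \<times> UNIV" "q \<in> E \<times> UNIV" "L0 p = L0 q"
    then have eq: "\<theta> x (fst p - fst q) = (snd q - snd p) *\<^sub>R \<theta> n y"
      by (simp add: L0_def linear_diff[OF linear_\<theta>(1)] algebra_simps \<theta>_commute)
    have "snd p = snd q"
    proof (rule ccontr)
      assume "snd p \<noteq> snd q"
      then have "\<theta> n y = \<theta> x ((1 / (snd q - snd p)) *\<^sub>R (fst p - fst q))"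
        using eq by (simp add: \<theta>_simps)
      then show False using notin by blast
    qed
    moreover have "fst p = fst q"
    proof (rule inj_onD[OF E(2)])
      show "\<theta> x (fst p) = \<theta> x (fst q)"
        using eq \<open>snd p = snd q\<close> by (simp add: linear_diff[OF linear_\<theta>(1)])
    qed (use pq in auto)
    ultimately show "p = q" by (simp add: prod_eq_iff)
  qed
  obtain \<epsilon> where \<epsilon>: "\<epsilon> > 0" "\<And>t. \<bar>t\<bar> < \<epsilon> \<Longrightarrow> inj_on (\<lambda>p. L0 p + t *\<^sub>R L1 p) (E \<times> UNIV)"
    using inj_on_perturb[OF L E' inj] by blast
  define t where "t = \<epsilon> / 2"
  have t: "t \<noteq> 0" "\<bar>t\<bar> < \<epsilon>" using \<epsilon>(1) by (auto simp: t_def)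
  have "L0 p + t *\<^sub>R L1 p = \<theta> (x + t *\<^sub>R y) (fst p + (snd p / t) *\<^sub>R n)" for p
    using t assms(2) by (simp add: L0_def L1_def \<theta>_simps ker_def)
  then have sub: "(\<lambda>p. L0 p + t *\<^sub>R L1 p) ` (E \<times> UNIV) \<subseteq> range (\<theta> (x + t *\<^sub>R y))"
    by auto
  have "dim (E \<times> (UNIV :: real set)) \<le> dim (range (\<theta> (x + t *\<^sub>R y)))"
    by (rule dim_le_dim_range[OF _ E' \<epsilon>(2)[OF t(2)] sub])
       (intro linear_compose_add linear_compose_scale_right L)
  then have "dim E + 1 \<le> dim (range (\<theta> (x + t *\<^sub>R y)))"
    using dim_Times[OF E(1) subspace_UNIV, where ?'b = real] by simp
  then show False
    using assms(1)[unfolded regular_def, rule_format, of "x + t *\<^sub>R y"] E(3) by linarith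
qed

text \<open>Membership in the image comes from regularity, and orthogonality from flatness:
  \<open>b (\<theta> n y) (\<theta> x v)\<close> equals
  \<open>b (\<theta> x n) (\<theta> y v)\<close>, whose first argument is zero.\<close>

lemma regular_ker_in_rad:
  assumes "regular x" "n \<in> ker x"
  shows "\<theta> n y \<in> rad x"
  unfolding rad_def
proof (safe)
  show "\<theta> n y \<in> range (\<theta> x)" by (rule regular_ker_in_range[OF assms])
  fix v
  have "b (\<theta> n y) (\<theta> x v) = c n y x v" by (simp add: c_def)
  also have "\<dots> = c x n y v" by (metis c_sym(1,2))
  also have "\<dots> = 0" using assms(2) by (simp add: c_def ker_def b_simps)
  finally show "b (\<theta> n y) (\<theta> x v) = 0" .
qed

text \<open>By flatness, \<open>\<theta> n z\<close> is orthogonal to the image of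
  \<open>\<theta> y\<close> whenever \<open>n\<close> is killed by both \<open>\<theta> x\<close>
  and \<open>\<theta> y\<close>; being in \<open>rad x\<close>, it vanishes. So \<open>ker x\<close>
  modulo \<open>nullspace\<close> embeds into \<open>rad x\<close> through
  \<open>\<theta> y\<close>, and rank plus radical is at most \<open>dim S\<close>.\<close>

lemma nullity_if_rad_paired:
  assumes "regular x" and y: "\<And>w. w \<in> rad x \<Longrightarrow> (\<And>v. b w (\<theta> y v) = 0) \<Longrightarrow> w = 0"
  shows "DIM('v) \<le> dim nullspace + dim S"
proof -
  let ?N = "{n \<in> ker x. \<theta> y n = 0}"
  have "dim (\<theta> y ` ker x) + dim ?N = dim (ker x)"
    by (rule dim_image_kernel[OF linear_\<theta>(1) subspace_ker])
  moreover have "\<theta> y ` ker x \<subseteq> rad x"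
    using regular_ker_in_rad[OF assms(1)] by (auto simp: \<theta>_commute[of y])
  then have "dim (\<theta> y ` ker x) \<le> dim (rad x)" by (rule dim_subset)
  moreover have "?N \<subseteq> nullspace"
  proof
    fix n assume n: "n \<in> ?N"
    have "\<theta> n z = 0" for z
    proof (rule y)
      show "\<theta> n z \<in> rad x" using n by (auto intro: regular_ker_in_rad[OF assms(1)])
      fix v
      have "b (\<theta> n z) (\<theta> y v) = c y n z v" unfolding c_def[symmetric] by (metis c_sym(1,2))
      also have "\<dots> = 0" using n by (simp add: c_def b_simps)
      finally show "b (\<theta> n z) (\<theta> y v) = 0" .
    qed
    then show "n \<in> nullspace" by (simp add: nullspace_def)
  qed
  then have "dim ?N \<le> dim nullspace" by (rule dim_subset)
  ultimately show ?thesis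
    using dim_range_add_ker[of x] dim_range_add_rad[of x] by linarith
qed

lemma eq_0_if_quadratic_0:
  assumes "u \<in> S" "\<And>y. b u (\<theta> y y) = 0"
  shows "u = 0"
proof (rule total[OF assms(1)])
  fix v w
  have "b u (\<theta> (v + w) (v + w)) = b u (\<theta> v v) + 2 * b u (\<theta> v w) + b u (\<theta> w w)"
    by (simp add: \<theta>_simps b_simps \<theta>_commute[of w v])
  then show "b u (\<theta> v w) = 0" by (simp add: assms(2))
qed

text \<open>The quadratic forms \<open>b u1 (\<theta> y y)\<close> and
  \<open>b u2 (\<theta> y y)\<close> have differentials \<open>2 b u1 (\<theta> y z)\<close> and
  \<open>2 b u2 (\<theta> y z)\<close>. A relation that may vary with \<open>y\<close> makes their
  Wronskian zero, so a fixed combination of the forms vanishes; polarization and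
  \<open>total\<close> finish.\<close>

lemma dependent_if_everywhere_dependent:
  assumes uS: "u1 \<in> S" "u2 \<in> S"
    and dep: "\<And>y. \<exists>p q. (p \<noteq> 0 \<or> q \<noteq> 0) \<and> (\<forall>v. b (p *\<^sub>R u1 + q *\<^sub>R u2) (\<theta> y v) = 0)"
  shows "\<exists>p q. (p \<noteq> 0 \<or> q \<noteq> 0) \<and> p *\<^sub>R u1 + q *\<^sub>R u2 = 0"
proof -
  define f where "f i y = b (if i then u1 else u2) (\<theta> y y)" for i y
  define f' where "f' i y z = 2 * b (if i then u1 else u2) (\<theta> y z)" for i y z
  have poly: "\<exists>P. \<forall>t. f i (y + t *\<^sub>R z) = poly P t \<and> f' i (y + t *\<^sub>R z) z = poly (pderiv P) t" for i y z
    by (rule exI[of _ "[:f i y, f' i y z, f i z:]"])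
       (auto simp: f_def f'_def \<theta>_simps b_simps pderiv_pCons algebra_simps \<theta>_commute[of z y])
  have "f True y * f' False y z = f False y * f' True y z" for y z
  proof -
    obtain p q where pq: "p \<noteq> 0 \<or> q \<noteq> 0" "\<And>v. p * b u1 (\<theta> y v) + q * b u2 (\<theta> y v) = 0"
      using dep[of y] by (auto simp: b_simps)
    have "p * f True y + q * f False y = 0" "p * f' True y z + q * f' False y z = 0"
      using pq(2)[of y] pq(2)[of z] by (auto simp: f_def f'_def)
    then have "p * (f True y * f' False y z - f False y * f' True y z) = 0"
        "q * (f True y * f' False y z - f False y * f' True y z) = 0"
      by algebra+
    then show ?thesis using pq(1) by auto
  qed
  from dependent_if_proportional_derivatives[OF poly poly this]
  obtain p q where pq: "p \<noteq> 0 \<or> q \<noteq> 0" "\<And>y. p * f True y + q * f False y = 0" by blast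
  have "p *\<^sub>R u1 + q *\<^sub>R u2 = 0"
    using uS pq(2) S
    by (intro eq_0_if_quadratic_0) (auto simp: f_def b_simps intro: subspace_add subspace_scale)
  then show ?thesis using pq(1) by blast
qed

text \<open>When the nullity bound fails, each \<open>y\<close> has a nonzero \<open>w\<close> in
  \<open>rad x\<close> orthogonal to the image of \<open>\<theta> y\<close>. In a radical of
  dimension at most 2 this \<open>w\<close> can be made independent of \<open>y\<close>, which
  contradicts \<open>total\<close>.\<close>

lemma rad_dim_ge_3:
  assumes small: "dim nullspace + dim S < DIM('v)" and "regular x"
  shows "3 \<le> dim (rad x)"
proof (rule ccontr)
  assume "\<not> 3 \<le> dim (rad x)"
  have ex: "\<exists>w\<in>rad x. w \<noteq> 0 \<and> (\<forall>v. b w (\<theta> y v) = 0)" for y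
    using nullity_if_rad_paired[OF assms(2), of y] small by force
  obtain B where B: "B \<subseteq> rad x" "independent B" "rad x \<subseteq> span B" "card B = dim (rad x)"
    using basis_exists by blast
  consider "card B = 0" | "card B = 1" | "card B = 2"
    using B(4) \<open>\<not> 3 \<le> dim (rad x)\<close> by linarith
  then show False
  proof cases
    case 1
    then have "B = {}" using B(2) by (simp add: independent_bound)
    then show False using ex B(3) by auto
  next
    case 2
    then obtain u where u: "B = {u}" by (auto simp: card_1_singleton_iff)
    have "b u (\<theta> y v) = 0" for y v
    proof -
      obtain w where w: "w \<in> rad x" "w \<noteq> 0" "\<And>v. b w (\<theta> y v) = 0" using ex by blast
      then obtain k where "w = k *\<^sub>R u" using B(3) u by (auto simp: span_singleton)
      then show ?thesis using w(2) w(3)[of v] by (auto simp: b_simps)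
    qed
    then have "u = 0" using B(1) u rad_subset by (intro total) auto
    then show False using B(2) u by simp
  next
    case 3
    then obtain u1 u2 where u: "B = {u1, u2}" "u1 \<noteq> u2" by (auto simp: card_2_iff)
    have "\<exists>p q. (p \<noteq> 0 \<or> q \<noteq> 0) \<and> p *\<^sub>R u1 + q *\<^sub>R u2 = 0"
    proof (rule dependent_if_everywhere_dependent)
      show "u1 \<in> S" "u2 \<in> S" using B(1) u rad_subset by auto
      fix y
      obtain w where w: "w \<in> rad x" "w \<noteq> 0" "\<And>v. b w (\<theta> y v) = 0" using ex by blast
      then have "w \<in> span (insert u1 {u2})" using B(3) u by blast
      then obtain p where "w - p *\<^sub>R u1 \<in> span {u2}"
        unfolding span_breakdown_eq[of w u1] by blast
      then obtain q where "w - p *\<^sub>R u1 = q *\<^sub>R u2" by (auto simp: span_singleton)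
      then have "w = p *\<^sub>R u1 + q *\<^sub>R u2" by (simp add: algebra_simps)
      then show "\<exists>p q. (p \<noteq> 0 \<or> q \<noteq> 0) \<and> (\<forall>v. b (p *\<^sub>R u1 + q *\<^sub>R u2) (\<theta> y v) = 0)"
        using w(2,3) by (intro exI[of _ p] exI[of _ q]) auto
    qed
    then obtain p q where pq: "p \<noteq> 0 \<or> q \<noteq> 0" "p *\<^sub>R u1 + q *\<^sub>R u2 = 0" by blast
    have "u1 \<in> span {u2} \<or> u2 \<in> span {u1}"
    proof (cases "p = 0")
      case True
      then have "u2 = 0" using pq by simp
      then show ?thesis by (simp add: span_zero)
    next
      case False
      then have "u1 = (- (q / p)) *\<^sub>R u2"
        using arg_cong[OF pq(2), of "\<lambda>z. (1 / p) *\<^sub>R z"]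
        by (simp add: algebra_simps eq_neg_iff_add_eq_0)
      then show ?thesis by (metis singletonI span_base span_mul)
    qed
    moreover have "B - {u1} = {u2}" "B - {u2} = {u1}" using u by auto
    ultimately show False using B(2) u(1) unfolding dependent_def by fastforce
  qed
qed

text \<open>Polarization frees one argument at a time: the linear coefficient in \<open>t\<close> of
  the form on \<open>y + t z\<close> is read off first for the quartic, then for the cubic with one
  argument fixed.\<close>

lemma c_eq_0_if_diagonal_0:
  assumes "\<And>x. c x x x x = 0"
  shows "c x y z w = 0"
proof -
  have 3: "c y y y z = 0" for y z
  proof -
    let ?a = "(!) [c y y y y, 4 * c y y y z, 6 * c y y z z, 4 * c y z z z, c z z z z]"
    have "?a 0 + t * ?a 1 + t^2 * ?a 2 + t^3 * ?a 3 + t^4 * ?a 4 = c (y + t *\<^sub>R z) (y + t *\<^sub>R z) (y + t *\<^sub>R z) (y + t *\<^sub>R z)" for t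
      by (simp add: c_simps c_sym power2_eq_square power3_eq_cube power4_eq_xxxx algebra_simps)
    then have "?a 1 = 0" using assms by (intro quartic_coeffs_0(2)[of 1 ?a]) auto
    then show ?thesis by simp
  qed
  have 2: "c y y z w = 0" for y z w
  proof -
    let ?a = "(!) [c y y y w, 3 * c y y z w, 3 * c y z z w, c z z z w, 0]"
    have "?a 0 + t * ?a 1 + t^2 * ?a 2 + t^3 * ?a 3 + t^4 * ?a 4 = c (y + t *\<^sub>R z) (y + t *\<^sub>R z) (y + t *\<^sub>R z) w" for t
      by (simp add: c_simps c_sym power2_eq_square power3_eq_cube power4_eq_xxxx algebra_simps)
    then have "?a 1 = 0" using 3 by (intro quartic_coeffs_0(2)[of 1 ?a]) auto
    then show ?thesis by simp
  qed
  show ?thesis using 2[of "x + y" z w] 2[of x z w] 2[of y z w] by (simp add: c_simps c_sym(1)[of y x])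
qed

text \<open>Regularity persists for a short time along every line through a regular
  \<open>x\<close>. If the quartic vanished at all regular vectors, its \<open>t^4\<close>
  coefficient along direction \<open>y\<close> would give \<open>c y y y y = 0\<close> for all
  \<open>y\<close>, hence \<open>\<theta> = 0\<close> and a full nullspace.\<close>

lemma regular_nonnull_exists:
  assumes small: "dim nullspace + dim S < DIM('v)"
  obtains x where "regular x" "c x x x x \<noteq> 0"
proof -
  have "\<exists>x. regular x \<and> c x x x x \<noteq> 0"
  proof (rule ccontr)
    assume "\<not> (\<exists>x. regular x \<and> c x x x x \<noteq> 0)"
    then have 0: "c x x x x = 0" if "regular x" for x using that by blast
    obtain x where x: "regular x" by (rule regular_exists)
    have "c y y y y = 0" for y
    proof -
      obtain \<epsilon> where \<epsilon>: "\<epsilon> > 0" "\<And>t. \<bar>t\<bar> < \<epsilon> \<Longrightarrow> regular (x + t *\<^sub>R y)"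
        using regular_near[OF x] by blast
      let ?a = "(!) [c x x x x, 4 * c x x x y, 6 * c x x y y, 4 * c x y y y, c y y y y]"
      have "?a 0 + t * ?a 1 + t^2 * ?a 2 + t^3 * ?a 3 + t^4 * ?a 4 = c (x + t *\<^sub>R y) (x + t *\<^sub>R y) (x + t *\<^sub>R y) (x + t *\<^sub>R y)" for t
        by (simp add: c_simps c_sym power2_eq_square power3_eq_cube power4_eq_xxxx algebra_simps)
      then have "?a 4 = 0" using 0 \<epsilon> by (intro quartic_coeffs_0(5)[of \<epsilon> ?a]) auto
      then show ?thesis by simp
    qed
    then have "c u v w z = 0" for u v w z by (rule c_eq_0_if_diagonal_0)
    then have "\<theta> u v = 0" for u v
      by (intro total \<theta>_in) (simp add: c_def)
    then have "nullspace = UNIV" by (simp add: nullspace_def)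
    then show False using small by simp
  qed
  then show thesis using that by blast
qed

text \<open>
  If the bound failed, two elements \<open>n1\<close>, \<open>n2\<close> of \<open>ker x\<close> would have independent cubics
  \<open>c n y y y\<close>. For suitable \<open>y\<close>, \<open>z\<close> and small \<open>t\<close>, the images of \<open>n1, n2, y, z, x\<close> under
  \<open>\<theta> (x + t *\<^sub>R y)\<close> then have a nonsingular Gram matrix, so that the radical, of dimension
  at least 3, has codimension at least 5 in the image. This needs \<open>5 + 2 * 3 \<le> dim S\<close>.
\<close>

lemma nullity_bound:
  assumes dimS: "dim S \<le> 10"
  shows "DIM('v) \<le> dim nullspace + dim S"
proof (rule ccontr)
  assume "\<not> ?thesis"
  then have small: "dim nullspace + dim S < DIM('v)" by simp
  obtain x where x: "regular x" "c x x x x \<noteq> 0"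
    using regular_nonnull_exists[OF small] .
  have n_null: "nullspace \<subseteq> ker x"
    by (auto simp: nullspace_def ker_def \<theta>_commute[of x])
  \<comment> \<open>A radical of dimension at least 3 forces the rank down to at most
    \<open>dim S - 3\<close>, so the kernel has room for two vectors independent modulo
    \<open>nullspace\<close>.\<close>
  have dimN: "dim nullspace + 2 \<le> dim (ker x)"
    using small dim_range_add_ker[of x] dim_range_add_rad[of x] rad_dim_ge_3[OF small x(1)] by linarith
  obtain n1 where n1: "n1 \<in> ker x" "n1 \<notin> nullspace"
    using dimN dim_subset[of "ker x" nullspace] by fastforce
  obtain n2 where n2: "n2 \<in> ker x" "n2 \<notin> span (insert n1 nullspace)"
  proof -
    have "dim (span (insert n1 nullspace)) \<le> dim nullspace + 1"
      by (simp add: dim_insert)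
    then have "\<not> ker x \<subseteq> span (insert n1 nullspace)"
      using dimN dim_subset[of "ker x" "span (insert n1 nullspace)"] by fastforce
    then show thesis using that by blast
  qed
  \<comment> \<open>The Boolean selects \<open>n1\<close> or \<open>n2\<close>, and
    \<open>f'\<close> is the differential of the cubic \<open>f\<close>. An identically zero
    Wronskian would yield a nontrivial combination of \<open>n1\<close> and \<open>n2\<close> with
    zero cubic, which polarization places in \<open>nullspace\<close>.\<close>
  define f where "f i y = c (if i then n1 else n2) y y y" for i y
  define f' where "f' i y z = 3 * c (if i then n1 else n2) y y z" for i y z
  have poly: "\<exists>P. \<forall>t. f i (y + t *\<^sub>R z) = poly P t \<and> f' i (y + t *\<^sub>R z) z = poly (pderiv P) t" for i y z
    by (rule exI[of _ "[:f i y, f' i y z, 3 * c (if i then n1 else n2) y z z, f i z:]"])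
       (auto simp: f_def f'_def c_simps c_sym pderiv_pCons algebra_simps)
  have "\<exists>y z. f True y * f' False y z \<noteq> f False y * f' True y z"
  proof (rule ccontr)
    assume "\<not> ?thesis"
    then have "f True y * f' False y z = f False y * f' True y z" for y z by blast
    from dependent_if_proportional_derivatives[OF poly poly this]
    obtain p q where pq: "p \<noteq> 0 \<or> q \<noteq> 0" "\<And>y. p * f True y + q * f False y = 0" by blast
    define n where "n = p *\<^sub>R n1 + q *\<^sub>R n2"
    have cn: "c n y y y = 0" for y using pq(2)[of y] by (simp add: n_def f_def c_simps)
    have cn2: "c n y y z = 0" for y z
    proof -
      let ?a = "(!) [c n y y y, 3 * c n y y z, 3 * c n y z z, c n z z z, 0]"
      have "?a 0 + t * ?a 1 + t^2 * ?a 2 + t^3 * ?a 3 + t^4 * ?a 4 = c n (y + t *\<^sub>R z) (y + t *\<^sub>R z) (y + t *\<^sub>R z)" for t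
        by (simp add: c_simps c_sym power2_eq_square power3_eq_cube power4_eq_xxxx algebra_simps)
      then have "?a 1 = 0" using cn by (intro quartic_coeffs_0(2)[of 1 ?a]) auto
      then show ?thesis by simp
    qed
    have "\<theta> n z = 0" for z
    proof (rule eq_0_if_quadratic_0[OF \<theta>_in])
      fix y
      have "b (\<theta> n z) (\<theta> y y) = c n y y z" unfolding c_def[symmetric] by (metis c_sym(6) c_sym(4))
      then show "b (\<theta> n z) (\<theta> y y) = 0" using cn2 by simp
    qed
    then have n: "n \<in> nullspace" by (simp add: nullspace_def)
    show False
    proof (cases "q = 0")
      case True
      then have "n1 = (1 / p) *\<^sub>R n" using pq(1) by (simp add: n_def)
      then show False using n1(2) n subspace_nullspace by (simp add: subspace_scale)
    next
      case False
      then have "n2 = (1 / q) *\<^sub>R (n - p *\<^sub>R n1)" by (simp add: n_def)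
      then show False using n2(2) n by (auto simp: span_base intro!: span_mul span_diff)
    qed
  qed
  then obtain y z where yz: "c n1 y y y * c n2 y y z \<noteq> c n2 y y y * c n1 y y z"
    by (auto simp: f_def f'_def)
  obtain \<epsilon> where \<epsilon>: "\<epsilon> > 0" "\<And>t. \<bar>t\<bar> < \<epsilon> \<Longrightarrow> regular (x + t *\<^sub>R y)"
    using regular_near[OF x(1)] by blast
  \<comment> \<open>The last quantity will be the Gram entry of \<open>\<theta> x' x\<close> with
    itself; it tends to \<open>c x x x x\<close>, which is nonzero, as \<open>t\<close> tends to
    0.\<close>
  obtain t where t: "\<bar>t\<bar> < \<epsilon>" "t \<noteq> 0" "c (x + t *\<^sub>R y) x (x + t *\<^sub>R y) x \<noteq> 0"
  proof -
    have "((\<lambda>t. c x x x x + t * (2 * c x x x y) + t * t * c x x y y) \<longlongrightarrow> c x x x x + 0 * (2 * c x x x y) + 0 * 0 * c x x y y) (at 0)"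
      by (intro tendsto_intros)
    then have "\<forall>\<^sub>F t in at 0. c x x x x + t * (2 * c x x x y) + t * t * c x x y y \<noteq> 0"
      using x(2) by (intro tendsto_imp_eventually_ne) auto
    moreover have "\<forall>\<^sub>F t in at (0::real). \<bar>t\<bar> < \<epsilon>"
      using \<epsilon>(1) by (auto simp: eventually_at dist_real_def)
    moreover have "\<forall>\<^sub>F t in at (0::real). t \<noteq> 0" by (rule eventually_neq_at_within)
    ultimately have "\<forall>\<^sub>F t in at 0. \<bar>t\<bar> < \<epsilon> \<and> t \<noteq> 0 \<and> c x x x x + t * (2 * c x x x y) + t * t * c x x y y \<noteq> 0"
      by eventually_elim simp
    then obtain t where "\<bar>t\<bar> < \<epsilon>" "t \<noteq> 0" "c x x x x + t * (2 * c x x x y) + t * t * c x x y y \<noteq> 0"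
      using eventually_happens'[OF at_neq_bot] by blast
    moreover have "c (x + t *\<^sub>R y) x (x + t *\<^sub>R y) x = c x x x x + t * (2 * c x x x y) + t * t * c x x y y"
      by (simp add: c_simps c_sym algebra_simps)
    ultimately show thesis using that by simp
  qed
  define x' where "x' = x + t *\<^sub>R y"
  have x': "regular x'" using \<epsilon>(2) t(1) by (simp add: x'_def)
  have n_kill: "c n x v w = 0" if "n \<in> ker x" for n v w
    using that by (simp add: c_sym(1)[of n x]) (simp add: c_def ker_def b_simps)
  have Bn: "b (\<theta> x' n) (\<theta> x' v) = t^2 * c n y y v" if "n \<in> ker x" for n v
  proof -
    have "b (\<theta> x' n) (\<theta> x' v) = c n x' x' v" unfolding c_def[symmetric] by (metis c_sym(1))
    also have "\<dots> = t^2 * c n y y v"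
      using n_kill[OF that] c_sym(4)[of n y x v]
      by (simp add: x'_def c_simps power2_eq_square)
    finally show ?thesis .
  qed
  have Bnn: "b (\<theta> x' n) (\<theta> x' m) = 0" if "n \<in> ker x" "m \<in> ker x" for n m
  proof -
    have "\<theta> m x' \<in> rad x" "\<theta> n x' \<in> rad x" using regular_ker_in_rad[OF x(1)] that by auto
    then show ?thesis by (auto simp: rad_def \<theta>_commute[of x'])
  qed
  have Bnx: "b (\<theta> x' n) (\<theta> x' x) = 0" if "n \<in> ker x" for n
    using Bn[OF that, of x] n_kill[OF that] c_sym(3)[of n y y x] c_sym(2)[of n y x y] c_sym(4,5,6)
    by (metis mult_zero_right)
  \<comment> \<open>In the Gram matrix of these five vectors the \<open>n1, n2\<close> block is
    zero, its pairing with \<open>y, z\<close> is \<open>t^2\<close> times the Wronskian matrix, and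
    \<open>x\<close> is orthogonal to \<open>n1, n2\<close>. Testing a radical vector first against
    \<open>n1, n2\<close>, then \<open>x\<close>, then \<open>y, z\<close> therefore kills
    \<open>p3, p4\<close>, then \<open>p5\<close>, then \<open>p1, p2\<close>.\<close>
  define \<Psi> where "\<Psi> p = (case p of (p1, p2, p3, p4, p5) \<Rightarrow>
      p1 *\<^sub>R \<theta> x' n1 + p2 *\<^sub>R \<theta> x' n2 + p3 *\<^sub>R \<theta> x' y + p4 *\<^sub>R \<theta> x' z + p5 *\<^sub>R \<theta> x' x)"
    for p :: "real \<times> real \<times> real \<times> real \<times> real"
  have lin: "linear \<Psi>"
    by (auto intro!: linearI simp: \<Psi>_def scaleR_add_left scaleR_add_right)
  have \<Psi>_rad: "p = 0" if "\<Psi> p \<in> rad x'" for p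
  proof -
    obtain p1 p2 p3 p4 p5 where p: "p = (p1, p2, p3, p4, p5)" by (metis prod.exhaust)
    define w where "w = \<Psi> p"
    have w: "w = p1 *\<^sub>R \<theta> x' n1 + p2 *\<^sub>R \<theta> x' n2 + p3 *\<^sub>R \<theta> x' y + p4 *\<^sub>R \<theta> x' z + p5 *\<^sub>R \<theta> x' x"
      by (simp add: w_def p \<Psi>_def)
    have bw: "b w (\<theta> x' v) = 0" for v using that by (simp add: rad_def w_def)
    have 34: "p3 * c n y y y + p4 * c n y y z = 0" if n: "n = n1 \<or> n = n2" for n
    proof -
      have nk: "n \<in> ker x" using n n1(1) n2(1) by auto
      have "0 = b (\<theta> x' n) w" using bw[of n] by (simp add: b_commute)
      also have "\<dots> = t^2 * (p3 * c n y y y + p4 * c n y y z)"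
        unfolding w using Bnn[OF nk n1(1)] Bnn[OF nk n2(1)] Bnx[OF nk] Bn[OF nk, of y] Bn[OF nk, of z]
        by (simp add: b_simps algebra_simps)
      finally show ?thesis using t(2) by simp
    qed
    have "p3 * (c n1 y y y * c n2 y y z - c n2 y y y * c n1 y y z) = 0"
      "p4 * (c n1 y y y * c n2 y y z - c n2 y y y * c n1 y y z) = 0"
      using 34[of n1, simplified] 34[of n2, simplified] by algebra+
    then have p34: "p3 = 0" "p4 = 0" using yz by auto
    have "b w (\<theta> x' x) = p5 * b (\<theta> x' x) (\<theta> x' x)"
      unfolding w using p34 Bnx[OF n1(1)] Bnx[OF n2(1)] by (simp add: b_simps)
    then have p5: "p5 = 0" using bw[of x] t(3) by (simp add: x'_def[symmetric] c_def)
    have 12: "p1 * c n1 y y v + p2 * c n2 y y v = 0" for v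
    proof -
      have "0 = b w (\<theta> x' v)" using bw by simp
      also have "\<dots> = t^2 * (p1 * c n1 y y v + p2 * c n2 y y v)"
        unfolding w using p34 p5 Bn[OF n1(1), of v] Bn[OF n2(1), of v]
        by (simp add: b_simps algebra_simps)
      finally show ?thesis using t(2) by simp
    qed
    have "p1 * (c n1 y y y * c n2 y y z - c n2 y y y * c n1 y y z) = 0"
      "p2 * (c n1 y y y * c n2 y y z - c n2 y y y * c n1 y y z) = 0"
      using 12[of y] 12[of z] by algebra+
    then have "p1 = 0" "p2 = 0" using yz by auto
    then show "p = 0" using p p34 p5 by (simp add: zero_prod_def)
  qed
  have "inj \<Psi>"
    unfolding linear_injective_0[OF lin]
  proof (intro allI impI)
    fix p assume "\<Psi> p = 0"
    then have "\<Psi> p \<in> rad x'" using subspace_0[OF subspace_rad] by simp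
    then show "p = 0" by (rule \<Psi>_rad)
  qed
  then have dim5: "dim (range \<Psi>) = 5"
    using dim_image_eq[OF lin, of UNIV] by simp
  have r\<Psi>: "subspace (range \<Psi>)" by (intro linear_subspace_image lin) simp
  have "w = 0" if "w \<in> range \<Psi> \<inter> rad x'" for w
  proof -
    obtain p where "w = \<Psi> p" "\<Psi> p \<in> rad x'" using \<open>w \<in> range \<Psi> \<inter> rad x'\<close> by blast
    then show ?thesis using \<Psi>_rad[of p] linear_0[OF lin] by simp
  qed
  then have "range \<Psi> \<inter> rad x' = {0}"
    using subspace_0[OF subspace_rad, of x'] subspace_0[OF r\<Psi>] by blast
  then have "dim {u + v |u v. u \<in> range \<Psi> \<and> v \<in> rad x'} = 5 + dim (rad x')"
    using dim_sums_Int[OF r\<Psi> subspace_rad, of x'] dim5 by simp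
  moreover have "{u + v |u v. u \<in> range \<Psi> \<and> v \<in> rad x'} \<subseteq> range (\<theta> x')"
  proof safe
    fix v and p :: "real \<times> real \<times> real \<times> real \<times> real" assume "v \<in> rad x'"
    then have "v \<in> range (\<theta> x')" unfolding rad_def by blast
    moreover obtain p1 p2 p3 p4 p5 where p: "p = (p1, p2, p3, p4, p5)" by (metis prod.exhaust)
    have "\<Psi> p = \<theta> x' (p1 *\<^sub>R n1 + p2 *\<^sub>R n2 + p3 *\<^sub>R y + p4 *\<^sub>R z + p5 *\<^sub>R x)"
      by (simp add: \<Psi>_def p \<theta>_simps)
    then have "\<Psi> p \<in> range (\<theta> x')" by simp
    ultimately show "\<Psi> p + v \<in> range (\<theta> x')" by (intro subspace_add subspace_range)
  qed
  then have "dim {u + v |u v. u \<in> range \<Psi> \<and> v \<in> rad x'} \<le> dim (range (\<theta> x'))"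
    by (rule dim_subset)
  ultimately have "5 + dim (rad x') \<le> dim (range (\<theta> x'))" by simp
  then show False
    using dim_range_add_rad[of x'] rad_dim_ge_3[OF small x'] dimS by linarith
qed

end

text \<open>The quotient of \<open>S\<close> by \<open>R\<close> is modelled by the Euclidean
  complement of \<open>R\<close> in \<open>S\<close>, with orthogonal projection
  \<open>\<pi>\<close>. Since \<open>R\<close> is \<open>b\<close>-orthogonal to \<open>S\<close>,
  projecting leaves \<open>b\<close> unchanged on \<open>S\<close>, and the nullspace of the
  projected form consists of the \<open>u\<close> with all \<open>\<theta> u v\<close> in
  \<open>R\<close>.\<close>

lemma flat_nullity_modulo_radical:
  fixes b :: "'w::euclidean_space \<Rightarrow> 'w \<Rightarrow> real" and \<theta> :: "'v::euclidean_space \<Rightarrow> 'v \<Rightarrow> 'w"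
  assumes S: "subspace S" and R: "subspace R" "R \<subseteq> S" "\<And>x y. x \<in> R \<Longrightarrow> y \<in> S \<Longrightarrow> b x y = 0"
    and b: "bilinear b" "\<And>x y. b x y = b y x"
    and \<theta>: "bilinear \<theta>" "\<And>u v. \<theta> u v = \<theta> v u" "\<And>u v. \<theta> u v \<in> S"
    and flat: "\<And>u v w z. b (\<theta> u v) (\<theta> w z) = b (\<theta> u z) (\<theta> w v)"
    and total: "\<And>x. x \<in> S \<Longrightarrow> (\<And>u v. b x (\<theta> u v) = 0) \<Longrightarrow> x \<in> R"
    and dim: "dim S \<le> dim R + 10"
  shows "DIM('v) + dim R \<le> dim {u. \<forall>v. \<theta> u v \<in> R} + dim S"
proof -
  obtain E where E: "E \<subseteq> R" "pairwise orthogonal E" "\<And>x. x \<in> E \<Longrightarrow> norm x = 1"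
    "independent E" "card E = dim R" "span E = R"
    using orthonormal_basis_subspace[OF R(1)] by blast
  have finE: "finite E" using E(4) independent_bound by blast
  have inner_e: "e \<bullet> e' = (if e = e' then 1 else 0)" if "e \<in> E" "e' \<in> E" for e e'
    using E(2,3) that by (auto simp: pairwise_def orthogonal_def norm_eq_1)
  define \<pi> where "\<pi> w = w - (\<Sum>e\<in>E. (w \<bullet> e) *\<^sub>R e)" for w
  have \<pi>: "linear \<pi>"
    unfolding \<pi>_def
    by (intro linear_compose_sub linear_ident linear_compose_sum ballI linearI)
       (simp_all add: inner_add_left scaleR_add_left)
  have \<pi>_diff: "w - \<pi> w \<in> R" for w
    using E(1) R(1) by (auto simp: \<pi>_def intro!: subspace_sum subspace_scale)
  have \<pi>_orth: "orthogonal x (\<pi> w)" if "x \<in> R" for x w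
  proof -
    have *: "orthogonal (\<pi> w) e" if "e \<in> E" for e
    proof -
      have "\<pi> w \<bullet> e = w \<bullet> e - (\<Sum>e'\<in>E. (w \<bullet> e') * (e' \<bullet> e))"
        by (simp add: \<pi>_def inner_diff_left inner_sum_left)
      also have "(\<Sum>e'\<in>E. (w \<bullet> e') * (e' \<bullet> e)) = (\<Sum>e'\<in>E. if e' = e then w \<bullet> e' else 0)"
        by (rule sum.cong) (auto simp: inner_e that)
      also have "\<dots> = w \<bullet> e" using finE that by simp
      finally show ?thesis by (simp add: orthogonal_def)
    qed
    have "orthogonal (\<pi> w) x"
      using that E(6) by (intro orthogonal_to_span[of x E]) (auto intro: *)
    then show ?thesis by (simp add: orthogonal_commute)
  qed
  have \<pi>_0: "\<pi> w = 0 \<longleftrightarrow> w \<in> R" for w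
  proof
    show "w \<in> R" if "\<pi> w = 0" using \<pi>_diff[of w] that by simp
    show "\<pi> w = 0" if "w \<in> R"
      using subspace_diff[OF R(1) that \<pi>_diff[of w]] \<pi>_orth[of "\<pi> w" w]
      by (simp add: orthogonal_self)
  qed
  have \<pi>_S: "\<pi> w \<in> S" if "w \<in> S" for w
    using subspace_diff[OF S that subsetD[OF R(2) \<pi>_diff[of w]]] by simp
  have b\<pi>: "b x (\<pi> y) = b x y" "b (\<pi> y) x = b y x" if "x \<in> S" for x y
  proof -
    have "b (y - \<pi> y) x = 0" using R(3) \<pi>_diff that by blast
    then show "b (\<pi> y) x = b y x" by (simp add: bilinear_lsub[OF b(1)])
    then show "b x (\<pi> y) = b x y" by (simp add: b(2)[of x])
  qed
  let ?S = "{y \<in> S. \<forall>x\<in>R. orthogonal x y}"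
  have dimS: "dim ?S + dim R = dim S"
    by (rule dim_subspace_orthogonal_to_vectors[OF R(1) S R(2)])
  interpret flat_form ?S b "\<lambda>u v. \<pi> (\<theta> u v)"
  proof
    show "subspace ?S"
      using S by (auto simp: subspace_def orthogonal_def inner_add_right)
    show "bilinear b" "b x y = b y x" for x y by fact+
    have "linear (\<lambda>v. \<pi> (\<theta> u v))" "linear (\<lambda>u. \<pi> (\<theta> u v))" for u v
      using \<theta>(1) linear_compose[OF _ \<pi>] by (auto simp: bilinear_def o_def)
    then show "bilinear (\<lambda>u v. \<pi> (\<theta> u v))" by (simp add: bilinear_def)
    show "\<pi> (\<theta> u v) = \<pi> (\<theta> v u)" for u v by (subst \<theta>(2)) simp
    show "\<pi> (\<theta> u v) \<in> ?S" for u v using \<pi>_S \<pi>_orth \<theta>(3) by blast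
    show "b (\<pi> (\<theta> u v)) (\<pi> (\<theta> w z)) = b (\<pi> (\<theta> u z)) (\<pi> (\<theta> w v))" for u v w z
      using flat by (simp add: b\<pi> \<pi>_S \<theta>(3))
    fix x assume x: "x \<in> ?S" and x0: "\<And>u v. b x (\<pi> (\<theta> u v)) = 0"
    have "x \<in> R" using x x0 by (intro total) (auto simp: b\<pi>)
    then have "orthogonal x x" using x by blast
    then show "x = 0" by (simp add: orthogonal_self)
  qed
  have "DIM('v) \<le> dim nullspace + dim ?S"
    by (rule nullity_bound) (use dimS dim in linarith)
  moreover have "nullspace = {u. \<forall>v. \<theta> u v \<in> R}"
    by (simp add: nullspace_def \<pi>_0)
  ultimately show ?thesis using dimS by simp
qed

text \<open>The neutral form for which the graph of a linear map is totally isotropic exactly when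
  the map is skew.\<close>

definition split_form :: "'e::euclidean_space \<times> 'e \<Rightarrow> 'e \<times> 'e \<Rightarrow> real" where
  "split_form p q = fst p \<bullet> snd q + snd p \<bullet> fst q"

lemma bilinear_split_form: "bilinear split_form"
  by (auto simp: bilinear_def split_form_def intro!: linearI simp: inner_add_left inner_add_right algebra_simps)

lemma split_form_commute: "split_form p q = split_form q p"
  by (simp add: split_form_def inner_commute)

lemma split_form_nondegenerate:
  assumes "\<And>q. split_form p q = 0"
  shows "p = 0"
proof -
  have "fst p \<bullet> fst p = 0" "snd p \<bullet> snd p = 0"
    using assms[of "(0, fst p)"] assms[of "(snd p, 0)"] by (auto simp: split_form_def)
  then show ?thesis by (simp add: prod_eq_iff)
qed

lemma split_form_0_on_span:
  assumes "\<And>x y. x \<in> A \<Longrightarrow> y \<in> B \<Longrightarrow> split_form x y = 0" "p \<in> span A" "q \<in> span B"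
  shows "split_form p q = 0"
proof -
  note simps = bilinear_ladd[OF bilinear_split_form] bilinear_radd[OF bilinear_split_form]
    bilinear_lmul[OF bilinear_split_form] bilinear_rmul[OF bilinear_split_form]
    bilinear_lzero[OF bilinear_split_form] bilinear_rzero[OF bilinear_split_form]
  have 1: "split_form x q = 0" if "x \<in> A" for x
    using assms(3) by (induction rule: span_induct_alt) (simp_all add: simps assms(1) that)
  show ?thesis
    using assms(2) by (induction rule: span_induct_alt) (simp_all add: simps 1)
qed

text \<open>The span of \<open>P\<close> is itself the graph: it projects onto the first factor, and
  if \<open>(0, d)\<close> belongs to it, pairing with an element whose first component is
  \<open>d\<close> gives \<open>d \<bullet> d = 0\<close>.\<close>

lemma skew_map_exists:
  fixes P :: "('e::euclidean_space \<times> 'e) set"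
  assumes iso: "\<And>p q. p \<in> P \<Longrightarrow> q \<in> P \<Longrightarrow> split_form p q = 0" and span: "span (fst ` P) = UNIV"
  obtains \<Omega> where "linear \<Omega>" "\<And>x y. \<Omega> x \<bullet> y = - (x \<bullet> \<Omega> y)" "\<And>x y. (x, y) \<in> P \<Longrightarrow> \<Omega> x = y"
proof -
  let ?Q = "span P"
  have isoQ: "split_form p q = 0" if "p \<in> ?Q" "q \<in> ?Q" for p q
    using split_form_0_on_span[OF iso that] .
  have surj: "\<exists>q\<in>?Q. fst q = x" for x
  proof -
    have "linear (fst :: 'e \<times> 'e \<Rightarrow> 'e)" by (auto intro: linearI)
    then have "fst ` ?Q = UNIV" using span by (simp add: linear_span_image)
    then show ?thesis by (metis UNIV_I imageE)
  qed
  have uniq: "q = q'" if q: "q \<in> ?Q" "q' \<in> ?Q" "fst q = fst q'" for q q'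
  proof -
    have "q - q' \<in> ?Q" using q by (simp add: span_diff)
    moreover obtain r where "r \<in> ?Q" "fst r = snd (q - q')" using surj by blast
    ultimately have "split_form (q - q') r = 0" "fst r = snd (q - q')" using isoQ by auto
    then have "snd (q - q') \<bullet> snd (q - q') = 0" using q(3) by (simp add: split_form_def)
    then show ?thesis using q(3) by (simp add: prod_eq_iff)
  qed
  define \<Omega> where "\<Omega> x = snd (SOME q. q \<in> ?Q \<and> fst q = x)" for x
  have \<Omega>_in: "(x, \<Omega> x) \<in> ?Q" for x
  proof -
    have "\<exists>q. q \<in> ?Q \<and> fst q = x" using surj[of x] by blast
    from someI_ex[OF this] show ?thesis unfolding \<Omega>_def by (metis prod.collapse)
  qed
  have \<Omega>_eq: "\<Omega> x = y" if "(x, y) \<in> ?Q" for x y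
    using uniq[OF \<Omega>_in[of x] that] by simp
  show thesis
  proof
    show "linear \<Omega>"
    proof (rule linearI)
      show "\<Omega> (x + y) = \<Omega> x + \<Omega> y" for x y
        using span_add[OF \<Omega>_in[of x] \<Omega>_in[of y]] by (intro \<Omega>_eq) simp
      show "\<Omega> (k *\<^sub>R x) = k *\<^sub>R \<Omega> x" for k x
        using span_scale[OF \<Omega>_in[of x], of k] by (intro \<Omega>_eq) simp
    qed
    show "\<Omega> x \<bullet> y = - (x \<bullet> \<Omega> y)" for x y
      using isoQ[OF \<Omega>_in[of x] \<Omega>_in[of y]] by (simp add: split_form_def)
    show "\<Omega> x = y" if "(x, y) \<in> P" for x y
      using that by (intro \<Omega>_eq span_base)
  qed
qed

text \<open>
  The \<open>F i\<close> and \<open>G i\<close> stand for the derivatives of order \<open>i\<close> at a point of two maps \<open>F\<close>, \<open>G\<close>.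
\<close>

locale skew_jets =
  fixes F0 G0 :: "'e::euclidean_space" and F1 G1 :: "'v::euclidean_space \<Rightarrow> 'e"
    and F2 G2 :: "'v \<Rightarrow> 'v \<Rightarrow> 'e"
  assumes lin: "linear F1" "linear G1" "bilinear F2" "bilinear G2"
    and sym: "\<And>u v. F2 u v = F2 v u" "\<And>u v. G2 u v = G2 v u"
    and r00: "F0 \<bullet> G0 = 0"
    and r10: "\<And>u. F1 u \<bullet> G0 + G1 u \<bullet> F0 = 0"
    and r11: "\<And>u v. F1 u \<bullet> G1 v + G1 u \<bullet> F1 v = 0"
    and r20: "\<And>u v. F2 u v \<bullet> G0 + G2 u v \<bullet> F0 = 0"
    and r21: "\<And>u v w. F2 u v \<bullet> G1 w + G2 u v \<bullet> F1 w = 0"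
    and gauss: "\<And>u v w z. F2 u v \<bullet> G2 w z + G2 u v \<bullet> F2 w z = F2 u z \<bullet> G2 w v + G2 u z \<bullet> F2 w v"
    and indep: "\<And>a u. a *\<^sub>R F0 + F1 u = 0 \<Longrightarrow> a = 0 \<and> u = 0"
    and codim: "DIM('e) \<le> DIM('v) + 6"
    and nullity: "\<And>Y. subspace Y \<Longrightarrow> 1 \<le> dim Y \<Longrightarrow> (\<And>\<eta> u. \<eta> \<in> Y \<Longrightarrow> \<eta> \<bullet> F0 = 0 \<and> \<eta> \<bullet> F1 u = 0) \<Longrightarrow>
      dim {u. \<forall>v. \<forall>\<eta>\<in>Y. \<eta> \<bullet> F2 u v = 0} + 2 * dim Y + 1 \<le> DIM('v)"
begin

text \<open>The claim is that the span \<open>S\<close> of all jets equals its own radical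
  \<open>R\<close>. With \<open>N = DIM('e)\<close>, nondegeneracy gives
  \<open>dim S + dim R <= 2 N\<close>, which settles the case \<open>dim R >= N\<close>. Otherwise a
  space \<open>Y\<close> of dimension at least \<open>N - dim R\<close> is normal to the first
  components of \<open>R\<close>; the flat-form bound gives it nullity at least
  \<open>n - (dim S - dim R) >= n - 2 dim Y\<close>, where \<open>n = DIM('v)\<close>, against the
  assumption \<open>nullity\<close>.\<close>

lemma second_derivatives_null: "F2 u v \<bullet> G2 w z + G2 u v \<bullet> F2 w z = 0"
proof -
  define \<theta> where "\<theta> u v = (F2 u v, G2 u v)" for u v
  define \<Lambda> where "\<Lambda> p = (fst p *\<^sub>R F0 + F1 (snd p), fst p *\<^sub>R G0 + G1 (snd p))" for p :: "real \<times> 'v"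
  let ?T = "range (\<lambda>p. \<theta> (fst p) (snd p))"
  have \<Lambda>: "linear \<Lambda>"
    by (rule linearI) (simp_all add: \<Lambda>_def linear_add lin(1,2) linear_scale algebra_simps)
  have "inj \<Lambda>"
    unfolding linear_injective_0[OF \<Lambda>]
  proof (intro allI impI)
    fix p assume "\<Lambda> p = 0"
    then have "fst p *\<^sub>R F0 + F1 (snd p) = 0" by (simp add: \<Lambda>_def zero_prod_def)
    from indep[OF this] show "p = 0" by (simp add: prod_eq_iff)
  qed
  then have dim\<Lambda>: "dim (range \<Lambda>) = DIM('v) + 1"
    using dim_image_eq[OF \<Lambda>, of UNIV] by simp
  define S where "S = span (range \<Lambda> \<union> ?T)"
  have S: "subspace S" by (simp add: S_def)
  define R where "R = {w \<in> S. \<forall>s\<in>S. split_form w s = 0}"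
  have R: "subspace R"
    using S by (auto simp: R_def subspace_def bilinear_ladd[OF bilinear_split_form]
        bilinear_lmul[OF bilinear_split_form] bilinear_lzero[OF bilinear_split_form])
  have RS: "R \<subseteq> S" by (auto simp: R_def)
  have \<theta>S: "\<theta> u v \<in> S" for u v unfolding S_def by (intro span_base UnI2) (auto intro: image_eqI[of _ _ "(u, v)"])
  have \<Lambda>\<Lambda>: "split_form (\<Lambda> p) (\<Lambda> q) = 0" for p q
  proof -
    obtain a u a' u' where pq: "p = (a, u)" "q = (a', u')" by (metis prod.exhaust)
    have "split_form (\<Lambda> p) (\<Lambda> q) = a * a' * (F0 \<bullet> G0 + G0 \<bullet> F0) + a * (F0 \<bullet> G1 u' + G0 \<bullet> F1 u')
        + a' * (F1 u \<bullet> G0 + G1 u \<bullet> F0) + (F1 u \<bullet> G1 u' + G1 u \<bullet> F1 u')"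
      by (simp add: split_form_def \<Lambda>_def pq inner_add_left inner_add_right algebra_simps)
    moreover have "F0 \<bullet> G1 u' + G0 \<bullet> F1 u' = 0" using r10[of u'] by (simp add: inner_commute add.commute)
    ultimately show ?thesis using r00 by (simp add: r10 r11 inner_commute[of G0 F0])
  qed
  have \<Lambda>\<theta>: "split_form (\<Lambda> p) (\<theta> u v) = 0" for p u v
  proof -
    have "split_form (\<theta> u v) (\<Lambda> p) = fst p * (F2 u v \<bullet> G0 + G2 u v \<bullet> F0) + (F2 u v \<bullet> G1 (snd p) + G2 u v \<bullet> F1 (snd p))"
      by (simp add: split_form_def \<Lambda>_def \<theta>_def inner_add_right algebra_simps)
    then show ?thesis using r20 r21 by (simp add: split_form_commute)
  qed
  have \<Lambda>R: "range \<Lambda> \<subseteq> R"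
  proof
    fix w assume w: "w \<in> range \<Lambda>"
    have "split_form w s = 0" if "s \<in> S" for s
    proof (rule split_form_0_on_span[of "range \<Lambda>" "range \<Lambda> \<union> ?T"])
      show "split_form y z = 0" if "y \<in> range \<Lambda>" "z \<in> range \<Lambda> \<union> ?T" for y z
        using that \<Lambda>\<Lambda> \<Lambda>\<theta> by blast
    qed (use that w in \<open>simp_all add: S_def span_base\<close>)
    moreover have "w \<in> S" using w by (simp add: S_def span_base)
    ultimately show "w \<in> R" by (simp add: R_def)
  qed
  have dimR: "DIM('v) + 1 \<le> dim R" using dim_subset[OF \<Lambda>R] dim\<Lambda> by simp
  have dimSR: "dim S + dim R \<le> 2 * DIM('e)"
  proof -
    have "dim S + dim R \<le> dim (UNIV :: ('e \<times> 'e) set)"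
    proof (rule dim_perp_add_le[OF bilinear_split_form subspace_UNIV S R])
      show "x = 0" if "\<And>y. y \<in> UNIV \<Longrightarrow> split_form x y = 0" for x :: "'e \<times> 'e"
        using that by (intro split_form_nondegenerate) simp
    qed (auto simp: R_def)
    then show ?thesis by simp
  qed
  have total: "x \<in> R" if "x \<in> S" "\<And>u v. split_form x (\<theta> u v) = 0" for x
  proof -
    have "split_form x s = 0" if "s \<in> S" for s
    proof (rule split_form_0_on_span[of "{x}" "range \<Lambda> \<union> ?T"])
      show "split_form y z = 0" if "y \<in> {x}" "z \<in> range \<Lambda> \<union> ?T" for y z
      proof (cases "z \<in> range \<Lambda>")
        case True
        then have "split_form z x = 0" using \<Lambda>R \<open>x \<in> S\<close> unfolding R_def by blast
        then show ?thesis using that(1) by (simp add: split_form_commute)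
      qed (use that \<open>\<And>u v. split_form x (\<theta> u v) = 0\<close> in auto)
    qed (use that in \<open>auto simp: S_def span_base\<close>)
    then show ?thesis using that(1) by (simp add: R_def)
  qed
  have "S = R"
  proof (cases "dim R < DIM('e)")
    case False
    then have "dim S \<le> dim R" using dimSR dim_subset[OF RS] by linarith
    then show ?thesis using subspace_dim_equal[OF R S RS] by simp
  next
    case True
    \<comment> \<open>As \<open>R\<close> contains the first-order jets, \<open>Y\<close> is normal
      to \<open>F0\<close> and to all \<open>F1 u\<close>; and \<open>\<theta> u v\<close> in
      \<open>R\<close> for all \<open>v\<close> puts \<open>u\<close> into the nullity of
      \<open>Y\<close>.\<close>
    define Y where "Y = {y \<in> UNIV. \<forall>x\<in>fst ` R. orthogonal x y}"
    have Y: "subspace Y"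
      by (auto simp: Y_def subspace_def orthogonal_def inner_add_right)
    have linf: "linear (fst :: 'e \<times> 'e \<Rightarrow> 'e)" by (auto intro: linearI)
    have "dim Y + dim (fst ` R) = DIM('e)"
      using dim_subspace_orthogonal_to_vectors[OF linear_subspace_image[OF linf R] subspace_UNIV]
      by (simp add: Y_def)
    moreover have "dim (fst ` R) \<le> dim R" using dim_image_le[OF linf] .
    ultimately have dimY: "DIM('e) \<le> dim Y + dim R" by linarith
    have "dim {u. \<forall>v. \<forall>\<eta>\<in>Y. \<eta> \<bullet> F2 u v = 0} + 2 * dim Y + 1 \<le> DIM('v)"
    proof (rule nullity[OF Y])
      show "1 \<le> dim Y" using dimY True by linarith
      fix \<eta> u assume "\<eta> \<in> Y"
      moreover have "\<Lambda> (1, 0) \<in> R" "\<Lambda> (0, u) \<in> R" using \<Lambda>R by auto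
      then have "F0 \<in> fst ` R" "F1 u \<in> fst ` R"
        by (force simp: \<Lambda>_def linear_0[OF lin(1)] intro: image_eqI)+
      ultimately show "\<eta> \<bullet> F0 = 0 \<and> \<eta> \<bullet> F1 u = 0"
        by (auto simp: Y_def orthogonal_def inner_commute)
    qed
    moreover have "dim {u. \<forall>v. \<theta> u v \<in> R} \<le> dim {u. \<forall>v. \<forall>\<eta>\<in>Y. \<eta> \<bullet> F2 u v = 0}"
    proof (rule dim_subset, safe)
      fix u v \<eta> assume "\<forall>v. \<theta> u v \<in> R" "\<eta> \<in> Y"
      then have "F2 u v \<in> fst ` R" by (metis \<theta>_def fst_conv image_eqI)
      then show "\<eta> \<bullet> F2 u v = 0" using \<open>\<eta> \<in> Y\<close> by (auto simp: Y_def orthogonal_def inner_commute)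
    qed
    moreover have "DIM('v) + dim R \<le> dim {u. \<forall>v. \<theta> u v \<in> R} + dim S"
    proof (rule flat_nullity_modulo_radical[OF S R RS _ bilinear_split_form split_form_commute _ _ \<theta>S _ total])
      show "bilinear \<theta>"
        using lin(3,4) by (auto simp: bilinear_def \<theta>_def linear_iff)
      show "\<theta> u v = \<theta> v u" for u v by (simp add: \<theta>_def sym[of u v])
      show "split_form (\<theta> u v) (\<theta> w z) = split_form (\<theta> u z) (\<theta> w v)" for u v w z
        using gauss by (simp add: \<theta>_def split_form_def)
      \<comment> \<open>Here \<open>10 = 2 (n + 6) - 2 (n + 1)\<close> with
        \<open>n = DIM('v)\<close>.\<close>
      show "dim S \<le> dim R + 10" using dimSR dimR codim by linarith
    qed (auto simp: R_def)
    ultimately show ?thesis using dimY dimSR by linarith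
  qed
  then have "\<theta> u v \<in> R" using \<theta>S by blast
  then have "split_form (\<theta> u v) (\<theta> w z) = 0" using \<theta>S unfolding R_def by blast
  then show ?thesis by (simp add: \<theta>_def split_form_def)
qed

text \<open>A nonzero vector orthogonal to all these jets would span a line \<open>Y\<close> whose
  nullity is the whole space, against the case \<open>dim Y = 1\<close> of
  \<open>nullity\<close>.\<close>

lemma span_derivatives: "span ({F0} \<union> range F1 \<union> {F2 u v |u v. True}) = UNIV"
proof (rule ccontr)
  assume "\<not> ?thesis"
  then obtain \<eta> where \<eta>: "\<eta> \<noteq> 0" "\<forall>x \<in> span ({F0} \<union> range F1 \<union> {F2 u v |u v. True}). \<eta> \<bullet> x = 0"
    using span_not_UNIV_orthogonal by blast
  then have *: "\<eta> \<bullet> F0 = 0" "\<eta> \<bullet> F1 u = 0" "\<eta> \<bullet> F2 u v = 0" for u v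
    by (blast intro: span_base)+
  have "dim (span {\<eta>}) = 1"
    unfolding dim_span using \<eta>(1) by (subst dim_eq_card_independent) auto
  then have "dim {u. \<forall>v. \<forall>\<eta>'\<in>span {\<eta>}. \<eta>' \<bullet> F2 u v = 0} + 2 * dim (span {\<eta>}) + 1 \<le> DIM('v)"
    by (intro nullity subspace_span) (use * in \<open>auto simp: span_singleton\<close>)
  moreover have "{u. \<forall>v. \<forall>\<eta>'\<in>span {\<eta>}. \<eta>' \<bullet> F2 u v = 0} = UNIV"
    using * by (auto simp: span_singleton)
  ultimately show False by simp
qed

lemma skew_map:
  obtains \<Omega> where "linear \<Omega>" "\<And>x y. \<Omega> x \<bullet> y = - (x \<bullet> \<Omega> y)"
    "\<Omega> F0 = G0" "\<And>u. \<Omega> (F1 u) = G1 u" "\<And>u v. \<Omega> (F2 u v) = G2 u v"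
proof -
  let ?P = "{(F0, G0)} \<union> range (\<lambda>u. (F1 u, G1 u)) \<union> {(F2 u v, G2 u v) |u v. True}"
  have r01: "F0 \<bullet> G1 u + G0 \<bullet> F1 u = 0" and r02: "F0 \<bullet> G2 u v + G0 \<bullet> F2 u v = 0"
    and r12: "F1 w \<bullet> G2 u v + G1 w \<bullet> F2 u v = 0" for u v w
    using r10[of u] r20[of u v] r21[of u v w] by (simp_all add: inner_commute add.commute)
  have "fst ` ?P = {F0} \<union> range F1 \<union> {F2 u v |u v. True}" by (auto simp: image_iff) force+
  then have span: "span (fst ` ?P) = UNIV" using span_derivatives by simp
  have "split_form p q = 0" if "p \<in> ?P" "q \<in> ?P" for p q
    using that
    by (auto simp: split_form_def r01 r02 r12 r10 r11 r20 r21 second_derivatives_null r00 inner_commute[of G0 F0])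
  then obtain \<Omega> where "linear \<Omega>" "\<And>x y. \<Omega> x \<bullet> y = - (x \<bullet> \<Omega> y)" "\<And>x y. (x, y) \<in> ?P \<Longrightarrow> \<Omega> x = y"
    using skew_map_exists[OF _ span] by blast
  then show thesis by (intro that[of \<Omega>]) blast+
qed

end


subsection \<open>Smooth maps and directional derivatives\<close>

text \<open>The direction comes first so that a directional derivative is again a map of the point
  and can be iterated.\<close>

definition dir_deriv :: "'a::euclidean_space \<Rightarrow> ('a \<Rightarrow> 'b::euclidean_space) \<Rightarrow> 'a \<Rightarrow> 'b" where
  "dir_deriv v h z = frechet_derivative h (at z) v"

lemma dir_deriv_eqI: "(h has_derivative h') (at z) \<Longrightarrow> dir_deriv v h z = h' v"
  unfolding dir_deriv_def using frechet_derivative_at by metis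

lemma has_derivative_cong_on_open:
  assumes "open S" "z \<in> S" "\<And>y. y \<in> S \<Longrightarrow> h y = k y"
  shows "(h has_derivative h') (at z) \<longleftrightarrow> (k has_derivative h') (at z)"
  using has_derivative_transform_within_open[OF _ assms(1,2), of h h' UNIV k]
    has_derivative_transform_within_open[OF _ assms(1,2), of k h' UNIV h] assms(3) by auto

lemma dir_deriv_cong:
  assumes "open S" "z \<in> S" "\<And>y. y \<in> S \<Longrightarrow> h y = k y"
  shows "dir_deriv v h z = dir_deriv v k z"
  using has_derivative_cong_on_open[OF assms] by (simp add: dir_deriv_def frechet_derivative_def)

lemma k_smooth_on_Suc:
  "k_smooth_on (Suc k) S h \<longleftrightarrow> (\<forall>z\<in>S. h differentiable (at z)) \<and> (\<forall>v. k_smooth_on k S (dir_deriv v h))"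
  by (simp add: dir_deriv_def[abs_def])

declare k_smooth_on.simps(2) [simp del]

lemma k_smooth_on_cong:
  assumes "open S" "\<And>y. y \<in> S \<Longrightarrow> h y = h' y"
  shows "k_smooth_on k S h \<longleftrightarrow> k_smooth_on k S h'"
  using assms(2)
proof (induction k arbitrary: h h')
  case 0
  then show ?case by (simp cong: continuous_on_cong)
next
  case (Suc k)
  have "h differentiable (at z) \<longleftrightarrow> h' differentiable (at z)" if "z \<in> S" for z
    unfolding differentiable_def
    using has_derivative_cong_on_open[OF assms(1) that Suc.prems] by simp
  moreover have "k_smooth_on k S (dir_deriv v h) \<longleftrightarrow> k_smooth_on k S (dir_deriv v h')" for v
    by (intro Suc.IH dir_deriv_cong[OF assms(1)] Suc.prems)
  ultimately show ?case by (simp add: k_smooth_on_Suc)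
qed

lemma k_smooth_on_decrease: "k_smooth_on (Suc k) S h \<Longrightarrow> k_smooth_on k S h"
proof (induction k arbitrary: h)
  case 0
  then show ?case
    by (auto simp: k_smooth_on_Suc intro!: continuous_at_imp_continuous_on differentiable_imp_continuous_within)
next
  case (Suc k)
  then show ?case using k_smooth_on_Suc[of "Suc k" S h] k_smooth_on_Suc[of k S h] by blast
qed

lemma has_derivative_dir_deriv:
  assumes "h differentiable (at z)"
  shows "(h has_derivative (\<lambda>v. dir_deriv v h z)) (at z)"
  using assms unfolding dir_deriv_def by (simp add: frechet_derivative_works)

lemma k_smooth_on_add:
  assumes "open S" "k_smooth_on k S f" "k_smooth_on k S g"
  shows "k_smooth_on k S (\<lambda>z. f z + g z)"
  using assms(2,3)
proof (induction k arbitrary: f g)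
  case 0
  then show ?case by (auto intro: continuous_on_add)
next
  case (Suc k)
  have "dir_deriv v (\<lambda>z. f z + g z) z = dir_deriv v f z + dir_deriv v g z" if "z \<in> S" for z v
    using Suc.prems that unfolding k_smooth_on_Suc
    by (intro dir_deriv_eqI has_derivative_add has_derivative_dir_deriv) auto
  then have "k_smooth_on k S (dir_deriv v (\<lambda>z. f z + g z)) \<longleftrightarrow>
      k_smooth_on k S (\<lambda>z. dir_deriv v f z + dir_deriv v g z)" for v
    by (intro k_smooth_on_cong assms(1))
  then show ?case using Suc unfolding k_smooth_on_Suc by (auto intro: differentiable_add)
qed

text \<open>By the product rule the derivative is a sum of two terms of the same shape in maps of
  one order less. A general \<open>B\<close> covers inner products, scalar multiples and real
  products at once.\<close>

lemma k_smooth_on_bilinear: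
  fixes B :: "'b::euclidean_space \<Rightarrow> 'c::euclidean_space \<Rightarrow> 'd::euclidean_space"
  assumes B: "bounded_bilinear B" and "open S" "k_smooth_on k S f" "k_smooth_on k S g"
  shows "k_smooth_on k S (\<lambda>z. B (f z) (g z))"
  using assms(3,4)
proof (induction k arbitrary: f g)
  case 0
  then show ?case by (auto intro: bounded_bilinear.continuous_on[OF B])
next
  case (Suc k)
  have D: "((\<lambda>z. B (f z) (g z)) has_derivative (\<lambda>v. B (f z) (dir_deriv v g z) + B (dir_deriv v f z) (g z))) (at z)"
    if "z \<in> S" for z
    using Suc.prems that unfolding k_smooth_on_Suc
    by (intro bounded_bilinear.FDERIV[OF B] has_derivative_dir_deriv) auto
  have "k_smooth_on k S (dir_deriv v (\<lambda>z. B (f z) (g z))) \<longleftrightarrow>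
      k_smooth_on k S (\<lambda>z. B (f z) (dir_deriv v g z) + B (dir_deriv v f z) (g z))" for v
    using dir_deriv_eqI[OF D] by (intro k_smooth_on_cong assms(2)) auto
  moreover have "k_smooth_on k S (\<lambda>z. B (f z) (dir_deriv v g z) + B (dir_deriv v f z) (g z))" for v
    using Suc.prems k_smooth_on_decrease unfolding k_smooth_on_Suc[of k S f] k_smooth_on_Suc[of k S g]
    by (intro k_smooth_on_add assms(2) Suc.IH) (use Suc.prems k_smooth_on_decrease in blast)+
  ultimately show ?case using D unfolding k_smooth_on_Suc differentiable_def by blast
qed

lemma k_smooth_on_const:
  fixes S :: "'a::euclidean_space set" and c :: "'b::euclidean_space"
  shows "k_smooth_on k S (\<lambda>z. c)"
proof (induction k arbitrary: c)
  case (Suc k)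
  have "dir_deriv v (\<lambda>z::'a. c) = (\<lambda>z. 0)" for v
    by (rule ext, rule dir_deriv_eqI) (rule has_derivative_const)
  then show ?case using Suc by (simp add: k_smooth_on_Suc)
qed simp

lemma smooth_on_add:
  assumes "open S" "smooth_on S f" "smooth_on S g"
  shows "smooth_on S (\<lambda>z. f z + g z)"
  using assms k_smooth_on_add unfolding smooth_on_def by blast

lemma smooth_on_bilinear:
  assumes "bounded_bilinear B" "open S" "smooth_on S f" "smooth_on S g"
  shows "smooth_on S (\<lambda>z. B (f z) (g z))"
  using assms k_smooth_on_bilinear unfolding smooth_on_def by blast

lemma smooth_on_const: "smooth_on S (\<lambda>z. c)"
  by (simp add: smooth_on_def k_smooth_on_const)

text \<open>A linear map is treated as a bilinear one whose first factor is the constant 1.\<close>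

lemma smooth_on_linear:
  assumes "open S" "linear L" "smooth_on S f"
  shows "smooth_on S (\<lambda>z. L (f z))"
proof -
  have "bounded_bilinear (\<lambda>(x::real) y. x *\<^sub>R L y)"
    using assms(2) linear_conv_bounded_linear
    by (intro bounded_bilinear.comp[OF bounded_bilinear_scaleR bounded_linear_ident]) blast
  from smooth_on_bilinear[OF this assms(1) smooth_on_const[of S 1] assms(3)] show ?thesis by simp
qed

lemma smooth_on_diff:
  assumes "open S" "smooth_on S f" "smooth_on S g"
  shows "smooth_on S (\<lambda>z. f z - g z)"
  using smooth_on_add[OF assms(1,2) smooth_on_linear[OF assms(1) _ assms(3)], of uminus]
  by (simp add: linear_uminus)

lemma smooth_on_Pair:
  assumes "open S" "smooth_on S f" "smooth_on S g"
  shows "smooth_on S (\<lambda>z. (f z, g z))"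
proof -
  have "linear (\<lambda>x::'b. (x, 0::'c))" "linear (\<lambda>y::'c. (0::'b, y))" by (auto intro: linearI)
  from smooth_on_add[OF assms(1) smooth_on_linear[OF assms(1) this(1) assms(2)] smooth_on_linear[OF assms(1) this(2) assms(3)]]
  show ?thesis by simp
qed

lemma smooth_on_dir_deriv: "smooth_on S h \<Longrightarrow> smooth_on S (dir_deriv v h)"
  unfolding smooth_on_def using k_smooth_on_Suc by blast

lemma smooth_on_imp_continuous_on: "smooth_on S h \<Longrightarrow> continuous_on S h"
  unfolding smooth_on_def using k_smooth_on.simps(1) by blast

lemma smooth_on_imp_differentiable: "smooth_on S h \<Longrightarrow> z \<in> S \<Longrightarrow> h differentiable (at z)"
  unfolding smooth_on_def using k_smooth_on_Suc by blast

lemma smooth_on_has_derivative: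
  "smooth_on S h \<Longrightarrow> z \<in> S \<Longrightarrow> (h has_derivative (\<lambda>v. dir_deriv v h z)) (at z)"
  by (intro has_derivative_dir_deriv smooth_on_imp_differentiable)

lemma linear_dir_deriv: "smooth_on S h \<Longrightarrow> z \<in> S \<Longrightarrow> linear (\<lambda>v. dir_deriv v h z)"
  using smooth_on_has_derivative has_derivative_linear by blast

lemma dir_deriv_linear:
  assumes "linear L" "smooth_on S f" "z \<in> S"
  shows "dir_deriv v (\<lambda>z. L (f z)) z = L (dir_deriv v f z)"
proof (intro dir_deriv_eqI)
  have "bounded_linear L" using assms(1) linear_conv_bounded_linear by blast
  then show "((\<lambda>z. L (f z)) has_derivative (\<lambda>v. L (dir_deriv v f z))) (at z)"
    using smooth_on_has_derivative[OF assms(2,3)] by (rule bounded_linear.has_derivative)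
qed

section \<open>Symmetry of second derivatives\<close>

lemma DERIV_along_line:
  fixes h :: "'a::euclidean_space \<Rightarrow> real"
  assumes "smooth_on S h" "p + s *\<^sub>R u \<in> S"
  shows "DERIV (\<lambda>s. h (p + s *\<^sub>R u)) s :> dir_deriv u h (p + s *\<^sub>R u)"
proof -
  have "((\<lambda>s. p + s *\<^sub>R u) has_derivative (\<lambda>t. t *\<^sub>R u)) (at s)"
    by (auto intro!: derivative_eq_intros)
  then have "((\<lambda>s. h (p + s *\<^sub>R u)) has_derivative (\<lambda>t. dir_deriv (t *\<^sub>R u) h (p + s *\<^sub>R u))) (at s)"
    by (rule has_derivative_compose[where f = "\<lambda>s. p + s *\<^sub>R u" and g = h, OF _ smooth_on_has_derivative[OF assms]])
  moreover have "dir_deriv (t *\<^sub>R u) h (p + s *\<^sub>R u) = dir_deriv u h (p + s *\<^sub>R u) * t" for t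
    using linear_scale[OF linear_dir_deriv[OF assms]] by simp
  ultimately show ?thesis by (simp add: has_field_derivative_def)
qed

lemma second_difference_mean_value:
  fixes h :: "'a::euclidean_space \<Rightarrow> real"
  assumes h: "smooth_on S h" and \<epsilon>: "\<epsilon> > 0"
    and S: "\<And>s t. 0 \<le> s \<Longrightarrow> s \<le> \<epsilon> \<Longrightarrow> 0 \<le> t \<Longrightarrow> t \<le> \<epsilon> \<Longrightarrow> z + s *\<^sub>R u + t *\<^sub>R v \<in> S"
  obtains s t where "0 < s" "s < \<epsilon>" "0 < t" "t < \<epsilon>"
    "h (z + \<epsilon> *\<^sub>R u + \<epsilon> *\<^sub>R v) - h (z + \<epsilon> *\<^sub>R u) - h (z + \<epsilon> *\<^sub>R v) + h z
      = \<epsilon>\<^sup>2 * dir_deriv v (dir_deriv u h) (z + s *\<^sub>R u + t *\<^sub>R v)"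
proof -
  define g where "g s = h ((z + \<epsilon> *\<^sub>R v) + s *\<^sub>R u) - h (z + s *\<^sub>R u)" for s
  have "DERIV g s :> dir_deriv u h ((z + \<epsilon> *\<^sub>R v) + s *\<^sub>R u) - dir_deriv u h (z + s *\<^sub>R u)"
    if "0 \<le> s" "s \<le> \<epsilon>" for s
    unfolding g_def using S[OF that, of \<epsilon>] S[OF that, of 0] \<epsilon>
    by (intro DERIV_diff DERIV_along_line[OF h]) (auto simp: algebra_simps)
  from MVT2[OF \<epsilon> this]
  obtain s where s: "0 < s" "s < \<epsilon>"
    "g \<epsilon> - g 0 = \<epsilon> * (dir_deriv u h ((z + \<epsilon> *\<^sub>R v) + s *\<^sub>R u) - dir_deriv u h (z + s *\<^sub>R u))"
    by auto
  have "DERIV (\<lambda>t. dir_deriv u h ((z + s *\<^sub>R u) + t *\<^sub>R v)) t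
      :> dir_deriv v (dir_deriv u h) ((z + s *\<^sub>R u) + t *\<^sub>R v)" if "0 \<le> t" "t \<le> \<epsilon>" for t
    using S[of s t] s that by (intro DERIV_along_line[OF smooth_on_dir_deriv[OF h]]) auto
  from MVT2[OF \<epsilon> this]
  obtain t where t: "0 < t" "t < \<epsilon>"
    "dir_deriv u h (z + s *\<^sub>R u + \<epsilon> *\<^sub>R v) - dir_deriv u h (z + s *\<^sub>R u)
      = \<epsilon> * dir_deriv v (dir_deriv u h) (z + s *\<^sub>R u + t *\<^sub>R v)"
    by auto
  show thesis
  proof (rule that[OF s(1,2) t(1,2)])
    have "h (z + \<epsilon> *\<^sub>R u + \<epsilon> *\<^sub>R v) - h (z + \<epsilon> *\<^sub>R u) - h (z + \<epsilon> *\<^sub>R v) + h z = g \<epsilon> - g 0"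
      by (simp add: g_def algebra_simps)
    also have "\<dots> = \<epsilon>\<^sup>2 * dir_deriv v (dir_deriv u h) (z + s *\<^sub>R u + t *\<^sub>R v)"
      using s(3) t(3) by (simp add: power2_eq_square algebra_simps)
    finally show "h (z + \<epsilon> *\<^sub>R u + \<epsilon> *\<^sub>R v) - h (z + \<epsilon> *\<^sub>R u) - h (z + \<epsilon> *\<^sub>R v) + h z
      = \<epsilon>\<^sup>2 * dir_deriv v (dir_deriv u h) (z + s *\<^sub>R u + t *\<^sub>R v)" .
  qed
qed

text \<open>The second difference is symmetric in \<open>u\<close> and \<open>v\<close>, so the mean
  value theorem makes the two mixed derivatives agree at two points of an arbitrarily small
  parallelogram; continuity moves both points to \<open>z\<close>.\<close>

lemma dir_deriv_commute_real:
  fixes h :: "'a::euclidean_space \<Rightarrow> real"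
  assumes S: "open S" "z \<in> S" and h: "smooth_on S h"
  shows "dir_deriv v (dir_deriv u h) z = dir_deriv u (dir_deriv v h) z"
proof (rule ccontr)
  define a where "a = dir_deriv v (dir_deriv u h)"
  define b where "b = dir_deriv u (dir_deriv v h)"
  assume "\<not> ?thesis"
  then have ab: "a z \<noteq> b z" by (simp add: a_def b_def)
  have cont: "isCont a z" "isCont b z"
    using smooth_on_imp_continuous_on[OF smooth_on_dir_deriv[OF smooth_on_dir_deriv[OF h]]] S
    by (auto simp: a_def b_def continuous_on_eq_continuous_at)
  define e where "e = \<bar>a z - b z\<bar> / 2"
  have e: "e > 0" using ab by (simp add: e_def)
  obtain r1 where r1: "r1 > 0" "\<And>y. dist y z < r1 \<Longrightarrow> \<bar>a y - a z\<bar> < e"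
    using cont(1) e unfolding continuous_at_eps_delta dist_real_def by blast
  obtain r2 where r2: "r2 > 0" "\<And>y. dist y z < r2 \<Longrightarrow> \<bar>b y - b z\<bar> < e"
    using cont(2) e unfolding continuous_at_eps_delta dist_real_def by blast
  obtain r3 where r3: "r3 > 0" "\<And>y. dist y z < r3 \<Longrightarrow> y \<in> S"
    using S unfolding open_dist by blast
  define r where "r = min r1 (min r2 r3)"
  have r: "r > 0" using r1 r2 r3 by (simp add: r_def)
  define \<epsilon> where "\<epsilon> = r / (norm u + norm v + 1)"
  have pos: "norm u + norm v + 1 > 0" by (simp add: add_nonneg_pos)
  have \<epsilon>: "\<epsilon> > 0" using r pos by (simp add: \<epsilon>_def)
  have near: "dist (z + s *\<^sub>R u + t *\<^sub>R v) z < r" if "0 \<le> s" "s \<le> \<epsilon>" "0 \<le> t" "t \<le> \<epsilon>" for s t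
  proof -
    have "dist (z + s *\<^sub>R u + t *\<^sub>R v) z = norm (s *\<^sub>R u + t *\<^sub>R v)"
      by (simp add: dist_norm add.assoc)
    also have "\<dots> \<le> s * norm u + t * norm v"
      using norm_triangle_ineq[of "s *\<^sub>R u" "t *\<^sub>R v"] that by simp
    also have "\<dots> \<le> \<epsilon> * norm u + \<epsilon> * norm v"
      using that by (intro add_mono mult_right_mono) auto
    also have "\<dots> < \<epsilon> * (norm u + norm v + 1)" using \<epsilon> by (simp add: algebra_simps)
    also have "\<dots> = r" using pos by (simp add: \<epsilon>_def)
    finally show ?thesis .
  qed
  obtain s t where st: "0 < s" "s < \<epsilon>" "0 < t" "t < \<epsilon>"
    "h (z + \<epsilon> *\<^sub>R u + \<epsilon> *\<^sub>R v) - h (z + \<epsilon> *\<^sub>R u) - h (z + \<epsilon> *\<^sub>R v) + h z = \<epsilon>\<^sup>2 * a (z + s *\<^sub>R u + t *\<^sub>R v)"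
    using second_difference_mean_value[OF h \<epsilon>, of z u v] near r3 unfolding a_def r_def by (metis min_less_iff_conj)
  obtain s' t' where st': "0 < s'" "s' < \<epsilon>" "0 < t'" "t' < \<epsilon>"
    "h (z + \<epsilon> *\<^sub>R v + \<epsilon> *\<^sub>R u) - h (z + \<epsilon> *\<^sub>R v) - h (z + \<epsilon> *\<^sub>R u) + h z = \<epsilon>\<^sup>2 * b (z + s' *\<^sub>R v + t' *\<^sub>R u)"
  proof (rule second_difference_mean_value[OF h \<epsilon>, of z v u])
    show "z + s *\<^sub>R v + t *\<^sub>R u \<in> S" if "0 \<le> s" "s \<le> \<epsilon>" "0 \<le> t" "t \<le> \<epsilon>" for s t
      using near[of t s] that r3(2)[of "z + s *\<^sub>R v + t *\<^sub>R u"] by (simp add: r_def algebra_simps)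
  qed (use that in \<open>auto simp: b_def\<close>)
  have "\<epsilon>\<^sup>2 * a (z + s *\<^sub>R u + t *\<^sub>R v) = \<epsilon>\<^sup>2 * b (z + s' *\<^sub>R v + t' *\<^sub>R u)"
    using st(5) st'(5) by (simp add: algebra_simps)
  then have "a (z + s *\<^sub>R u + t *\<^sub>R v) = b (z + s' *\<^sub>R v + t' *\<^sub>R u)" using \<epsilon> by simp
  moreover have "\<bar>a (z + s *\<^sub>R u + t *\<^sub>R v) - a z\<bar> < e"
    using near[of s t] st by (intro r1(2)) (simp add: r_def)
  moreover have "\<bar>b (z + s' *\<^sub>R v + t' *\<^sub>R u) - b z\<bar> < e"
    using near[of t' s'] st' by (intro r2(2)) (simp add: r_def algebra_simps)
  ultimately have "\<bar>a z - b z\<bar> < e + e" by (smt (verit))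
  then show False by (simp add: e_def)
qed

lemma dir_deriv_commute:
  fixes h :: "'a::euclidean_space \<Rightarrow> 'b::euclidean_space"
  assumes S: "open S" "z \<in> S" and h: "smooth_on S h"
  shows "dir_deriv v (dir_deriv u h) z = dir_deriv u (dir_deriv v h) z"
proof (rule euclidean_eqI)
  fix e :: 'b assume "e \<in> Basis"
  have lin: "linear (\<lambda>x::'b. x \<bullet> e)" by (intro linearI) (simp_all add: inner_add_left)
  have *: "dir_deriv v (dir_deriv u h) z \<bullet> e = dir_deriv v (dir_deriv u (\<lambda>z. h z \<bullet> e)) z" for u v
  proof -
    have "dir_deriv v (dir_deriv u h) z \<bullet> e = dir_deriv v (\<lambda>z. dir_deriv u h z \<bullet> e) z"
      using dir_deriv_linear[OF lin smooth_on_dir_deriv[OF h] S(2)] by simp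
    also have "\<dots> = dir_deriv v (dir_deriv u (\<lambda>z. h z \<bullet> e)) z"
      using dir_deriv_linear[OF lin h] by (intro dir_deriv_cong[OF S]) simp
    finally show ?thesis .
  qed
  show "dir_deriv v (dir_deriv u h) z \<bullet> e = dir_deriv u (dir_deriv v h) z \<bullet> e"
    unfolding * by (rule dir_deriv_commute_real[OF S smooth_on_linear[OF S(1) lin h]])
qed


subsection \<open>Local triviality of isometric bendings\<close>

text \<open>The jet relations have the shape of a sum of two inner products, one for
  \<open>F\<close> against \<open>G\<close> and one for \<open>G\<close> against \<open>F\<close>;
  this is the product rule that passes from each order to the next.\<close>

lemma dir_deriv_inner_sum_0:
  assumes S: "open S" "z \<in> S" and sm: "smooth_on S f" "smooth_on S g" "smooth_on S f'" "smooth_on S g'"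
    and 0: "\<And>z. z \<in> S \<Longrightarrow> f z \<bullet> g z + f' z \<bullet> g' z = 0"
  shows "dir_deriv v f z \<bullet> g z + f z \<bullet> dir_deriv v g z + dir_deriv v f' z \<bullet> g' z + f' z \<bullet> dir_deriv v g' z = 0"
proof -
  have "((\<lambda>z. f z \<bullet> g z + f' z \<bullet> g' z) has_derivative
      (\<lambda>v. (f z \<bullet> dir_deriv v g z + dir_deriv v f z \<bullet> g z) + (f' z \<bullet> dir_deriv v g' z + dir_deriv v f' z \<bullet> g' z))) (at z)"
    by (intro has_derivative_add bounded_bilinear.FDERIV[OF bounded_bilinear_inner]
        smooth_on_has_derivative[OF sm(1) S(2)] smooth_on_has_derivative[OF sm(2) S(2)]
        smooth_on_has_derivative[OF sm(3) S(2)] smooth_on_has_derivative[OF sm(4) S(2)])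
  then have "dir_deriv v (\<lambda>z. f z \<bullet> g z + f' z \<bullet> g' z) z =
      (f z \<bullet> dir_deriv v g z + dir_deriv v f z \<bullet> g z) + (f' z \<bullet> dir_deriv v g' z + dir_deriv v f' z \<bullet> g' z)"
    by (rule dir_deriv_eqI)
  moreover have "dir_deriv v (\<lambda>z. f z \<bullet> g z + f' z \<bullet> g' z) z = dir_deriv v (\<lambda>z. 0::real) z"
    by (rule dir_deriv_cong[OF S 0])
  moreover have "dir_deriv v (\<lambda>z. 0::real) z = 0"
    by (rule dir_deriv_eqI[OF has_derivative_const])
  ultimately show ?thesis by simp
qed

lemma span_image_finite_sum:
  assumes "finite I" "x \<in> span (f ` I)"
  shows "\<exists>a. x = (\<Sum>i\<in>I. a i *\<^sub>R f i)"
  using assms(2)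
proof (induction rule: span_induct_alt)
  case base
  show ?case by (rule exI[of _ "\<lambda>_. 0"]) simp
next
  case (step c y z)
  then obtain i a where "i \<in> I" "y = f i" "z = (\<Sum>i\<in>I. a i *\<^sub>R f i)" by blast
  then have "c *\<^sub>R y + z = (\<Sum>j\<in>I. (a j + (if j = i then c else 0)) *\<^sub>R f j)"
    using assms(1) by (simp add: scaleR_add_left sum.distrib if_distrib[of "\<lambda>c. c *\<^sub>R _"] cong: if_cong)
  then show ?case by (rule exI[of _ "\<lambda>j. a j + (if j = i then c else 0)"])
qed

text \<open>Each basis vector is expanded in the \<open>X i z0\<close> with coefficients frozen at
  \<open>z0\<close>. At a nearby \<open>z\<close> the expansion has total error
  \<open>Q z <= 1/2\<close>, so that with \<open>N\<close> the sum of the norms of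
  \<open>\<Delta>\<close> on the basis one gets \<open>N <= L m + N / 2\<close>, and the error term
  is absorbed.\<close>

lemma linear_norm_bound_near:
  fixes X :: "'i \<Rightarrow> 'a::euclidean_space \<Rightarrow> 'e::euclidean_space"
  assumes I: "finite I" and D: "open D" "z0 \<in> D" and cont: "\<And>i. i \<in> I \<Longrightarrow> continuous_on D (X i)"
    and span: "span ((\<lambda>i. X i z0) ` I) = UNIV"
  obtains \<delta> C where "\<delta> > 0" "C > 0" "cball z0 \<delta> \<subseteq> D"
    "\<And>(\<Delta> :: 'e \<Rightarrow> 'e) z y. linear \<Delta> \<Longrightarrow> z \<in> cball z0 \<delta> \<Longrightarrow> norm (\<Delta> y) \<le> C * (\<Sum>i\<in>I. norm (\<Delta> (X i z))) * norm y"
proof -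
  have "\<exists>a. \<forall>e. e = (\<Sum>i\<in>I. a e i *\<^sub>R X i z0)"
    using span_image_finite_sum[OF I] span by (intro choice) blast
  then obtain a where a: "\<And>e. e = (\<Sum>i\<in>I. a e i *\<^sub>R X i z0)" by blast
  define Q where "Q z = (\<Sum>e\<in>Basis. norm (e - (\<Sum>i\<in>I. a e i *\<^sub>R X i z)))" for z
  have "continuous_on D Q"
    unfolding Q_def by (intro continuous_intros cont)
  then have "isCont Q z0" using D continuous_on_eq_continuous_at by blast
  moreover have "Q z0 = 0" unfolding Q_def using a by simp
  ultimately obtain \<delta>1 where \<delta>1: "\<delta>1 > 0" "\<And>z. dist z z0 < \<delta>1 \<Longrightarrow> \<bar>Q z\<bar> < 1 / 2"
    unfolding continuous_at_eps_delta dist_real_def by (metis diff_zero half_gt_zero zero_less_one)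
  obtain \<delta>2 where \<delta>2: "\<delta>2 > 0" "cball z0 \<delta>2 \<subseteq> D" using D open_contains_cball by blast
  define L where "L = (\<Sum>e\<in>(Basis::'e set). \<Sum>i\<in>I. \<bar>a e i\<bar>)"
  have L0: "L \<ge> 0" by (simp add: L_def sum_nonneg)
  define \<delta> where "\<delta> = min (\<delta>1 / 2) \<delta>2"
  show thesis
  proof
    show "\<delta> > 0" using \<delta>1 \<delta>2 by (simp add: \<delta>_def)
    show "2 * (L + 1) > 0" using L0 by simp
    show "cball z0 \<delta> \<subseteq> D" using \<delta>2 by (auto simp: \<delta>_def)
    fix \<Delta> :: "'e \<Rightarrow> 'e" and z :: 'a and y :: 'e assume \<Delta>: "linear \<Delta>" and z: "z \<in> cball z0 \<delta>"
    have "dist z z0 < \<delta>1" using z \<delta>1 by (auto simp: \<delta>_def dist_commute)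
    then have Qz: "Q z \<le> 1 / 2" using \<delta>1(2) by fastforce
    define N where "N = (\<Sum>e\<in>Basis. norm (\<Delta> e))"
    define m where "m = (\<Sum>i\<in>I. norm (\<Delta> (X i z)))"
    have N0: "N \<ge> 0" and m0: "m \<ge> 0" by (simp_all add: N_def m_def sum_nonneg)
    have bound: "norm (\<Delta> y) \<le> N * norm y" for y
    proof -
      have "\<Delta> y = (\<Sum>e\<in>Basis. (y \<bullet> e) *\<^sub>R \<Delta> e)"
        by (rule linear_basis_sum[OF \<Delta>])
      then have "norm (\<Delta> y) \<le> (\<Sum>e\<in>Basis. \<bar>y \<bullet> e\<bar> * norm (\<Delta> e))"
        by (metis (no_types, lifting) norm_scaleR norm_sum sum.cong)
      also have "\<dots> \<le> (\<Sum>e\<in>Basis. norm y * norm (\<Delta> e))"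
        by (intro sum_mono mult_right_mono) (auto simp: Basis_le_norm)
      finally show ?thesis by (simp add: N_def sum_distrib_left mult.commute)
    qed
    have "norm (\<Delta> e) \<le> (\<Sum>i\<in>I. \<bar>a e i\<bar>) * m + N * norm (e - (\<Sum>i\<in>I. a e i *\<^sub>R X i z))" for e
    proof -
      have "\<Delta> e = (\<Sum>i\<in>I. a e i *\<^sub>R \<Delta> (X i z)) + \<Delta> (e - (\<Sum>i\<in>I. a e i *\<^sub>R X i z))"
        using \<Delta> by (simp add: linear_diff linear_sum linear_scale)
      then have "norm (\<Delta> e) \<le> norm (\<Sum>i\<in>I. a e i *\<^sub>R \<Delta> (X i z)) + norm (\<Delta> (e - (\<Sum>i\<in>I. a e i *\<^sub>R X i z)))"
        by (metis norm_triangle_ineq)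
      also have "norm (\<Sum>i\<in>I. a e i *\<^sub>R \<Delta> (X i z)) \<le> (\<Sum>i\<in>I. \<bar>a e i\<bar> * norm (\<Delta> (X i z)))"
        using norm_sum[of "\<lambda>i. a e i *\<^sub>R \<Delta> (X i z)" I] by simp
      also have "\<dots> \<le> (\<Sum>i\<in>I. \<bar>a e i\<bar> * m)"
        using I by (intro sum_mono mult_left_mono) (auto simp: m_def intro!: member_le_sum)
      also have "\<dots> = (\<Sum>i\<in>I. \<bar>a e i\<bar>) * m" by (simp add: sum_distrib_right)
      finally show ?thesis using bound[of "e - (\<Sum>i\<in>I. a e i *\<^sub>R X i z)"] by linarith
    qed
    then have "N \<le> (\<Sum>e\<in>Basis. (\<Sum>i\<in>I. \<bar>a e i\<bar>) * m + N * norm (e - (\<Sum>i\<in>I. a e i *\<^sub>R X i z)))"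
      unfolding N_def by (intro sum_mono) (simp add: N_def)
    also have "\<dots> = L * m + N * Q z"
      by (simp add: sum.distrib L_def Q_def sum_distrib_left sum_distrib_right)
    also have "\<dots> \<le> L * m + N * (1 / 2)" using Qz N0 by (intro add_left_mono mult_left_mono)
    finally have "N \<le> 2 * L * m" by simp
    also have "\<dots> \<le> 2 * (L + 1) * m" using m0 by (intro mult_right_mono) auto
    finally have "N * norm y \<le> 2 * (L + 1) * m * norm y" by (rule mult_right_mono) simp
    then show "norm (\<Delta> y) \<le> 2 * (L + 1) * (\<Sum>i\<in>I. norm (\<Delta> (X i z))) * norm y"
      using bound[of y] by (simp add: m_def)
  qed
qed

text \<open>Gronwall's argument, as a contraction on a small ball.\<close>

lemma zero_near_if_derivative_bounded:
  fixes h :: "'i \<Rightarrow> 'a::euclidean_space \<Rightarrow> 'e::euclidean_space"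
  assumes I: "finite I" and \<delta>: "\<delta> > 0"
    and der: "\<And>i z. i \<in> I \<Longrightarrow> z \<in> cball z0 \<delta> \<Longrightarrow> (h i has_derivative h' i z) (at z)"
    and bound: "\<And>i z v. i \<in> I \<Longrightarrow> z \<in> cball z0 \<delta> \<Longrightarrow> norm (h' i z v) \<le> C * (\<Sum>j\<in>I. norm (h j z)) * norm v"
    and C: "C \<ge> 0" and init: "\<And>i. i \<in> I \<Longrightarrow> h i z0 = 0"
  obtains r where "r > 0" "r \<le> \<delta>" "\<And>i z. i \<in> I \<Longrightarrow> z \<in> ball z0 r \<Longrightarrow> h i z = 0"
proof -
  \<comment> \<open>With \<open>r <= 1 / K\<close>, summing the mean value estimates at a maximum
    point \<open>y\<close> of \<open>m\<close> gives \<open>m y <= m y / 2\<close>. The summand 1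
    keeps \<open>K\<close> positive when \<open>C = 0\<close>.\<close>
  define K where "K = 2 * (real (card I) * C + 1)"
  have K: "K > 0" using C by (auto simp: K_def intro!: add_nonneg_pos)
  define r where "r = min \<delta> (1 / K)"
  have r: "r > 0" "r \<le> \<delta>" using \<delta> K by (auto simp: r_def)
  define m where "m z = (\<Sum>j\<in>I. norm (h j z))" for z
  have sub: "z \<in> cball z0 \<delta>" if "z \<in> cball z0 r" for z using that r by auto
  have "continuous_on (cball z0 r) (h i)" if "i \<in> I" for i
    using der[OF that sub] by (intro continuous_at_imp_continuous_on ballI has_derivative_continuous)
  then have "continuous_on (cball z0 r) m"
    unfolding m_def by (intro continuous_intros)
  then obtain y where y: "y \<in> cball z0 r" "\<And>z. z \<in> cball z0 r \<Longrightarrow> m z \<le> m y"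
    using continuous_attains_sup[OF compact_cball, of z0 r m] r by auto
  have m0: "m z \<ge> 0" for z by (simp add: m_def sum_nonneg)
  have hi: "norm (h i z) \<le> C * m y * r" if "i \<in> I" "z \<in> cball z0 r" for i z
  proof -
    have "norm (h i z - h i z0) \<le> (C * m y) * norm (z - z0)"
    proof (rule differentiable_bound[OF convex_cball, of z0 r])
      show "(h i has_derivative h' i w) (at w within cball z0 r)" if "w \<in> cball z0 r" for w
        using der[OF \<open>i \<in> I\<close> sub[OF that]] by (rule has_derivative_at_withinI)
      show "onorm (h' i w) \<le> C * m y" if w: "w \<in> cball z0 r" for w
      proof (rule onorm_le)
        fix v
        have "norm (h' i w v) \<le> C * m w * norm v"
          using bound[OF \<open>i \<in> I\<close> sub[OF w]] by (simp add: m_def)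
        also have "\<dots> \<le> C * m y * norm v" using y(2)[OF w] C by (intro mult_right_mono mult_left_mono) auto
        finally show "norm (h' i w v) \<le> C * m y * norm v" .
      qed
    qed (use that r in auto)
    also have "\<dots> \<le> (C * m y) * r"
      using that(2) C m0 by (intro mult_left_mono) (auto simp: dist_norm norm_minus_commute)
    finally show ?thesis using init[OF that(1)] by simp
  qed
  have "m y \<le> (\<Sum>j\<in>I. C * m y * r)" unfolding m_def[of y] by (intro sum_mono hi[unfolded m_def] y(1))
  also have "\<dots> = (real (card I) * C * r) * m y" by simp
  also have "\<dots> \<le> (1 / 2) * m y"
  proof (rule mult_right_mono)
    have "real (card I) * C * r \<le> (K / 2) * (1 / K)"
      using C r by (intro mult_mono) (auto simp: K_def r_def)
    then show "real (card I) * C * r \<le> 1 / 2" using K by simp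
  qed (rule m0)
  finally have my: "m y = 0" using m0[of y] by linarith
  show thesis
  proof
    fix i z assume i: "i \<in> I" and z: "z \<in> ball z0 r"
    then show "h i z = 0" using hi[OF i, of z] my by auto
  qed (use r in auto)
qed

lemma bilinear_second_dir_deriv:
  assumes S: "open S" "z \<in> S" and h: "smooth_on S h"
  shows "bilinear (\<lambda>u v. dir_deriv u (dir_deriv v h) z)"
  unfolding bilinear_def
proof (intro conjI allI)
  show "linear (\<lambda>u. dir_deriv u (dir_deriv v h) z)" for v
    by (rule linear_dir_deriv[OF smooth_on_dir_deriv[OF h] S(2)])
  then show "linear (\<lambda>v. dir_deriv u (dir_deriv v h) z)" for u
    by (subst dir_deriv_commute[OF S h])
qed

text \<open>Interface between the light-cone geometry and the rigidity argument. The Lorentzian form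
  has been absorbed into \<open>G\<close>, so all pairings are Euclidean; for the lift, the slack 6
  in \<open>codim\<close> is the bound 4 on the codimension plus the two extra coordinates.\<close>

locale skew_pair =
  fixes D :: "'v::euclidean_space set" and F G :: "'v \<Rightarrow> 'e::euclidean_space"
  assumes D: "open D" and F: "smooth_on D F" and G: "smooth_on D G"
    and r0: "\<And>z. z \<in> D \<Longrightarrow> F z \<bullet> G z = 0"
    and r11: "\<And>z u v. z \<in> D \<Longrightarrow> dir_deriv u F z \<bullet> dir_deriv v G z + dir_deriv u G z \<bullet> dir_deriv v F z = 0"
    and indep: "\<And>z a u. z \<in> D \<Longrightarrow> a *\<^sub>R F z + dir_deriv u F z = 0 \<Longrightarrow> a = 0 \<and> u = 0"
    and codim: "DIM('e) \<le> DIM('v) + 6"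
    and nullity: "\<And>z Y. z \<in> D \<Longrightarrow> subspace Y \<Longrightarrow> 1 \<le> dim Y \<Longrightarrow>
      (\<And>\<eta> u. \<eta> \<in> Y \<Longrightarrow> \<eta> \<bullet> F z = 0 \<and> \<eta> \<bullet> dir_deriv u F z = 0) \<Longrightarrow>
      dim {u. \<forall>v. \<forall>\<eta>\<in>Y. \<eta> \<bullet> dir_deriv u (dir_deriv v F) z = 0} + 2 * dim Y + 1 \<le> DIM('v)"
begin

abbreviation "F1 u \<equiv> dir_deriv u F"
abbreviation "G1 u \<equiv> dir_deriv u G"
abbreviation "F2 u v \<equiv> dir_deriv u (dir_deriv v F)"
abbreviation "G2 u v \<equiv> dir_deriv u (dir_deriv v G)"
abbreviation "F3 u v w \<equiv> dir_deriv u (dir_deriv v (dir_deriv w F))"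
abbreviation "G3 u v w \<equiv> dir_deriv u (dir_deriv v (dir_deriv w G))"

lemmas sm = F G smooth_on_dir_deriv[OF F] smooth_on_dir_deriv[OF G]
  smooth_on_dir_deriv[OF smooth_on_dir_deriv[OF F]] smooth_on_dir_deriv[OF smooth_on_dir_deriv[OF G]]

section \<open>Jet relations up to order three\<close>

lemma sym:
  assumes z: "z \<in> D"
  shows "F2 u v z = F2 v u z" "G2 u v z = G2 v u z"
    "F3 u v w z = F3 v u w z" "F3 u v w z = F3 u w v z" "G3 u v w z = G3 v u w z" "G3 u v w z = G3 u w v z"
proof -
  show "F2 u v z = F2 v u z" "G2 u v z = G2 v u z" "F3 u v w z = F3 v u w z" "G3 u v w z = G3 v u w z"
    by (intro dir_deriv_commute[OF D z] sm)+
  show "F3 u v w z = F3 u w v z" "G3 u v w z = G3 u w v z"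
    by (intro dir_deriv_cong[OF D z] dir_deriv_commute[OF D] sm; assumption)+
qed

lemma r10:
  assumes "z \<in> D"
  shows "F1 u z \<bullet> G z + G1 u z \<bullet> F z = 0"
  using dir_deriv_inner_sum_0[OF D assms F G F G, of u] r0
  by (simp add: inner_commute)

lemma r20:
  assumes "z \<in> D"
  shows "F2 u v z \<bullet> G z + G2 u v z \<bullet> F z = 0"
  using dir_deriv_inner_sum_0[OF D assms sm(3) G sm(4) F, of v v u] r10 r11[OF assms, of v u] by simp

text \<open>Koszul's argument: the expression \<open>K\<close> is symmetric in its first two
  arguments and, by differentiating \<open>r11\<close>, skew in its last two; such a trilinear
  expression vanishes.\<close>

lemma r21:
  assumes "z \<in> D"
  shows "F2 u v z \<bullet> G1 w z + G2 u v z \<bullet> F1 w z = 0"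
proof -
  define K where "K u v w = F2 u v z \<bullet> G1 w z + G2 u v z \<bullet> F1 w z" for u v w
  have skew: "K w u v + K w v u = 0" for u v w
    using dir_deriv_inner_sum_0[OF D assms sm(3) sm(4) sm(4) sm(3), of u v u v w] r11
    by (simp add: K_def inner_commute)
  have sym: "K u v w = K v u w" for u v w
    using sym(1,2)[OF assms, of u v] by (simp add: K_def)
  have "K u v w = 0"
    using skew[of u v w] skew[of v u w] skew[of w u v] sym[of u v w] sym[of u w v] sym[of v w u] by linarith
  then show ?thesis by (simp add: K_def)
qed

lemma gauss_aux:
  assumes "z \<in> D"
  shows "F3 t u v z \<bullet> G1 w z + F2 u v z \<bullet> G2 t w z + G3 t u v z \<bullet> F1 w z + G2 u v z \<bullet> F2 t w z = 0"
  using dir_deriv_inner_sum_0[OF D assms sm(5) sm(4) sm(6) sm(3), of u v w u v w t] r21 by simp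

text \<open>The linearized Gauss equation. Differentiating \<open>r21\<close> and exchanging
  \<open>t\<close> with \<open>v\<close> leaves the third-order terms unchanged, so they drop out of
  the difference. This is the flatness of the second-order form.\<close>

lemma gauss:
  assumes "z \<in> D"
  shows "F2 u v z \<bullet> G2 w t z + G2 u v z \<bullet> F2 w t z = F2 u t z \<bullet> G2 w v z + G2 u t z \<bullet> F2 w v z"
proof -
  have "F3 t u v z = F3 v u t z" "G3 t u v z = G3 v u t z" using sym(3-6)[OF assms] by metis+
  then show ?thesis
    using gauss_aux[OF assms, of t u v w] gauss_aux[OF assms, of v u t w]
      sym(1,2)[OF assms, of w t] sym(1,2)[OF assms, of w v] by simp
qed

lemma skew_jets:
  assumes z: "z \<in> D"
  shows "skew_jets (F z) (G z) (\<lambda>u. F1 u z) (\<lambda>u. G1 u z) (\<lambda>u v. F2 u v z) (\<lambda>u v. G2 u v z)"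
proof (rule skew_jets.intro)
  show "linear (\<lambda>u. F1 u z)" "linear (\<lambda>u. G1 u z)" by (rule linear_dir_deriv[OF _ z], rule F G)+
  show "bilinear (\<lambda>u v. F2 u v z)" "bilinear (\<lambda>u v. G2 u v z)"
    by (rule bilinear_second_dir_deriv[OF D z], rule F G)+
  show "F2 u v z = F2 v u z" "G2 u v z = G2 v u z" for u v by (rule sym[OF z])+
  show "F z \<bullet> G z = 0" by (rule r0[OF z])
  show "F1 u z \<bullet> G z + G1 u z \<bullet> F z = 0" for u by (rule r10[OF z])
  show "F1 u z \<bullet> G1 v z + G1 u z \<bullet> F1 v z = 0" for u v by (rule r11[OF z])
  show "F2 u v z \<bullet> G z + G2 u v z \<bullet> F z = 0" for u v by (rule r20[OF z])
  show "F2 u v z \<bullet> G1 w z + G2 u v z \<bullet> F1 w z = 0" for u v w by (rule r21[OF z])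
  show "F2 u v z \<bullet> G2 w t z + G2 u v z \<bullet> F2 w t z = F2 u t z \<bullet> G2 w v z + G2 u t z \<bullet> F2 w v z" for u v w t
    by (rule gauss[OF z])
  show "a = 0 \<and> u = 0" if "a *\<^sub>R F z + F1 u z = 0" for a u by (rule indep[OF z that])
  show "DIM('e) \<le> DIM('v) + 6" by (rule codim)
  show "dim {u. \<forall>v. \<forall>\<eta>\<in>Y. \<eta> \<bullet> F2 u v z = 0} + 2 * dim Y + 1 \<le> DIM('v)"
    if "subspace Y" "1 \<le> dim Y" "\<And>\<eta> u. \<eta> \<in> Y \<Longrightarrow> \<eta> \<bullet> F z = 0 \<and> \<eta> \<bullet> F1 u z = 0" for Y
    by (rule nullity[OF z that])
qed

lemma null:
  assumes "z \<in> D"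
  shows "F2 u v z \<bullet> G2 w t z + G2 u v z \<bullet> F2 w t z = 0"
  by (rule skew_jets.second_derivatives_null[OF skew_jets[OF assms]])

text \<open>
  The left-hand side changes sign when \<open>(v, w)\<close> and \<open>(s, t)\<close> are exchanged, but the symmetries
  of the derivatives make it totally symmetric in all five arguments.
\<close>

lemma third_orthogonal_to_second:
  assumes z: "z \<in> D"
  shows "F3 u v w z \<bullet> G2 s t z + G3 u v w z \<bullet> F2 s t z = 0"
proof -
  define \<tau> where "\<tau> u v w s t = F3 u v w z \<bullet> G2 s t z + G3 u v w z \<bullet> F2 s t z" for u v w s t
  have flip: "\<tau> u v w s t + \<tau> u s t v w = 0" for u v w s t
  proof -
    have "F2 v w y \<bullet> G2 s t y + G2 v w y \<bullet> F2 s t y = 0" if "y \<in> D" for y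
      by (rule null[OF that])
    from dir_deriv_inner_sum_0[OF D z sm(5) sm(6) sm(6) sm(5) this, of u]
    show ?thesis
      using inner_commute[of "F3 u s t z" "G2 v w z"] inner_commute[of "G3 u s t z" "F2 v w z"]
      unfolding \<tau>_def by linarith
  qed
  have s1: "\<tau> u v w s t = \<tau> v u w s t" and s2: "\<tau> u v w s t = \<tau> u w v s t" and s3: "\<tau> u v w s t = \<tau> u v w t s"
    for u v w s t
    using sym(3,5)[OF z, of u v w] sym(4,6)[OF z, of u v w] sym(1,2)[OF z, of s t] by (simp_all add: \<tau>_def)
  \<comment> \<open>Two uses of \<open>flip\<close>, separated by the exchange of the first two
    arguments, move \<open>s\<close> into first position; the two signs cancel.\<close>
  have swap: "\<tau> u v w s t = \<tau> s v w u t" for u v w s t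
    using flip[of u v w s t] s1[of u s t v w] flip[of s u t v w] by linarith
  \<comment> \<open>The chain realizes the exchange of \<open>(v, w)\<close> with
    \<open>(s, t)\<close> at fixed \<open>u\<close> by sign-preserving moves only, so that
    \<open>flip\<close> leaves \<open>\<tau>\<close> equal to its negative.\<close>
  have "\<tau> u v w s t = \<tau> s v w u t" by (rule swap)
  also have "\<dots> = \<tau> w s v t u" by (metis s1 s2 s3)
  also have "\<dots> = \<tau> t s v w u" by (rule swap)
  also have "\<dots> = \<tau> v s t u w" by (metis s1 s2 s3)
  also have "\<dots> = \<tau> u s t v w" by (rule swap)
  finally show ?thesis using flip[of u v w s t] by (simp add: \<tau>_def)
qed

lemma third_orthogonal:
  assumes z: "z \<in> D"
  shows "F3 u v w z \<bullet> G z + G3 u v w z \<bullet> F z = 0" "F3 u v w z \<bullet> G1 t z + G3 u v w z \<bullet> F1 t z = 0"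
proof -
  show "F3 u v w z \<bullet> G z + G3 u v w z \<bullet> F z = 0"
    using dir_deriv_inner_sum_0[OF D z sm(5) G sm(6) F, of v w v w u] r20 r21[OF z, of v w u] by simp
  show "F3 u v w z \<bullet> G1 t z + G3 u v w z \<bullet> F1 t z = 0"
    using gauss_aux[OF z, of u v w t] null[OF z, of v w u t] by simp
qed

text \<open>The defect of \<open>\<Omega>\<close> on a third-order jet is orthogonal to every jet of
  order at most two, by skewness and the third-order relations. Those jets span, so the defect is
  zero.\<close>

lemma skew_map_exists:
  assumes z: "z \<in> D"
  obtains \<Omega> where "linear \<Omega>" "\<And>x y. \<Omega> x \<bullet> y = - (x \<bullet> \<Omega> y)"
    "\<Omega> (F z) = G z" "\<And>u. \<Omega> (F1 u z) = G1 u z" "\<And>u v. \<Omega> (F2 u v z) = G2 u v z"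
    "\<And>u v w. \<Omega> (F3 u v w z) = G3 u v w z"
proof -
  obtain \<Omega> where \<Omega>: "linear \<Omega>" "\<And>x y. \<Omega> x \<bullet> y = - (x \<bullet> \<Omega> y)"
    "\<Omega> (F z) = G z" "\<And>u. \<Omega> (F1 u z) = G1 u z" "\<And>u v. \<Omega> (F2 u v z) = G2 u v z"
    by (rule skew_jets.skew_map[OF skew_jets[OF z]]) (rule that)
  have "\<Omega> (F3 u v w z) = G3 u v w z" for u v w
  proof -
    define r where "r = G3 u v w z - \<Omega> (F3 u v w z)"
    have r: "r \<bullet> x = G3 u v w z \<bullet> x + F3 u v w z \<bullet> \<Omega> x" for x
      by (simp add: r_def inner_diff_left \<Omega>(2))
    let ?X = "{F z} \<union> range (\<lambda>u. F1 u z) \<union> {F2 u v z |u v. True}"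
    have "orthogonal r r"
    proof (rule orthogonal_to_span[of r ?X r])
      show "r \<in> span ?X" using skew_jets.span_derivatives[OF skew_jets[OF z]] by simp
      show "orthogonal r x" if "x \<in> ?X" for x
        using that third_orthogonal[OF z, of u v w] third_orthogonal_to_second[OF z, of u v w]
        by (auto simp: orthogonal_def r \<Omega>(3-5) add.commute)
    qed
    then show ?thesis by (simp add: r_def orthogonal_self)
  qed
  with \<Omega> show thesis using that by blast
qed

section \<open>Comparison of the skew maps at nearby points\<close>

definition jet :: "('v \<Rightarrow> 'e) \<Rightarrow> 'v list \<Rightarrow> 'v \<Rightarrow> 'e" where
  "jet h us = foldr dir_deriv us h"

lemma jet_simps: "jet h [] = h" "jet h (u # us) = dir_deriv u (jet h us)"
  by (simp_all add: jet_def)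

lemma smooth_on_jet: "smooth_on D h \<Longrightarrow> smooth_on D (jet h us)"
  by (induction us) (auto simp: jet_simps intro: smooth_on_dir_deriv)

text \<open>A finite index set for the jets of order at most two. The cutoff lies one below the
  order to which the skew maps match, so differentiating a framed jet stays within that
  order.\<close>

definition frames :: "'v list set" where
  "frames = {us. set us \<subseteq> Basis \<and> length us \<le> 2}"

lemma finite_frames: "finite frames"
  unfolding frames_def by (rule finite_lists_length_le) simp

lemma span_jets:
  assumes z: "z \<in> D"
  shows "span ((\<lambda>us. jet F us z) ` frames) = UNIV"
proof -
  let ?X = "(\<lambda>us. jet F us z) ` frames"
  have 0: "F z \<in> span ?X"
    by (rule span_base, rule image_eqI[of _ _ "[]"]) (auto simp: jet_simps frames_def)
  have 1: "F1 u z \<in> span ?X" for u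
  proof -
    have "F1 u z = (\<Sum>i\<in>Basis. (u \<bullet> i) *\<^sub>R F1 i z)"
      by (rule linear_basis_sum[OF linear_dir_deriv[OF F z]])
    moreover have "F1 i z \<in> span ?X" if "i \<in> Basis" for i
      by (rule span_base, rule image_eqI[of _ _ "[i]"]) (use that in \<open>auto simp: jet_simps frames_def\<close>)
    ultimately show ?thesis by (auto intro: span_sum span_scale)
  qed
  have 2: "F2 u v z \<in> span ?X" for u v
  proof -
    have "F2 u v z = (\<Sum>i\<in>Basis. \<Sum>j\<in>Basis. (u \<bullet> i * (v \<bullet> j)) *\<^sub>R F2 i j z)"
    proof -
      have "F2 u v z = (\<Sum>(i, j)\<in>Basis \<times> Basis. ((u \<bullet> i) * (v \<bullet> j)) *\<^sub>R F2 i j z)"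
        using bilinear_sum[OF bilinear_second_dir_deriv[OF D z F],
            of "\<lambda>i. (u \<bullet> i) *\<^sub>R i" Basis "\<lambda>j. (v \<bullet> j) *\<^sub>R j" Basis]
          bilinear_lmul[OF bilinear_second_dir_deriv[OF D z F]]
          bilinear_rmul[OF bilinear_second_dir_deriv[OF D z F]]
        by (simp add: euclidean_representation split_def mult.commute)
      then show ?thesis by (simp add: sum.cartesian_product)
    qed
    moreover have "F2 i j z \<in> span ?X" if "i \<in> Basis" "j \<in> Basis" for i j
      by (rule span_base, rule image_eqI[of _ _ "[i, j]"]) (use that in \<open>auto simp: jet_simps frames_def\<close>)
    ultimately show ?thesis by (auto intro!: span_sum span_scale)
  qed
  have "{F z} \<union> range (\<lambda>u. F1 u z) \<union> {F2 u v z |u v. True} \<subseteq> span ?X"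
    using 0 1 2 by blast
  then have "span ({F z} \<union> range (\<lambda>u. F1 u z) \<union> {F2 u v z |u v. True}) \<subseteq> span ?X"
    by (rule span_minimal) simp
  then show ?thesis
    using skew_jets.span_derivatives[OF skew_jets[OF z]] by blast
qed

text \<open>The defect \<open>h us\<close> of the fixed map \<open>\<Omega> z0\<close> is smooth,
  and on jets of order at most three it equals \<open>\<Delta> z\<close> applied to the jet of
  \<open>F\<close>. As the framed jets span, \<open>\<Delta> z\<close> is bounded by its values on
  them, that is, by the \<open>h us z\<close> themselves. The derivatives of the \<open>h us\<close>
  are thus bounded by the \<open>h us\<close>, and all of them vanish at \<open>z0\<close>.\<close>

lemma locally_constant_skew_map:
  assumes z0: "z0 \<in> D"
  obtains r \<Omega> where "r > 0" "linear \<Omega>" "\<And>x y. \<Omega> x \<bullet> y = - (x \<bullet> \<Omega> y)"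
    "\<And>z. z \<in> ball z0 r \<Longrightarrow> z \<in> D \<and> G z = \<Omega> (F z)"
proof -
  have "\<exists>\<Omega>. linear \<Omega> \<and> (\<forall>x y. \<Omega> x \<bullet> y = - (x \<bullet> \<Omega> y)) \<and> (\<forall>us. length us \<le> 3 \<longrightarrow> \<Omega> (jet F us z) = jet G us z)"
    if z: "z \<in> D" for z
  proof -
    obtain \<Omega> where \<Omega>: "linear \<Omega>" "\<And>x y. \<Omega> x \<bullet> y = - (x \<bullet> \<Omega> y)"
      "\<Omega> (F z) = G z" "\<And>u. \<Omega> (F1 u z) = G1 u z" "\<And>u v. \<Omega> (F2 u v z) = G2 u v z"
      "\<And>u v w. \<Omega> (F3 u v w z) = G3 u v w z"
      by (rule skew_map_exists[OF z]) (rule that)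
    have "\<Omega> (jet F us z) = jet G us z" if len: "length us \<le> 3" for us
    proof -
      consider "us = []" | u where "us = [u]" | u v where "us = [u, v]" | u v w where "us = [u, v, w]"
        using len
        by (auto simp: numeral_3_eq_3 length_Suc_conv le_Suc_eq)
      then show ?thesis by cases (simp_all add: jet_simps \<Omega>)
    qed
    then show ?thesis using \<Omega>(1,2) by blast
  qed
  then obtain \<Omega> where \<Omega>: "\<And>z. z \<in> D \<Longrightarrow> linear (\<Omega> z)" "\<And>z x y. z \<in> D \<Longrightarrow> \<Omega> z x \<bullet> y = - (x \<bullet> \<Omega> z y)"
    "\<And>z us. z \<in> D \<Longrightarrow> length us \<le> 3 \<Longrightarrow> \<Omega> z (jet F us z) = jet G us z"
    by metis
  define \<Delta> where "\<Delta> z x = \<Omega> z x - \<Omega> z0 x" for z x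
  have lin\<Delta>: "linear (\<Delta> z)" if "z \<in> D" for z
    unfolding \<Delta>_def by (intro linear_compose_sub \<Omega>(1) that z0)
  define h where "h us z = jet G us z - \<Omega> z0 (jet F us z)" for us z
  have h\<Delta>: "h us z = \<Delta> z (jet F us z)" if "z \<in> D" "length us \<le> 3" for us z
    using \<Omega>(3)[OF that] by (simp add: h_def \<Delta>_def)
  have smF: "smooth_on D (jet F us)" and smG: "smooth_on D (jet G us)" for us
    by (intro smooth_on_jet F G)+
  obtain \<delta> C where \<delta>: "\<delta> > 0" "C > 0" "cball z0 \<delta> \<subseteq> D" and
    C: "\<And>(\<Delta> :: 'e \<Rightarrow> 'e) z y. linear \<Delta> \<Longrightarrow> z \<in> cball z0 \<delta> \<Longrightarrow>
      norm (\<Delta> y) \<le> C * (\<Sum>us\<in>frames. norm (\<Delta> (jet F us z))) * norm y"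
    using linear_norm_bound_near[OF finite_frames D z0 smooth_on_imp_continuous_on[OF smF] span_jets[OF z0]]
    by blast
  \<comment> \<open>The derivative of \<open>h us\<close> involves the jets \<open>v # us\<close>,
    up to order three; compactness of the ball makes their bound uniform.\<close>
  define \<kappa> where "\<kappa> z = (\<Sum>us\<in>frames. \<Sum>i\<in>Basis. norm (jet F (i # us) z))" for z
  have "continuous_on (cball z0 \<delta>) \<kappa>"
    unfolding \<kappa>_def by (intro continuous_intros continuous_on_subset[OF smooth_on_imp_continuous_on[OF smF] \<delta>(3)])
  then obtain y where y: "y \<in> cball z0 \<delta>" "\<And>z. z \<in> cball z0 \<delta> \<Longrightarrow> \<kappa> z \<le> \<kappa> y"
    using continuous_attains_sup[OF compact_cball, of z0 \<delta> \<kappa>] \<delta>(1) by auto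
  have \<kappa>0: "\<kappa> z \<ge> 0" for z by (simp add: \<kappa>_def sum_nonneg)
  obtain r where r: "r > 0" "r \<le> \<delta>" "\<And>us z. us \<in> frames \<Longrightarrow> z \<in> ball z0 r \<Longrightarrow> h us z = 0"
  proof (rule zero_near_if_derivative_bounded[where h = h, OF finite_frames \<delta>(1)])
    fix us z assume us: "us \<in> frames" and z: "z \<in> cball z0 \<delta>"
    then have zD: "z \<in> D" using \<delta>(3) by blast
    have len: "length us \<le> 2" using us by (simp add: frames_def)
    have "bounded_linear (\<Omega> z0)" using \<Omega>(1)[OF z0] linear_conv_bounded_linear by blast
    then show "(h us has_derivative (\<lambda>v. jet G (v # us) z - \<Omega> z0 (jet F (v # us) z))) (at z)"
      unfolding h_def jet_simps
      by (intro has_derivative_diff smooth_on_has_derivative[OF smG zD]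
          bounded_linear.has_derivative[of "\<Omega> z0"] smooth_on_has_derivative[OF smF zD])
    fix v
    have "norm (jet F (v # us) z) \<le> \<kappa> y * norm v"
    proof -
      have "jet F (v # us) z = (\<Sum>i\<in>Basis. (v \<bullet> i) *\<^sub>R jet F (i # us) z)"
        unfolding jet_simps by (rule linear_basis_sum[OF linear_dir_deriv[OF smF zD]])
      then have "norm (jet F (v # us) z) \<le> (\<Sum>i\<in>Basis. norm ((v \<bullet> i) *\<^sub>R jet F (i # us) z))"
        by (simp only: norm_sum)
      also have "\<dots> \<le> (\<Sum>i\<in>Basis. norm v * norm (jet F (i # us) z))"
        by (intro sum_mono) (auto simp: Basis_le_norm intro: mult_right_mono)
      also have "\<dots> = norm v * (\<Sum>i\<in>Basis. norm (jet F (i # us) z))"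
        by (simp add: sum_distrib_left)
      also have "\<dots> \<le> norm v * \<kappa> z"
        unfolding \<kappa>_def using finite_frames us
        by (intro mult_left_mono member_le_sum[of us frames]) (auto simp: sum_nonneg)
      also have "\<dots> \<le> norm v * \<kappa> y" using y(2)[OF z] by (intro mult_left_mono) auto
      finally show ?thesis by (simp add: mult.commute)
    qed
    have "jet G (v # us) z - \<Omega> z0 (jet F (v # us) z) = \<Delta> z (jet F (v # us) z)"
      using h\<Delta>[OF zD, of "v # us"] len by (simp add: h_def)
    then have "norm (jet G (v # us) z - \<Omega> z0 (jet F (v # us) z))
        \<le> C * (\<Sum>us\<in>frames. norm (\<Delta> z (jet F us z))) * norm (jet F (v # us) z)"
      using C[OF lin\<Delta>[OF zD] z] by simp
    also have "\<dots> \<le> C * (\<Sum>us\<in>frames. norm (\<Delta> z (jet F us z))) * (\<kappa> y * norm v)"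
      using \<delta>(2) \<open>norm (jet F (v # us) z) \<le> \<kappa> y * norm v\<close> by (intro mult_left_mono) (auto simp: sum_nonneg)
    also have "(\<Sum>us\<in>frames. norm (\<Delta> z (jet F us z))) = (\<Sum>us\<in>frames. norm (h us z))"
      using h\<Delta>[OF zD] by (intro sum.cong) (auto simp: frames_def)
    finally show "norm (jet G (v # us) z - \<Omega> z0 (jet F (v # us) z)) \<le> (C * \<kappa> y) * (\<Sum>us\<in>frames. norm (h us z)) * norm v"
      by (simp add: mult_ac)
  next
    show "C * \<kappa> y \<ge> 0" using \<delta>(2) \<kappa>0 by simp
    show "h us z0 = 0" if "us \<in> frames" for us
      using h\<Delta>[OF z0, of us] that by (simp add: frames_def \<Delta>_def)
  qed blast
  show thesis
  proof (rule that[OF r(1) \<Omega>(1)[OF z0] \<Omega>(2)[OF z0]])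
    fix z assume z: "z \<in> ball z0 r"
    have "h [] z = 0" using z by (intro r(3)) (simp add: frames_def)
    moreover have "z \<in> D" using z r(2) \<delta>(3) by auto
    ultimately show "z \<in> D \<and> G z = \<Omega> z0 (F z)" by (simp add: h_def jet_simps)
  qed
qed

end


subsection \<open>Lift to the light cone\<close>

text \<open>The hypotheses read in one chart. The metric is replaced by inner products of
  derivatives of \<open>f\<close>, and projection to \<open>U\<close> by testing against its
  elements. With \<open>DIM('v) = n\<close> and \<open>DIM('b) = n + p\<close>, the second part of
  \<open>codim\<close> is \<open>n >= 2 p + 3\<close>.\<close>

locale euclidean_bending =
  fixes D :: "'v::euclidean_space set" and f T :: "'v \<Rightarrow> 'b::euclidean_space" and \<rho> :: "'v \<Rightarrow> real"
  assumes D: "open D" and f: "smooth_on D f" and T: "smooth_on D T" and \<rho>: "smooth_on D \<rho>"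
    and immersion: "\<And>z u. z \<in> D \<Longrightarrow> dir_deriv u f z = 0 \<Longrightarrow> u = 0"
    and bending: "\<And>z u v. z \<in> D \<Longrightarrow> dir_deriv u T z \<bullet> dir_deriv v f z + dir_deriv u f z \<bullet> dir_deriv v T z
      = 2 * \<rho> z * (dir_deriv u f z \<bullet> dir_deriv v f z)"
    and codim: "DIM('b) \<le> DIM('v) + 4" "2 * DIM('b) + 3 \<le> 3 * DIM('v)"
    and nullity: "\<And>z U \<zeta>. z \<in> D \<Longrightarrow> subspace U \<Longrightarrow> 1 \<le> dim U \<Longrightarrow> \<zeta> \<in> U \<Longrightarrow>
      (\<And>\<xi> u. \<xi> \<in> U \<Longrightarrow> \<xi> \<bullet> dir_deriv u f z = 0) \<Longrightarrow>
      dim {u. \<forall>v. \<forall>\<xi>\<in>U. \<xi> \<bullet> dir_deriv u (dir_deriv v f) z = (dir_deriv u f z \<bullet> dir_deriv v f z) * (\<xi> \<bullet> \<zeta>)}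
        + 2 * dim U + 1 \<le> DIM('v)"
begin

text \<open>
  \<open>lift\<close> takes values in the light cone of the Lorentzian form
  \<open>y \<bullet> y' - (a * b' + a' * b) / 2\<close>, and \<open>lifted_bending\<close> is the dual, with respect to that
  form, of the derivative of \<open>y \<mapsto> (y, 1, y \<bullet> y)\<close> along \<open>T\<close> minus \<open>\<rho>\<close> times the lift.
  Subtracting the latter term turns a conformal bending into an isometric one.
\<close>

definition lift :: "'v \<Rightarrow> 'b \<times> real \<times> real" where
  "lift z = (f z, 1, f z \<bullet> f z)"

definition lifted_bending :: "'v \<Rightarrow> 'b \<times> real \<times> real" where
  "lifted_bending z = (T z - \<rho> z *\<^sub>R f z, (1/2) * (\<rho> z * (f z \<bullet> f z)) - f z \<bullet> T z, (1/2) * \<rho> z)"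

section \<open>Smoothness and derivatives of the lift and of its bending\<close>

lemma smooth_on_inner: "smooth_on D h \<Longrightarrow> smooth_on D k \<Longrightarrow> smooth_on D (\<lambda>z. h z \<bullet> k z)"
  by (rule smooth_on_bilinear[OF bounded_bilinear_inner D])

lemma smooth_on_scaleR: "smooth_on D h \<Longrightarrow> smooth_on D k \<Longrightarrow> smooth_on D (\<lambda>z. h z *\<^sub>R k z)"
  by (rule smooth_on_bilinear[OF bounded_bilinear_scaleR D])

lemma smooth_on_mult:
  fixes h k :: "'v \<Rightarrow> real"
  shows "smooth_on D h \<Longrightarrow> smooth_on D k \<Longrightarrow> smooth_on D (\<lambda>z. h z * k z)"
  by (rule smooth_on_bilinear[OF bounded_bilinear_mult D])

lemma smooth_lift: "smooth_on D lift"
  unfolding lift_def by (intro smooth_on_Pair D smooth_on_const smooth_on_inner f)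

lemma smooth_lifted_bending: "smooth_on D lifted_bending"
  unfolding lifted_bending_def
  by (intro smooth_on_Pair smooth_on_diff smooth_on_scaleR smooth_on_mult smooth_on_inner smooth_on_const D f T \<rho>)

lemma dir_deriv_lift:
  assumes "z \<in> D"
  shows "dir_deriv u lift z = (dir_deriv u f z, 0, 2 * (f z \<bullet> dir_deriv u f z))"
proof -
  note d = smooth_on_has_derivative[OF f assms]
  have "(lift has_derivative (\<lambda>u. (dir_deriv u f z, 0, f z \<bullet> dir_deriv u f z + dir_deriv u f z \<bullet> f z))) (at z)"
    unfolding lift_def by (intro has_derivative_Pair has_derivative_const has_derivative_inner d)
  from dir_deriv_eqI[OF this, of u] show ?thesis by (simp add: inner_commute)
qed

lemma dir_deriv2_lift:
  assumes "z \<in> D"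
  shows "dir_deriv u (dir_deriv v lift) z = (dir_deriv u (dir_deriv v f) z, 0,
    2 * (f z \<bullet> dir_deriv u (dir_deriv v f) z + dir_deriv u f z \<bullet> dir_deriv v f z))"
proof -
  note d = smooth_on_has_derivative[OF f assms] smooth_on_has_derivative[OF smooth_on_dir_deriv[OF f] assms]
  have "((\<lambda>z. (dir_deriv v f z, 0::real, 2 * (f z \<bullet> dir_deriv v f z))) has_derivative
      (\<lambda>u. (dir_deriv u (dir_deriv v f) z, 0,
        2 * (f z \<bullet> dir_deriv u (dir_deriv v f) z + dir_deriv u f z \<bullet> dir_deriv v f z)))) (at z)"
    by (intro has_derivative_Pair has_derivative_const has_derivative_mult_right has_derivative_inner d)
  from dir_deriv_eqI[OF this, of u]
  show ?thesis by (subst dir_deriv_cong[OF D assms dir_deriv_lift])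
qed

lemma dir_deriv_lifted_bending:
  assumes "z \<in> D"
  shows "dir_deriv u lifted_bending z =
    (dir_deriv u T z - (\<rho> z *\<^sub>R dir_deriv u f z + dir_deriv u \<rho> z *\<^sub>R f z),
     \<rho> z * (f z \<bullet> dir_deriv u f z) + (1/2) * (dir_deriv u \<rho> z * (f z \<bullet> f z))
       - (f z \<bullet> dir_deriv u T z + dir_deriv u f z \<bullet> T z),
     (1/2) * dir_deriv u \<rho> z)"
proof -
  note d = smooth_on_has_derivative[OF f assms] smooth_on_has_derivative[OF T assms]
    smooth_on_has_derivative[OF \<rho> assms]
  have "(lifted_bending has_derivative (\<lambda>u. (dir_deriv u T z - (\<rho> z *\<^sub>R dir_deriv u f z + dir_deriv u \<rho> z *\<^sub>R f z),
     (1/2) * (\<rho> z * (f z \<bullet> dir_deriv u f z + dir_deriv u f z \<bullet> f z) + dir_deriv u \<rho> z * (f z \<bullet> f z))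
       - (f z \<bullet> dir_deriv u T z + dir_deriv u f z \<bullet> T z),
     (1/2) * dir_deriv u \<rho> z))) (at z)"
    unfolding lifted_bending_def
    by (intro has_derivative_Pair has_derivative_diff has_derivative_scaleR has_derivative_mult
        has_derivative_mult_right has_derivative_inner d)
  from dir_deriv_eqI[OF this, of u] show ?thesis by (simp add: inner_commute algebra_simps)
qed

text \<open>The middle coordinate, 1 for the lift and 0 for its derivatives, separates the position
  from the tangent vectors, so the first-order jets fill dimension \<open>n + 1\<close> and leave at
  most \<open>p + 1\<close> for \<open>Y\<close>, where \<open>n = DIM('v)\<close> and
  \<open>p = DIM('b) - n\<close>.\<close>

lemma dim_orthogonal_to_lift:
  assumes z: "z \<in> D" and Y: "subspace Y" "\<And>\<eta> u. \<eta> \<in> Y \<Longrightarrow> \<eta> \<bullet> lift z = 0 \<and> \<eta> \<bullet> dir_deriv u lift z = 0"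
  shows "dim Y + DIM('v) + 1 \<le> DIM('b) + 2"
proof -
  define \<Lambda> where "\<Lambda> p = fst p *\<^sub>R lift z + dir_deriv (snd p) lift z" for p :: "real \<times> 'v"
  have lin1: "linear (\<lambda>u. dir_deriv u lift z)" by (rule linear_dir_deriv[OF smooth_lift z])
  have \<Lambda>: "linear \<Lambda>"
    by (rule linearI) (simp_all add: \<Lambda>_def linear_add[OF lin1] linear_scale[OF lin1] algebra_simps)
  have "inj \<Lambda>"
    unfolding linear_injective_0[OF \<Lambda>]
    using immersion[OF z] by (auto simp: \<Lambda>_def dir_deriv_lift[OF z] lift_def zero_prod_def)
  then have "dim (range \<Lambda>) = DIM('v) + 1"
    using dim_image_eq[OF \<Lambda>, of UNIV] by simp
  moreover have "dim (range \<Lambda>) + dim Y \<le> dim (UNIV :: ('b \<times> real \<times> real) set)"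
  proof (rule dim_perp_add_le[where b = inner])
    show "bilinear (inner :: 'b \<times> real \<times> real \<Rightarrow> _)"
      using bounded_bilinear_inner bilinear_conv_bounded_bilinear by blast
    show "subspace (range \<Lambda>)" by (intro linear_subspace_image \<Lambda>) simp
    show "x = 0" if "\<And>y. y \<in> UNIV \<Longrightarrow> x \<bullet> y = 0" for x :: "'b \<times> real \<times> real"
      using that[of x] by simp
    show "\<eta> \<bullet> y = 0" if "\<eta> \<in> Y" "y \<in> range \<Lambda>" for \<eta> y
      using Y(2)[OF that(1)] that(2) by (auto simp: \<Lambda>_def inner_add_right)
  qed (use Y in auto)
  ultimately show ?thesis by simp
qed

text \<open>
  \<open>\<xi>\<close> fails to be injective only on multiples of the Lorentzian dual of \<open>lift z\<close>, which pairs
  with the second derivatives of the lift to minus the metric.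
\<close>

lemma lift_nullity:
  assumes z: "z \<in> D" and Y: "subspace Y" "1 \<le> dim Y"
    "\<And>\<eta> u. \<eta> \<in> Y \<Longrightarrow> \<eta> \<bullet> lift z = 0 \<and> \<eta> \<bullet> dir_deriv u lift z = 0"
  shows "dim {u. \<forall>v. \<forall>\<eta>\<in>Y. \<eta> \<bullet> dir_deriv u (dir_deriv v lift) z = 0} + 2 * dim Y + 1 \<le> DIM('v)"
proof -
  let ?N = "{u. \<forall>v. \<forall>\<eta>\<in>Y. \<eta> \<bullet> dir_deriv u (dir_deriv v lift) z = 0}"
  \<comment> \<open>Chosen so that pairing \<open>\<eta>\<close> with a derivative of the lift
    equals pairing \<open>\<xi> \<eta>\<close> with the same derivative of \<open>f\<close>;
    orthogonality to the former makes \<open>\<xi> \<eta>\<close> normal to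
    \<open>f\<close>.\<close>
  define \<xi> where "\<xi> \<eta> = fst \<eta> + (2 * snd (snd \<eta>)) *\<^sub>R f z" for \<eta> :: "'b \<times> real \<times> real"
  have \<xi>: "linear \<xi>" by (rule linearI) (simp_all add: \<xi>_def algebra_simps)
  have \<xi>_normal: "\<xi> \<eta> \<bullet> dir_deriv u f z = 0" if "\<eta> \<in> Y" for \<eta> u
    using Y(3)[OF that, of u] by (cases \<eta>) (simp add: \<xi>_def dir_deriv_lift[OF z] inner_add_left algebra_simps)
  have second: "\<eta> \<bullet> dir_deriv u (dir_deriv v lift) z
      = \<xi> \<eta> \<bullet> dir_deriv u (dir_deriv v f) z + 2 * snd (snd \<eta>) * (dir_deriv u f z \<bullet> dir_deriv v f z)" for \<eta> u v
    by (cases \<eta>) (simp add: \<xi>_def dir_deriv2_lift[OF z] inner_add_left algebra_simps)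
  show ?thesis
  proof (cases "inj_on \<xi> Y")
    case False
    then obtain \<eta>1 \<eta>2 where \<eta>12: "\<eta>1 \<in> Y" "\<eta>2 \<in> Y" "\<xi> \<eta>1 = \<xi> \<eta>2" "\<eta>1 \<noteq> \<eta>2"
      unfolding inj_on_def by blast
    define \<eta> where "\<eta> = \<eta>1 - \<eta>2"
    have \<eta>: "\<eta> \<in> Y" "\<eta> \<noteq> 0" "\<xi> \<eta> = 0"
      using \<eta>12 Y(1) by (auto simp: \<eta>_def subspace_diff linear_diff[OF \<xi>])
    have "snd (snd \<eta>) \<noteq> 0"
    proof
      assume 0: "snd (snd \<eta>) = 0"
      then have "fst \<eta> = 0" using \<eta>(3) by (simp add: \<xi>_def)
      then have "fst (snd \<eta>) = 0" using Y(3)[OF \<eta>(1)] 0 by (cases \<eta>) (simp add: lift_def)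
      then show False using \<eta>(2) 0 \<open>fst \<eta> = 0\<close> by (simp add: prod_eq_iff)
    qed
    have "u = 0" if "u \<in> ?N" for u
    proof -
      have "\<eta> \<bullet> dir_deriv u (dir_deriv u lift) z = 0" using that \<eta>(1) by blast
      then have "dir_deriv u f z \<bullet> dir_deriv u f z = 0"
        using second[of \<eta> u u] \<eta>(3) \<open>snd (snd \<eta>) \<noteq> 0\<close> by simp
      then show ?thesis using immersion[OF z] by simp
    qed
    then have "?N \<subseteq> {0}" by blast
    then have "dim ?N = 0" by (simp add: dim_eq_0)
    \<comment> \<open>With zero nullity, what remains is \<open>2 dim Y + 1 <= n\<close>. It follows
      from \<open>dim Y <= p + 1\<close> and \<open>n >= 2 p + 3\<close>.\<close>
    then show ?thesis using dim_orthogonal_to_lift[OF z Y(1,3)] codim(2) by linarith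
  next
    case True
    let ?U = "\<xi> ` Y"
    have U: "subspace ?U" by (rule linear_subspace_image[OF \<xi> Y(1)])
    have dimU: "dim ?U = dim Y"
      using True Y(1) by (intro dim_image_eq[OF \<xi>]) (simp add: span_eq_iff[THEN iffD2])
    obtain g where g: "linear g" "\<And>\<eta>. \<eta> \<in> Y \<Longrightarrow> g (\<xi> \<eta>) = \<eta>"
      using linear_exists_left_inverse_on[OF \<xi> Y(1) True] by blast
    \<comment> \<open>A functional that takes \<open>\<xi> \<eta>\<close> to minus the coefficient
      of the metric in \<open>second\<close>. The vector \<open>\<zeta>\<close> is its Riesz
      representative in \<open>?U\<close>, obtained by projecting the representative in the whole
      space.\<close>
    define l where "l x = - 2 * snd (snd (g x))" for x
    have l: "linear l" by (rule linearI) (simp_all add: l_def linear_add[OF g(1)] linear_scale[OF g(1)])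
    obtain \<zeta> y where \<zeta>: "\<zeta> \<in> span ?U" "\<And>w. w \<in> span ?U \<Longrightarrow> orthogonal y w" "adjoint l 1 = \<zeta> + y"
      using orthogonal_subspace_decomp_exists by blast
    have \<zeta>U: "\<zeta> \<in> ?U" using \<zeta>(1) U by (metis span_eq_iff)
    have \<xi>\<zeta>: "\<xi> \<eta> \<bullet> \<zeta> = - 2 * snd (snd \<eta>)" if "\<eta> \<in> Y" for \<eta>
    proof -
      have "\<xi> \<eta> \<bullet> y = 0"
        using \<zeta>(2)[of "\<xi> \<eta>"] that by (simp add: span_base orthogonal_def inner_commute)
      then have "\<xi> \<eta> \<bullet> \<zeta> = \<xi> \<eta> \<bullet> adjoint l 1" by (simp add: \<zeta>(3) inner_add_right)
      also have "\<dots> = l (\<xi> \<eta>) \<bullet> 1" by (rule adjoint_works[OF l])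
      finally show ?thesis using g(2)[OF that] by (simp add: l_def)
    qed
    let ?M = "{u. \<forall>v. \<forall>\<xi>\<in>?U. \<xi> \<bullet> dir_deriv u (dir_deriv v f) z = (dir_deriv u f z \<bullet> dir_deriv v f z) * (\<xi> \<bullet> \<zeta>)}"
    have "?N = ?M"
    proof -
      have "\<eta> \<bullet> dir_deriv u (dir_deriv v lift) z = 0 \<longleftrightarrow>
          \<xi> \<eta> \<bullet> dir_deriv u (dir_deriv v f) z = (dir_deriv u f z \<bullet> dir_deriv v f z) * (\<xi> \<eta> \<bullet> \<zeta>)"
        if "\<eta> \<in> Y" for \<eta> u v
        unfolding second \<xi>\<zeta>[OF that] by (auto simp: algebra_simps)
      then show ?thesis by (simp cong: ball_cong)
    qed
    moreover have "dim ?M + 2 * dim ?U + 1 \<le> DIM('v)"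
    proof (rule nullity[OF z U _ \<zeta>U])
      show "1 \<le> dim ?U" using dimU Y(2) by simp
      show "x \<bullet> dir_deriv u f z = 0" if "x \<in> ?U" for x u using that \<xi>_normal by blast
    qed
    ultimately show ?thesis by (simp only: dimU)
  qed
qed

sublocale skew_pair D lift lifted_bending
proof
  show "open D" "smooth_on D lift" "smooth_on D lifted_bending"
    by (rule D smooth_lift smooth_lifted_bending)+
  \<comment> \<open>The middle coordinate of \<open>lifted_bending\<close> is made for this
    identity; derivatives of the lift do not see it, since their own middle coordinate is 0.\<close>
  show "lift z \<bullet> lifted_bending z = 0" if "z \<in> D" for z
    by (simp add: lift_def lifted_bending_def inner_diff_right algebra_simps)
  \<comment> \<open>In each product the terms with a derivative of \<open>\<rho>\<close> cancel.
    What is left of the first is the inner product of the \<open>u\<close>-derivative of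
    \<open>f\<close> with the \<open>v\<close>-derivative of \<open>T\<close>, minus
    \<open>\<rho>\<close> times the metric; the sum is the bending equation.\<close>
  show "dir_deriv u lift z \<bullet> dir_deriv v lifted_bending z + dir_deriv u lifted_bending z \<bullet> dir_deriv v lift z = 0"
    if z: "z \<in> D" for z u v
    using bending[OF z, of u v]
    by (simp add: dir_deriv_lift[OF z] dir_deriv_lifted_bending[OF z] inner_diff_left inner_diff_right
        inner_add_left inner_add_right algebra_simps inner_commute[of "dir_deriv u f z" "f z"]
        inner_commute[of "dir_deriv v f z" "f z"])
  show "a = 0 \<and> u = 0" if "z \<in> D" "a *\<^sub>R lift z + dir_deriv u lift z = 0" for z a u
    using that immersion[OF that(1), of u] by (auto simp: dir_deriv_lift lift_def zero_prod_def)
  show "DIM('b \<times> real \<times> real) \<le> DIM('v) + 6" using codim(1) by simp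
qed (rule lift_nullity)

text \<open>The blocks of the constant skew map are the data of the Killing field: \<open>K\<close>
  the skew endomorphism, \<open>w\<close> the translation, \<open>v'\<close> the special conformal
  part and \<open>m\<close> the dilation. The last coordinate of the equation yields
  \<open>\<rho> = - 2 (f \<bullet> v' + m)\<close>, whence the factors -2 in the witnesses; the
  first coordinate then gives \<open>T\<close>.\<close>

lemma locally_conformal_killing:
  assumes "z0 \<in> D"
  obtains r l v w K where "r > 0" "linear K" "\<And>y z. K y \<bullet> z = - (y \<bullet> K z)"
    "\<And>z. z \<in> ball z0 r \<Longrightarrow> z \<in> D \<and>
      T z = (f z \<bullet> v + l) *\<^sub>R f z - ((1/2) * (norm (f z))\<^sup>2) *\<^sub>R v + K (f z) + w"
proof -
  obtain r \<Omega> where r: "r > 0" and \<Omega>: "linear \<Omega>" and skew: "\<And>x y. \<Omega> x \<bullet> y = - (x \<bullet> \<Omega> y)"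
    and eq: "\<And>z. z \<in> ball z0 r \<Longrightarrow> z \<in> D \<and> lifted_bending z = \<Omega> (lift z)"
    by (rule locally_constant_skew_map[OF assms]) (rule that)
  define K where "K y = fst (\<Omega> (y, 0, 0))" for y
  define w where "w = fst (\<Omega> (0, 1, 0))"
  define v' where "v' = fst (\<Omega> (0, 0, 1))"
  define m where "m = fst (snd (\<Omega> (0, 0, 1)))"
  have K: "linear K"
  proof (rule linearI)
    show "K (x + y) = K x + K y" for x y
      using linear_add[OF \<Omega>, of "(x, 0, 0)" "(y, 0, 0)"] by (simp add: K_def)
    show "K (k *\<^sub>R x) = k *\<^sub>R K x" for k x
      using linear_scale[OF \<Omega>, of k "(x, 0, 0)"] by (simp add: K_def)
  qed
  have inner3: "p \<bullet> q = fst p \<bullet> fst q + fst (snd p) * fst (snd q) + snd (snd p) * snd (snd q)"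
    for p q :: "'b \<times> real \<times> real"
    by (simp add: inner_prod_def)
  show thesis
  proof (rule that[OF r K])
    show "K y \<bullet> z = - (y \<bullet> K z)" for y z
      using skew[of "(y, 0, 0)" "(z, 0, 0)"] by (simp add: K_def inner3)
    fix z assume "z \<in> ball z0 r"
    then have z: "z \<in> D" "lifted_bending z = \<Omega> (lift z)" using eq by auto
    have "snd (snd (\<Omega> (0, 0, 1))) = 0"
      using skew[of "(0, 0, 1)" "(0, 0, 1)"] by (simp add: inner3)
    then have "\<Omega> (lift z) \<bullet> (0, 0, 1) = - (f z \<bullet> v' + m)"
      unfolding skew by (simp add: inner3 lift_def v'_def m_def)
    then have \<rho>z: "\<rho> z = - 2 * (f z \<bullet> v' + m)"
      using arg_cong[OF z(2), of "\<lambda>p. p \<bullet> (0, 0, 1)"] by (simp add: lifted_bending_def inner3)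
    have "lift z = (f z, 0, 0) + (0, 1, 0) + (f z \<bullet> f z) *\<^sub>R (0, 0, 1)" by (simp add: lift_def)
    then have "\<Omega> (lift z) = \<Omega> (f z, 0, 0) + \<Omega> (0, 1, 0) + (f z \<bullet> f z) *\<^sub>R \<Omega> (0, 0, 1)"
      by (simp only: linear_add[OF \<Omega>] linear_scale[OF \<Omega>])
    then have "fst (\<Omega> (lift z)) = K (f z) + w + (f z \<bullet> f z) *\<^sub>R v'"
      by (simp add: K_def w_def v'_def)
    then have "T z - \<rho> z *\<^sub>R f z = K (f z) + w + (f z \<bullet> f z) *\<^sub>R v'"
      using arg_cong[OF z(2), of fst] by (simp add: lifted_bending_def)
    then have "T z = \<rho> z *\<^sub>R f z + K (f z) + w + (f z \<bullet> f z) *\<^sub>R v'" by (simp add: algebra_simps)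
    then show "z \<in> D \<and> T z = (f z \<bullet> ((-2) *\<^sub>R v') + (- 2 * m)) *\<^sub>R f z
        - ((1/2) * (norm (f z))\<^sup>2) *\<^sub>R ((-2) *\<^sub>R v') + K (f z) + w"
      using z(1) by (simp add: \<rho>z power2_norm_eq_inner algebra_simps)
  qed
qed

end

subsection \<open>Charts and the second fundamental form\<close>

lemma orth_proj_eqI:
  assumes "subspace U" "y \<in> U" "\<And>z. z \<in> U \<Longrightarrow> orthogonal (w - y) z"
  shows "orth_proj U w = y"
  unfolding orth_proj_def
proof (rule the_equality)
  show "y \<in> U \<and> (\<forall>z\<in>U. orthogonal (w - y) z)" using assms by blast
  fix y' assume y': "y' \<in> U \<and> (\<forall>z\<in>U. orthogonal (w - y') z)"
  have d: "y' - y \<in> U" using y' assms by (simp add: subspace_diff)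
  have "(w - y) \<bullet> (y' - y) = 0" "(w - y') \<bullet> (y' - y) = 0"
    using y' assms(3) d by (auto simp: orthogonal_def)
  then have "(y' - y) \<bullet> (y' - y) = 0" by (simp add: inner_diff_left)
  then show "y' = y" by simp
qed

lemma orthogonal_orth_proj:
  assumes "subspace U" "z \<in> U"
  shows "orthogonal (w - orth_proj U w) z"
proof -
  obtain y y' where y: "y \<in> span U" "\<And>z. z \<in> span U \<Longrightarrow> orthogonal y' z" "w = y + y'"
    using orthogonal_subspace_decomp_exists by blast
  have "orth_proj U w = y"
    by (rule orth_proj_eqI) (use y assms(1) in \<open>auto simp: span_eq_iff[THEN iffD2]\<close>)
  then show ?thesis using y assms by (simp add: span_base)
qed

lemma in_chart_apply:
  assumes "chart_on M c" "x \<in> fst c"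
  shows "in_chart c h (snd c x) = h x"
proof -
  have "openin M (fst c)" "homeomorphic_map (subtopology M (fst c)) (top_of_set (snd c ` fst c)) (snd c)"
    using assms(1) by (auto simp: chart_on_def)
  then have "inj_on (snd c) (fst c)"
    using homeomorphic_imp_injective_map openin_subset by (fastforce simp: Int_absorb1)
  then show ?thesis using assms(2) by (simp add: in_chart_def)
qed

lemma open_preimage_chart:
  assumes "chart_on M c" "open B"
  shows "openin M {x \<in> fst c. snd c x \<in> B}"
proof -
  have o: "openin M (fst c)" and h: "homeomorphic_map (subtopology M (fst c)) (top_of_set (snd c ` fst c)) (snd c)"
    using assms(1) by (auto simp: chart_on_def)
  have top: "topspace (subtopology M (fst c)) = fst c"
    using openin_subset[OF o] by auto
  have "continuous_map (subtopology M (fst c)) euclidean (snd c)"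
    using homeomorphic_imp_continuous_map[OF h] continuous_map_in_subtopology by blast
  then have "openin (subtopology M (fst c)) {x \<in> topspace (subtopology M (fst c)). snd c x \<in> B}"
    using assms(2) by (intro openin_continuous_map_preimage) auto
  then show ?thesis unfolding top openin_open_subtopology[OF o] by blast
qed

lemma differential_eq_dir_deriv: "differential c h x u = dir_deriv u (in_chart c h) (snd c x)"
  by (simp add: differential_def dir_deriv_def)

lemma second_differential_eq_dir_deriv:
  assumes "chart_on M c" "x \<in> fst c"
  shows "differential c (\<lambda>y. differential c f y v) x u = dir_deriv u (dir_deriv v (in_chart c f)) (snd c x)"
proof -
  have "open (snd c ` fst c)" using assms(1) by (simp add: chart_on_def)
  then show ?thesis
    unfolding differential_eq_dir_deriv
    by (rule dir_deriv_cong) (use assms in \<open>auto simp: in_chart_apply\<close>)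
qed

theorem theorem3:
  fixes M :: "'a topology"
    and A :: "('a, 'n::finite) chart set"
    and g :: "('a, 'n) metric"
    and f :: "'a \<Rightarrow> real ^ 'm::finite"
    and p :: nat
  assumes "riemannian_manifold M A g"
    and "isometric_immersion A g f"
    and "CARD('m) = CARD('n) + p"
    and "CARD('n) \<ge> 2 * p + 3"
    and "1 \<le> p" and "p \<le> 4"
    and "\<forall>x\<in>topspace M. \<forall>s\<in>{1..p}. conformal_nullity A g f s x \<le> CARD('n) - 2 * s - 1"
  shows "conformally_infinitesimally_rigid M A g f"
  unfolding conformally_infinitesimally_rigid_def trivial_bending_def
proof (intro allI impI ballI)
  fix \<rho> T x0 assume bend: "conformal_infinitesimal_bending A g f \<rho> T" and x0: "x0 \<in> topspace M"
  have charts: "\<And>c. c \<in> A \<Longrightarrow> chart_on M c" and cover: "(\<Union>c\<in>A. fst c) = topspace M"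
    using assms(1) by (auto simp: riemannian_manifold_def smooth_manifold_def)
  obtain c where c: "c \<in> A" "x0 \<in> fst c" using x0 cover by blast
  note chart = charts[OF c(1)]
  define D where "D = snd c ` fst c"
  have sub: "fst c \<subseteq> topspace M" using cover c(1) by blast
  have iso: "inj (differential c f x)" "differential c f x u \<bullet> differential c f x v = g c x u v"
    if "x \<in> fst c" for x u v
    using assms(2) c(1) that by (auto simp: isometric_immersion_def)
  interpret euclidean_bending D "in_chart c f" "in_chart c T" "in_chart c \<rho>"
  proof
    show "open D" using chart by (simp add: D_def chart_on_def)
    show "smooth_on D (in_chart c f)" "smooth_on D (in_chart c T)" "smooth_on D (in_chart c \<rho>)"
      using assms(2) bend c(1)
      by (auto simp: D_def isometric_immersion_def conformal_infinitesimal_bending_def smooth_map_def)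
    then have lin: "linear (\<lambda>u. dir_deriv u (in_chart c f) z)" if "z \<in> D" for z
      using linear_dir_deriv that by blast
    show "u = 0" if z: "z \<in> D" "dir_deriv u (in_chart c f) z = 0" for z u
    proof -
      obtain x where x: "x \<in> fst c" "z = snd c x" using z(1) by (auto simp: D_def)
      then have "differential c f x u = differential c f x 0"
        using z(2) linear_0[OF lin[OF z(1)]] by (simp add: differential_eq_dir_deriv)
      then show ?thesis using iso(1)[OF x(1)] by (simp add: inj_def)
    qed
    show "dir_deriv u (in_chart c T) z \<bullet> dir_deriv v (in_chart c f) z
        + dir_deriv u (in_chart c f) z \<bullet> dir_deriv v (in_chart c T) z
      = 2 * in_chart c \<rho> z * (dir_deriv u (in_chart c f) z \<bullet> dir_deriv v (in_chart c f) z)"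
      if z: "z \<in> D" for z u v
    proof -
      obtain x where x: "x \<in> fst c" "z = snd c x" using z by (auto simp: D_def)
      then show ?thesis
        using bend c(1) iso(2)[OF x(1)]
        by (simp add: conformal_infinitesimal_bending_def in_chart_apply[OF chart]
            flip: differential_eq_dir_deriv)
    qed
    show "DIM(real^'m) \<le> DIM(real^'n) + 4" "2 * DIM(real^'m) + 3 \<le> 3 * DIM(real^'n)"
      using assms(3-6) by simp_all
    fix z U \<zeta>
    assume z: "z \<in> D" and U: "subspace U" "1 \<le> dim U" "\<zeta> \<in> U"
      and normal: "\<And>\<xi> u. \<xi> \<in> U \<Longrightarrow> \<xi> \<bullet> dir_deriv u (in_chart c f) z = 0"
    obtain x where x: "x \<in> fst c" "z = snd c x" using z by (auto simp: D_def)
    let ?N = "{u. \<forall>v. \<forall>\<xi>\<in>U. \<xi> \<bullet> dir_deriv u (dir_deriv v (in_chart c f)) z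
      = (dir_deriv u (in_chart c f) z \<bullet> dir_deriv v (in_chart c f) z) * (\<xi> \<bullet> \<zeta>)}"
    have Un: "U \<subseteq> normal_space c f x"
      using normal x by (auto simp: normal_space_def orthogonal_comp_def orthogonal_def
          differential_eq_dir_deriv inner_commute)
    have sn: "subspace (normal_space c f x)"
      unfolding normal_space_def by (rule subspace_orthogonal_comp)
    have lin_df: "linear (differential c f x)"
      using lin[OF z] x by (simp add: differential_eq_dir_deriv[abs_def])
    \<comment> \<open>The hypothesis on nullities covers \<open>s\<close> in \<open>{1..p}\<close>
      only; normality of \<open>U\<close> to the \<open>n\<close>-dimensional tangent space keeps
      \<open>dim U\<close> in that range.\<close>
    have dimU: "dim U \<le> p"
    proof -
      have "dim (range (differential c f x)) + dim U \<le> dim (UNIV :: (real^'m) set)"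
      proof (rule dim_perp_add_le[where b = inner])
        show "bilinear (inner :: real^'m \<Rightarrow> _)"
          using bounded_bilinear_inner bilinear_conv_bounded_bilinear by blast
        show "subspace (range (differential c f x))" by (intro linear_subspace_image lin_df) simp
        show "w = 0" if "\<And>y. y \<in> UNIV \<Longrightarrow> w \<bullet> y = 0" for w :: "real^'m" using that[of w] by simp
        show "\<xi> \<bullet> y = 0" if "\<xi> \<in> U" "y \<in> range (differential c f x)" for \<xi> y
          using normal[OF that(1)] that(2) x by (auto simp: differential_eq_dir_deriv)
      qed (use U in auto)
      moreover have "dim (range (differential c f x)) = CARD('n)"
        using dim_image_eq[OF lin_df, of UNIV] iso(1)[OF x(1)] by simp
      ultimately show ?thesis using assms(3) by simp
    qed
    have "?N \<subseteq> nullity_space c g f x U \<zeta>"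
    proof
      fix u assume u: "u \<in> ?N"
      have "orth_proj U (second_fundamental_form c f x u v) = g c x u v *\<^sub>R \<zeta>" for v
      proof (rule orth_proj_eqI[OF U(1)])
        show "g c x u v *\<^sub>R \<zeta> \<in> U" using U by (simp add: subspace_scale)
        fix \<xi> assume \<xi>: "\<xi> \<in> U"
        let ?w = "differential c (\<lambda>y. differential c f y v) x u"
        have "orthogonal (?w - second_fundamental_form c f x u v) \<xi>"
          unfolding second_fundamental_form_def using \<xi> Un by (intro orthogonal_orth_proj[OF sn]) blast
        then have "second_fundamental_form c f x u v \<bullet> \<xi> = ?w \<bullet> \<xi>"
          by (simp add: orthogonal_def inner_diff_left)
        also have "\<dots> = \<xi> \<bullet> dir_deriv u (dir_deriv v (in_chart c f)) z"
          unfolding second_differential_eq_dir_deriv[OF chart x(1)] x(2) by (rule inner_commute)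
        also have "\<dots> = (dir_deriv u (in_chart c f) z \<bullet> dir_deriv v (in_chart c f) z) * (\<xi> \<bullet> \<zeta>)"
          using u \<xi> by blast
        also have "\<dots> = g c x u v * (\<xi> \<bullet> \<zeta>)"
          using iso(2)[OF x(1), of u v] x(2) by (simp add: differential_eq_dir_deriv)
        finally show "orthogonal (second_fundamental_form c f x u v - g c x u v *\<^sub>R \<zeta>) \<xi>"
          by (simp add: orthogonal_def inner_diff_left inner_commute[of \<zeta>])
      qed
      then show "u \<in> nullity_space c g f x U \<zeta>" by (simp add: nullity_space_def)
    qed
    then have "dim ?N \<le> dim (nullity_space c g f x U \<zeta>)" by (rule dim_subset)
    also have "\<dots> \<le> conformal_nullity A g f (dim U) x"
      unfolding conformal_nullity_def
    proof (rule Max_ge)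
      \<comment> \<open>\<open>Max\<close> bounds its elements only for finite sets; here every
        dimension is at most \<open>CARD('n)\<close>.\<close>
      show "finite {dim (nullity_space c g f x V \<zeta>) | c V \<zeta>.
          c \<in> A \<and> x \<in> fst c \<and> subspace V \<and> V \<subseteq> normal_space c f x \<and> dim V = dim U \<and> \<zeta> \<in> V}"
        by (rule finite_subset[of _ "{..CARD('n)}"]) (auto intro: order_trans[OF dim_subset_UNIV])
    qed (use c(1) x(1) U Un in blast)
    also have "\<dots> \<le> CARD('n) - 2 * dim U - 1"
      using assms(7) sub x(1) U(2) dimU by auto
    \<comment> \<open>The subtraction of naturals is not truncated: \<open>dim U <= p\<close> and
      \<open>n >= 2 p + 3\<close> give \<open>2 dim U + 1 <= n\<close>.\<close>
    finally show "dim ?N + 2 * dim U + 1 \<le> DIM(real^'n)"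
      using dimU assms(4) by simp
  qed
  have "snd c x0 \<in> D" using c(2) by (simp add: D_def)
  then obtain r l v w K where r: "r > 0" and K: "linear K" "\<And>y z. K y \<bullet> z = - (y \<bullet> K z)"
    and eq: "\<And>z. z \<in> ball (snd c x0) r \<Longrightarrow> z \<in> D \<and> in_chart c T z =
      (in_chart c f z \<bullet> v + l) *\<^sub>R in_chart c f z - ((1/2) * (norm (in_chart c f z))\<^sup>2) *\<^sub>R v
        + K (in_chart c f z) + w"
    by (rule locally_conformal_killing) (rule that)
  define V where "V y = (y \<bullet> v + l) *\<^sub>R y - ((1/2) * (norm y)\<^sup>2) *\<^sub>R v + K y + w" for y
  let ?W = "{x \<in> fst c. snd c x \<in> ball (snd c x0) r}"
  have "openin M ?W" by (rule open_preimage_chart[OF chart open_ball])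
  moreover have "x0 \<in> ?W" using c(2) r by simp
  moreover have "conformal_killing_field V"
    unfolding conformal_killing_field_def V_def using K by blast
  moreover have "\<forall>y\<in>?W. T y = V (f y)"
  proof
    fix y assume "y \<in> ?W"
    then have y: "y \<in> fst c" "snd c y \<in> ball (snd c x0) r" by auto
    show "T y = V (f y)"
      using eq[OF y(2)] unfolding V_def in_chart_apply[OF chart y(1)] by blast
  qed
  ultimately show "\<exists>W V. openin M W \<and> x0 \<in> W \<and> conformal_killing_field V \<and> (\<forall>y\<in>W. T y = V (f y))"
    by blast
qed

end
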